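(* Let $\{V(u),|u|=1\}$ be the points of a point process $\Theta$ on $\mathbb{R}$, with $\nu:=\sum_{|u|=1}1$, and assume that there is a constant $\chi\in(0,1]$ such that $$\mathbb{E}\Big[\sum_{|u|=1}e^{-\chi V(u)}\Big]\le 1\qquad\text{and}\qquad \mathbb{E}[\nu]\in(1,\infty].$$ Let $Z\ge 0$ be a non-trivial solution of the equation in law $$Z\ \overset{\text{law}}{=}\ \sum_{|u|=1}e^{-V(u)}Z^{(u)},$$ where, conditionally on $\{V(u),|u|=1\}$, the $(Z^{(u)})_{|u|=1}$ are independent copies of $Z$. (The Schröder case) Assume that there is a constant $\gamma>0$ with $$\mathbb{E}\Big[1_{(\nu\ge1)}\,q^{\nu-1}\sum_{|u|=1}e^{\gamma V(u)}\Big]=1,$$ and that $\mathbb{E}\big[\sum_{|u|=1}e^{aV(u)}\big]<\infty$ for some $a>\gamma$. Then $$\mathbb{P}(0<Z<\varepsilon)\asymp\varepsilon^{\gamma}\quad\text{as }\varepsilon\to0,$$ and $\mathbb{E}\big[e^{-tZ}1_{(Z>0)}\big]\asymp t^{-\gamma}$ as $t\to\infty$. (The Böttcher case) Assume that $p_0=p_1=0$, that $\sup_{|u|=1}V(u)\le K$ for some constant $K>0$, and that $\sum_{|u|=1}e^{-\chi V(u)}\not\equiv1$ (i.e. this sum is not almost surely equal to $1$). Let $$\beta:=\sup\Big\{a>0:\ \mathbb{P}\Big(\sum_{|u|=1}e^{-aV(u)}\ge1\Big)=1\Big\}.$$ Then $$\mathbb{E}\big[e^{-tZ}\big]=e^{-t^{\beta+o(1)}},\qquad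 t\to\infty,$$ and $\mathbb{P}(Z<\varepsilon)=e^{-\varepsilon^{-\frac{\beta}{1-\beta}+o(1)}}$ as $\varepsilon\to0$.
   Context: $\Theta=\sum_{|u|=1}\delta_{V(u)}$ is the point process of first-generation positions of a branching random walk: one particle at the origin produces children at the points of $\Theta$, and every particle independently produces children whose displacements relative to it form an independent copy of $\Theta$. $\mathbb{T}$ is the associated Galton-Watson genealogical tree, whose offspring number is distributed as $\nu$; $p_j:=\mathbb{P}(\nu=j)$ for $j\ge 0$; $q:=\mathbb{P}(\mathbb{T}\text{ is finite})\in[0,1)$ is the extinction probability. Conventions: $\sum_\emptyset:=0$ and $0^0=1$ (so that when $q=0$ the equation defining $\gamma$ reads $\mathbb{E}[1_{(\nu=1)}\sum_{|u|=1}e^{\gamma V(u)}]=1$). A solution $Z$ is non-trivial if $Z$ is a nonnegative (finite) random variable that is not almost surely $0$. $f(x)\asymp g(x)$ as $x\to x_0$ means $0<\liminf_{x\to x_0}f(x)/g(x)\le\limsup_{x\to x_0}f(x)/g(x)<\infty$. *)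

theory Defs
  imports "HOL-Probability.Probability"
begin

text \<open>
  A point process on the line, given through an enumeration of its points: under \<open>M\<close>, the points
  are \<open>V i \<omega>\<close> for \<open>i < \<nu> \<omega>\<close>, listed with multiplicity.  The index \<open>i\<close> plays the role of a vertex
  \<open>u\<close> with \<open>|u| = 1\<close>.  The number of points may be infinite, and the values \<open>V i \<omega>\<close> with
  \<open>i \<ge> \<nu> \<omega>\<close> are irrelevant.
\<close>

locale point_process = prob_space M for M :: "'a measure" +
  fixes \<nu> :: "'a \<Rightarrow> enat" and V :: "nat \<Rightarrow> 'a \<Rightarrow> real"
  assumes measurable_number: "\<nu> \<in> measurable M (count_space UNIV)"
    and measurable_position: "\<And>i. V i \<in> borel_measurable M"

definition child_sum :: "('a \<Rightarrow> enat) \<Rightarrow> 'a \<Rightarrow> (nat \<Rightarrow> ennreal) \<Rightarrow> ennreal" where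
  "child_sum \<nu> \<omega> f = (\<Sum>i. if enat i < \<nu> \<omega> then f i else 0)"

text \<open>
  In Ulam--Harris notation the individuals are finite words; every word \<open>u\<close> carries its
  own independent copy \<open>\<omega> u\<close> of the reproduction randomness, and the children of \<open>u\<close> are the words
  \<open>u @ [i]\<close> with \<open>i < \<nu> (\<omega> u)\<close>.
\<close>

definition gw_tree :: "('a \<Rightarrow> enat) \<Rightarrow> (nat list \<Rightarrow> 'a) \<Rightarrow> nat list set" where
  "gw_tree \<nu> \<omega> = {u. \<forall>k<length u. enat (u ! k) < \<nu> (\<omega> (take k u))}"

definition extinction_prob :: "'a measure \<Rightarrow> ('a \<Rightarrow> enat) \<Rightarrow> real" where
  "extinction_prob M \<nu> =
     measure (\<Pi>\<^sub>M u\<in>(UNIV :: nat list set). M)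
       {\<omega> \<in> space (\<Pi>\<^sub>M u\<in>(UNIV :: nat list set). M). finite (gw_tree \<nu> \<omega>)}"

text \<open>
  The factor \<open>1_{(n \<ge> 1)} q^(n - 1)\<close>, where \<open>q < 1\<close> and hence \<open>q^\<infinity> = 0\<close>.
\<close>

definition schroeder_weight :: "real \<Rightarrow> enat \<Rightarrow> ennreal" where
  "schroeder_weight q n =
     (case n of enat k \<Rightarrow> if k \<ge> 1 then ennreal (q ^ (k - 1)) else 0 | \<infinity> \<Rightarrow> 0)"

text \<open>
  The law of the sum of \<open>e^(- V(u)) Z\<^sup>u\<close> over \<open>|u| = 1\<close>, where conditionally on the point process the
  \<open>Z\<^sup>u\<close> are independent with law \<open>L\<close>: the point process and the i.i.d. sequence are realised on
  a product space, and only the entries \<open>z i\<close> with \<open>i < \<nu> \<omega>\<close> enter the sum.  The sum is taken in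
  \<open>[0, \<infinity>]\<close>, so that it always makes sense.
\<close>

definition smoothing_law ::
    "'a measure \<Rightarrow> ('a \<Rightarrow> enat) \<Rightarrow> (nat \<Rightarrow> 'a \<Rightarrow> real) \<Rightarrow> real measure \<Rightarrow> ennreal measure" where
  "smoothing_law M \<nu> V L =
     distr (M \<Otimes>\<^sub>M (\<Pi>\<^sub>M i\<in>(UNIV :: nat set). L)) borel
       (\<lambda>(\<omega>, z). child_sum \<nu> \<omega> (\<lambda>i. ennreal (exp (- V i \<omega>)) * ennreal (z i)))"

definition nontrivial_solution ::
    "'a measure \<Rightarrow> ('a \<Rightarrow> enat) \<Rightarrow> (nat \<Rightarrow> 'a \<Rightarrow> real) \<Rightarrow> 'b measure \<Rightarrow> ('b \<Rightarrow> real) \<Rightarrow> bool" where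
  "nontrivial_solution M \<nu> V P Z \<longleftrightarrow>
     prob_space P \<and> Z \<in> borel_measurable P \<and>
     (AE x in P. 0 \<le> Z x) \<and> \<not> (AE x in P. Z x = 0) \<and>
     distr P borel (\<lambda>x. ennreal (Z x)) = smoothing_law M \<nu> V (distr P borel Z)"

text \<open>
  For the processes considered here the set below is nonempty and bounded above, so the
  supremum in the reals is the intended one.
\<close>

definition boettcher_exponent ::
    "'a measure \<Rightarrow> ('a \<Rightarrow> enat) \<Rightarrow> (nat \<Rightarrow> 'a \<Rightarrow> real) \<Rightarrow> real" where
  "boettcher_exponent M \<nu> V =
     Sup {a. a > 0 \<and>
       measure M {\<omega> \<in> space M. child_sum \<nu> \<omega> (\<lambda>i. ennreal (exp (- a * V i \<omega>))) \<ge> 1} = 1}"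

definition same_order :: "('x \<Rightarrow> real) \<Rightarrow> ('x \<Rightarrow> real) \<Rightarrow> 'x filter \<Rightarrow> bool" where
  "same_order f g F \<longleftrightarrow>
     0 < Liminf F (\<lambda>x. ereal (f x / g x)) \<and>
     Liminf F (\<lambda>x. ereal (f x / g x)) \<le> Limsup F (\<lambda>x. ereal (f x / g x)) \<and>
     Limsup F (\<lambda>x. ereal (f x / g x)) < \<infinity>"

end

theory Submission
  imports Defs
begin

text \<open>
  Let \<open>\<phi>\<close> be the Laplace transform of \<open>Z\<close> and \<open>\<Phi> x = \<phi> (e\<^sup>x)\<close>.  In both cases the number of children is
  almost surely finite, so the equation in law reads \<open>\<Phi> x = E[\<Prod>\<^sub>i \<Phi> (x - V\<^sub>i)]\<close>.

  In the Schroeder case \<open>P(Z = 0)\<close> and \<open>q\<close> solve the same fixed point equation, hence they agree, and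
  \<open>\<psi> = \<Phi> - q\<close> is the part of the transform coming from \<open>Z > 0\<close>.  Linearising the product around \<open>q\<close>
  gives \<open>\<psi> x \<ge> \<integral> \<psi> (x - s) d\<mu>\<close>, where \<open>\<mu>\<close> has mass less than 1, \<open>\<integral> e\<^bsup>\<gamma>s\<^esup> d\<mu> = 1\<close> and
  \<open>\<integral> e\<^bsup>as\<^esup> d\<mu> > 1\<close>.  Mass below 1 yields a maximum principle, and \<open>\<psi>\<close> is compared with
  \<open>e\<^bsup>-\<gamma>x\<^esup> \<plusminus> B e\<^bsup>-ax\<^esup>\<close>, truncated far to the left.  For the upper bound the error of the linearisation has
  to be \<open>O(e\<^bsup>-ax\<^esup>)\<close>; being quadratic in \<open>\<psi>\<close>, it is so once \<open>\<psi> = O(e\<^bsup>-ax/2\<^esup>)\<close>, which in turn follows from the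
  maximum principle for \<open>\<mu>\<close> with \<open>q\<close> replaced by a slightly larger number.

  In the Boettcher case \<open>u = - ln \<Phi>\<close> satisfies \<open>u x \<ge> ess inf \<Sum>\<^sub>i u (x - V\<^sub>i)\<close>, and for \<open>a < \<beta>\<close> the sum
  \<open>\<Sum>\<^sub>i e\<^bsup>-aV\<^sub>i\<^esup>\<close> exceeds 1 by a fixed amount, which propagates a bound \<open>u x \<ge> c e\<^bsup>ax\<^esup>\<close>.  For \<open>a > \<beta>\<close> the sum is
  less than \<open>1 - \<eta>\<close> with positive probability, and restricting the expectation to this event propagates
  \<open>u x \<le> C e\<^bsup>ax\<^esup>\<close>.  Exponential Chebyshev estimates transfer both results to the law of \<open>Z\<close> near 0.
\<close>

section \<open>Renewal inequalities\<close>

text \<open>The kernel has mass below 1 because the weight \<open>q ^ (N - 1)\<close> is less than 1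
  whenever there are at least two children: this makes the moment at \<open>- \<kappa>\<close>
  strictly less than 1, and convexity carries the strict inequality to all exponents from
  \<open>- \<kappa>\<close> up to, but excluding, \<open>\<gamma>\<close>, in particular to 0. The
  number of children is finite because the moment conditions, or the bound \<open>K\<close> on the
  displacements, keep the summands of an integrable sum away from 0. Two obstacles shape the
  estimates. Only first moments of the sums are available, whereas a quadratic error contains the
  square of a sum; a factor b ^ (N - 2) with b < 1 absorbs the number of children that
  Cauchy-Schwarz produces. Moreover, displacements may have either sign. In the Schroeder case large
  displacements are paid for by the moment at \<open>a\<close>; in the Boettcher case negative ones
  are clipped at 0 for one bound, and are absent on the chosen event for the other.\<close>

lemma exp_le_exp_add_exp:
  fixes \<kappa> a c s :: real
  assumes "- \<kappa> \<le> c" "c \<le> a"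
  shows "exp (c * s) \<le> exp (- \<kappa> * s) + exp (a * s)"
proof (cases "0 \<le> s")
  case True
  then have "exp (c * s) \<le> exp (a * s)" using assms by (simp add: mult_right_mono)
  then show ?thesis by (simp add: add_increasing)
next
  case False
  then have "exp (c * s) \<le> exp (- \<kappa> * s)" using mult_right_mono_neg[OF assms(1), of s] by simp
  then show ?thesis by (simp add: add_increasing2)
qed

text \<open>If the infimum i of \<open>D\<close> were negative, averaging \<open>D\<close> against a
  kernel of mass m < 1 would give at least i * m > i from \<open>x0\<close> on, while
  \<open>D\<close> is nonnegative before \<open>x0\<close>; so i * m would be a larger lower bound.
  The infimum need not be attained, and the kernel may charge both half-lines.\<close>

lemma max_principle:
  fixes \<mu> :: "real measure" and D :: "real \<Rightarrow> real"
  assumes "finite_measure \<mu>" and mass: "measure \<mu> (space \<mu>) < 1"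
    and nonneg: "\<And>x. x < x0 \<Longrightarrow> 0 \<le> D x"
    and bdd: "\<And>x. x0 \<le> x \<Longrightarrow> - C \<le> D x"
    and int: "\<And>x. x0 \<le> x \<Longrightarrow> integrable \<mu> (\<lambda>s. D (x - s))"
    and super: "\<And>x. x0 \<le> x \<Longrightarrow> (\<integral>s. D (x - s) \<partial>\<mu>) \<le> D x"
  shows "0 \<le> D x"
proof -
  interpret finite_measure \<mu> by fact
  define i where "i = Inf (range D)"
  have "bdd_below (range D)"
  proof (rule bdd_belowI2)
    show "- \<bar>C\<bar> \<le> D y" for y
      using nonneg[of y] bdd[of y] by (cases "x0 \<le> y") auto
  qed
  then have i_le: "i \<le> D y" for y
    unfolding i_def by (rule cINF_lower) simp
  have "0 \<le> i"
  proof (rule ccontr)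
    assume "\<not> 0 \<le> i"
    have "i * measure \<mu> (space \<mu>) \<le> D y" for y
    proof (cases "x0 \<le> y")
      case True
      have "i * measure \<mu> (space \<mu>) = (\<integral>s. i \<partial>\<mu>)" by simp
      also have "\<dots> \<le> (\<integral>s. D (y - s) \<partial>\<mu>)"
        using True by (intro integral_mono int i_le) auto
      also have "\<dots> \<le> D y" by (rule super[OF True])
      finally show ?thesis .
    next
      case False
      have "i * measure \<mu> (space \<mu>) \<le> 0"
        using \<open>\<not> 0 \<le> i\<close> by (simp add: mult_nonpos_nonneg)
      also have "\<dots> \<le> D y" using nonneg False by simp
      finally show ?thesis .
    qed
    then have "i * measure \<mu> (space \<mu>) \<le> i"
      unfolding i_def by (intro cINF_greatest) auto
    moreover have "i * 1 < i * measure \<mu> (space \<mu>)"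
      using \<open>\<not> 0 \<le> i\<close> mass by (intro mult_strict_left_mono_neg) auto
    ultimately show False by simp
  qed
  then show ?thesis using i_le[of x] by simp
qed

text \<open>Since the moment at \<open>c\<close> is strictly below 1,
  \<open>A * exp (- c * x)\<close> exceeds its own average by a fixed fraction of itself, and
  because \<open>c \<le> a\<close> this slack absorbs the error for x >= 0. The entry 1 in the
  maximum defining \<open>A\<close> handles x < 0, where only \<psi> \<le> 1 is known; the other
  entry makes the slack large enough.\<close>

lemma crude_upper_bound:
  fixes \<mu> :: "real measure" and \<psi> :: "real \<Rightarrow> real"
  assumes "finite_measure \<mu>" and [simp, measurable_cong]: "sets \<mu> = sets borel"
    and mass: "measure \<mu> (space \<mu>) < 1"
    and [measurable]: "\<psi> \<in> borel_measurable borel"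
    and nonneg: "\<And>x. 0 \<le> \<psi> x" and le1: "\<And>x. \<psi> x \<le> 1"
    and c: "0 \<le> c" "c \<le> a" "integrable \<mu> (\<lambda>s. exp (c * s))" "(\<integral>s. exp (c * s) \<partial>\<mu>) < 1"
    and sub: "\<And>x. 0 \<le> x \<Longrightarrow> \<psi> x \<le> (\<integral>s. \<psi> (x - s) \<partial>\<mu>) + C * exp (- a * x)"
  obtains A where "0 < A" "\<And>x. \<psi> x \<le> A * exp (- c * x)"
proof -
  interpret finite_measure \<mu> by fact
  let ?m = "\<integral>s. exp (c * s) \<partial>\<mu>"
  define A where "A = max 1 (C / (1 - ?m))"
  have A: "1 \<le> A" "C \<le> A * (1 - ?m)"
    using c mult_right_mono[of "C / (1 - ?m)" A "1 - ?m"] by (auto simp: A_def)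
  define D where "D x = A * exp (- c * x) - \<psi> x" for x
  have int\<psi>: "integrable \<mu> (\<lambda>s. \<psi> (x - s))" for x
    by (rule integrable_const_bound[where B = 1]) (auto simp: le1 nonneg)
  have e: "exp (- c * (x - s)) = exp (- c * x) * exp (c * s)" for x s
    by (simp add: exp_add[symmetric] algebra_simps)
  have inte: "integrable \<mu> (\<lambda>s. exp (- c * (x - s)))" for x
    unfolding e using c by (intro integrable_mult_right) auto
  have "0 \<le> D x" for x
  proof (rule max_principle[of \<mu> 0 D 1])
    show "finite_measure \<mu>" by unfold_locales
    show "measure \<mu> (space \<mu>) < 1" by (rule mass)
    show "0 \<le> D y" if "y < 0" for y
    proof -
      have "1 \<le> exp (- c * y)" using that c by (simp add: mult_nonneg_nonpos)
      then have "1 \<le> A * exp (- c * y)" using A(1) mult_mono[of 1 A 1 "exp (- c * y)"] by simp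
      then show ?thesis using le1[of y] by (simp add: D_def)
    qed
    show "- 1 \<le> D y" for y
    proof -
      have "0 \<le> A * exp (- c * y)" using A(1) by simp
      then show ?thesis using le1[of y] unfolding D_def by linarith
    qed
    show "integrable \<mu> (\<lambda>s. D (y - s))" for y
      unfolding D_def using int\<psi> inte by auto
    show "(\<integral>s. D (y - s) \<partial>\<mu>) \<le> D y" if "0 \<le> y" for y
    proof -
      have "C * exp (- a * y) \<le> A * (1 - ?m) * exp (- c * y)"
        using A c that by (intro mult_mono mult_nonneg_nonneg) (auto intro: mult_right_mono)
      then have *: "A * exp (- c * y) * ?m + C * exp (- a * y) \<le> A * exp (- c * y)"
        by (simp add: algebra_simps)
      have "(\<integral>s. D (y - s) \<partial>\<mu>) = A * (\<integral>s. exp (- c * (y - s)) \<partial>\<mu>) - (\<integral>s. \<psi> (y - s) \<partial>\<mu>)"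
        unfolding D_def using int\<psi> inte by simp
      also have "(\<integral>s. exp (- c * (y - s)) \<partial>\<mu>) = exp (- c * y) * ?m"
        unfolding e by simp
      finally show ?thesis using sub[OF that] * by (simp add: D_def algebra_simps)
    qed
  qed
  then show ?thesis using A(1) by (intro that[of A]) (auto simp: D_def)
qed

text \<open>\<open>\<gamma>\<close> plays the role of a Cramer exponent. One exponent
  \<open>- \<kappa>\<close> with moment below 1 decides, through convexity, on which side of 1 the
  moments on either side of \<open>\<gamma>\<close> lie.\<close>

locale renewal_kernel = finite_measure \<mu> for \<mu> :: "real measure" +
  fixes \<kappa> \<gamma> a :: real
  assumes sets_kernel [simp, measurable_cong]: "sets \<mu> = sets borel"
    and kappa_pos: "0 < \<kappa>" and gamma_pos: "0 < \<gamma>" and gamma_less: "\<gamma> < a"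
    and integrable_exp_kappa: "integrable \<mu> (\<lambda>s. exp (- \<kappa> * s))"
    and integrable_exp_a: "integrable \<mu> (\<lambda>s. exp (a * s))"
    and exp_kappa_less: "(\<integral>s. exp (- \<kappa> * s) \<partial>\<mu>) < 1"
    and exp_gamma_eq: "(\<integral>s. exp (\<gamma> * s) \<partial>\<mu>) = 1"
begin

abbreviation mgf :: "real \<Rightarrow> real" where
  "mgf c \<equiv> (\<integral>s. exp (c * s) \<partial>\<mu>)"

lemma integrable_exp:
  assumes "- \<kappa> \<le> c" "c \<le> a"
  shows "integrable \<mu> (\<lambda>s. exp (c * s))"
proof (rule Bochner_Integration.integrable_bound)
  show "integrable \<mu> (\<lambda>s. exp (- \<kappa> * s) + exp (a * s))"
    using integrable_exp_kappa integrable_exp_a by (rule Bochner_Integration.integrable_add)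
  have "exp (c * s) \<le> exp (- \<kappa> * s) + exp (a * s)" for s
    by (rule exp_le_exp_add_exp[OF assms])
  then show "AE s in \<mu>. norm (exp (c * s)) \<le> norm (exp (- \<kappa> * s) + exp (a * s))"
    by (simp add: add_nonneg_nonneg)
qed simp

lemma mgf_convex:
  assumes "- \<kappa> \<le> c" "c \<le> a" "- \<kappa> \<le> d" "d \<le> a" "0 \<le> u" "u \<le> 1"
  shows "mgf ((1 - u) * c + u * d) \<le> (1 - u) * mgf c + u * mgf d"
proof -
  have *: "- \<kappa> \<le> (1 - u) * c + u * d" "(1 - u) * c + u * d \<le> a"
    using convex_bound_le[of "- c" \<kappa> "- d" "1 - u" u] convex_bound_le[of c a d "1 - u" u] assms by auto
  have "mgf ((1 - u) * c + u * d) \<le> (\<integral>s. (1 - u) * exp (c * s) + u * exp (d * s) \<partial>\<mu>)"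
  proof (rule integral_mono)
    fix s
    have "exp ((1 - u) * (c * s) + u * (d * s)) \<le> (1 - u) * exp (c * s) + u * exp (d * s)"
      using convex_onD[OF exp_convex, of u "c * s" "d * s"] assms by simp
    then show "exp (((1 - u) * c + u * d) * s) \<le> (1 - u) * exp (c * s) + u * exp (d * s)"
      by (simp add: algebra_simps)
  qed (use assms * in \<open>auto intro!: integrable_exp Bochner_Integration.integrable_add integrable_mult_right\<close>)
  also have "\<dots> = (1 - u) * mgf c + u * mgf d"
    using assms by (subst Bochner_Integration.integral_add) (auto intro!: integrable_exp integrable_mult_right)
  finally show ?thesis .
qed

lemma mgf_less_1:
  assumes "- \<kappa> \<le> c" "c < \<gamma>"
  shows "mgf c < 1"
proof -
  define u where "u = (c + \<kappa>) / (\<gamma> + \<kappa>)"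
  have pos: "0 < \<gamma> + \<kappa>" using kappa_pos gamma_pos by simp
  have u: "0 \<le> u" "u < 1" using assms pos by (auto simp: u_def)
  have "u * (\<gamma> + \<kappa>) = c + \<kappa>" using pos by (simp add: u_def)
  then have c: "(1 - u) * (- \<kappa>) + u * \<gamma> = c" by (simp add: algebra_simps)
  have "mgf c \<le> (1 - u) * mgf (- \<kappa>) + u * mgf \<gamma>"
    using mgf_convex[of "- \<kappa>" \<gamma> u] u kappa_pos gamma_pos gamma_less unfolding c by simp
  also have "\<dots> < (1 - u) * 1 + u * 1"
    using u exp_kappa_less by (intro add_less_le_mono mult_strict_left_mono) (auto simp: exp_gamma_eq)
  finally show ?thesis by simp
qed

lemma mass_less_1: "measure \<mu> (space \<mu>) < 1"
  using mgf_less_1[of 0] kappa_pos gamma_pos by simp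

text \<open>\<open>\<gamma>\<close> is a convex combination of \<open>- \<kappa>\<close> and
  \<open>a\<close>. As the moment at \<open>- \<kappa>\<close> is below 1, the value 1 at
  \<open>\<gamma>\<close> has to be compensated at \<open>a\<close>.\<close>

lemma mgf_greater_1: "1 < mgf a"
proof -
  define u where "u = (\<gamma> + \<kappa>) / (a + \<kappa>)"
  have pos: "0 < a + \<kappa>" using kappa_pos gamma_pos gamma_less by simp
  have u: "0 < u" "u < 1" using pos kappa_pos gamma_pos gamma_less by (auto simp: u_def)
  have "u * (a + \<kappa>) = \<gamma> + \<kappa>" using pos by (simp add: u_def)
  then have c: "(1 - u) * (- \<kappa>) + u * a = \<gamma>" by (simp add: algebra_simps)
  have "1 \<le> (1 - u) * mgf (- \<kappa>) + u * mgf a"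
    using mgf_convex[of "- \<kappa>" a u] u kappa_pos gamma_pos gamma_less unfolding c
    by (simp add: exp_gamma_eq)
  also have "\<dots> < (1 - u) * 1 + u * mgf a"
    using u exp_kappa_less by (intro add_less_le_mono mult_strict_left_mono) auto
  finally have "u * 1 < u * mgf a" by simp
  with u show ?thesis by simp
qed

text \<open>From x >= 0 only jumps \<open>s > L\<close> lead below \<open>- L\<close>, so this tail
  is the price of cutting a comparison function off at \<open>- L\<close>.\<close>

lemma exp_tail_small:
  assumes "0 < e"
  obtains L where "0 \<le> L" "(\<integral>s. exp (a * s) * indicator {L<..} s \<partial>\<mu>) \<le> e"
    "integrable \<mu> (\<lambda>s. exp (a * s) * indicator {L<..} s)"
proof -
  have "(\<lambda>n. \<integral>s. exp (a * s) * indicator {real n<..} s \<partial>\<mu>) \<longlonglongrightarrow> (\<integral>s. 0 \<partial>\<mu>)"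
  proof (rule integral_dominated_convergence[where w = "\<lambda>s. exp (a * s)"])
    show "AE s in \<mu>. (\<lambda>n. exp (a * s) * indicator {real n<..} s) \<longlonglongrightarrow> 0"
    proof (rule AE_I2)
      fix s
      obtain n0 :: nat where "s \<le> real n0" using real_arch_simple by blast
      then have "\<forall>\<^sub>F n in sequentially. exp (a * s) * indicator {real n<..} s = 0"
        by (intro eventually_sequentiallyI[of n0]) auto
      then show "(\<lambda>n. exp (a * s) * indicator {real n<..} s) \<longlonglongrightarrow> 0"
        by (rule tendsto_eventually)
    qed
  qed (auto intro: integrable_exp_a simp: indicator_def)
  then have "\<forall>\<^sub>F n in sequentially. (\<integral>s. exp (a * s) * indicator {real n<..} s \<partial>\<mu>) < e"
    using assms by (intro order_tendstoD(2)[where y = 0]) auto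
  then obtain n :: nat where n: "(\<integral>s. exp (a * s) * indicator {real n<..} s \<partial>\<mu>) < e"
    by (auto simp: eventually_sequentially)
  have "integrable \<mu> (\<lambda>s. exp (a * s) * indicator {real n<..} s)"
    by (rule integrable_real_mult_indicator) (auto intro: integrable_exp_a)
  with n show ?thesis by (intro that[of "real n"]) auto
qed

text \<open>On its own \<open>exp (- \<gamma> * x)\<close> is exactly harmonic for the kernel, but
  unbounded to the left, where \<open>\<psi>\<close> is at most 1. Cutting it off at
  \<open>- L\<close> loses mass; the added \<open>exp (- a * x)\<close> has moment above 1, and its
  gain \<open>(mgf a - 1) * exp (- a * x)\<close> pays for the loss.\<close>

lemma lower_bound:
  fixes \<psi> :: "real \<Rightarrow> real"
  assumes anti: "antimono \<psi>" and pos: "\<And>x. 0 < \<psi> x" and le1: "\<And>x. \<psi> x \<le> 1"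
    and super: "\<And>x. (\<integral>s. \<psi> (x - s) \<partial>\<mu>) \<le> \<psi> x"
  obtains c where "0 < c" "\<And>x. 0 \<le> x \<Longrightarrow> c * exp (- \<gamma> * x) \<le> \<psi> x"
proof -
  have [measurable]: "\<psi> \<in> borel_measurable borel"
    using borel_measurable_mono[of "\<lambda>x. - \<psi> x"] anti
    by (auto simp: mono_def antimono_def)
  \<comment> \<open>Below the cutoff both exponentials are at most
    \<open>exp (- a * (x - s))\<close>, so the loss is at most twice this tail. Half of
    \<open>mgf a - 1\<close> makes gain and loss balance.\<close>
  obtain L where L: "0 \<le> L" "(\<integral>s. exp (a * s) * indicator {L<..} s \<partial>\<mu>) \<le> (mgf a - 1) / 2"
    "integrable \<mu> (\<lambda>s. exp (a * s) * indicator {L<..} s)"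
    using exp_tail_small[of "(mgf a - 1) / 2"] mgf_greater_1 by auto
  define g where "g x = (exp (- \<gamma> * x) + exp (- a * x)) * indicator {- L..} x" for x :: real
  have [measurable]: "g \<in> borel_measurable borel" unfolding g_def by measurable
  define G where "G = exp (\<gamma> * L) + exp (a * L)"
  have G: "0 < G" by (simp add: G_def add_pos_pos)
  have g_nonneg: "0 \<le> g x" for x by (simp add: g_def)
  have g_le: "g x \<le> G" for x
  proof (cases "- L \<le> x")
    case True
    then have "- \<gamma> * x \<le> \<gamma> * L" "- a * x \<le> a * L"
      using mult_left_mono[of "- L" x \<gamma>] mult_left_mono[of "- L" x a] gamma_pos gamma_less by auto
    with True show ?thesis by (simp add: g_def G_def add_mono)
  next
    case False
    with G show ?thesis by (simp add: g_def)
  qed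
  have sub: "g x \<le> (\<integral>s. g (x - s) \<partial>\<mu>)" if x: "0 \<le> x" for x
  proof -
    let ?r = "\<lambda>s. exp (- \<gamma> * x) * exp (\<gamma> * s) + exp (- a * x) * exp (a * s)
        - 2 * exp (- a * x) * (exp (a * s) * indicator {L<..} s)"
    have "g x \<le> exp (- \<gamma> * x) + exp (- a * x)"
      using x L(1) by (simp add: g_def)
    also have "\<dots> = exp (- \<gamma> * x) * mgf \<gamma> + exp (- a * x) * mgf a - 2 * exp (- a * x) * ((mgf a - 1) / 2)"
    proof -
      have "e1 + e = e1 * 1 + e * m - 2 * e * ((m - 1) / 2)" for e1 e m :: real
        by (simp add: field_simps)
      then show ?thesis unfolding exp_gamma_eq .
    qed
    also have "\<dots> \<le> exp (- \<gamma> * x) * mgf \<gamma> + exp (- a * x) * mgf a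
        - 2 * exp (- a * x) * (\<integral>s. exp (a * s) * indicator {L<..} s \<partial>\<mu>)"
      by (intro diff_left_mono mult_left_mono L) auto
    also have "\<dots> = (\<integral>s. ?r s \<partial>\<mu>)"
      using L(3) kappa_pos gamma_pos gamma_less
      by (simp add: integrable_exp)
    also have "\<dots> \<le> (\<integral>s. g (x - s) \<partial>\<mu>)"
    proof (rule integral_mono)
      show "integrable \<mu> ?r"
        using L(3) kappa_pos gamma_pos gamma_less by (simp add: integrable_exp)
      show "integrable \<mu> (\<lambda>s. g (x - s))"
        by (rule integrable_const_bound[where B = G]) (auto simp: g_nonneg g_le)
      fix s
      have e: "exp (- \<gamma> * x) * exp (\<gamma> * s) = exp (- \<gamma> * (x - s))"
        "exp (- a * x) * exp (a * s) = exp (- a * (x - s))"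
        by (simp_all add: exp_add[symmetric] algebra_simps)
      show "?r s \<le> g (x - s)"
      proof (cases "- L \<le> x - s")
        case True
        have "0 \<le> exp (- a * x) * (exp (a * s) * indicator {L<..} s)"
          by (simp add: indicator_def)
        with True e show ?thesis by (simp add: g_def)
      next
        case False
        then have "exp (- \<gamma> * (x - s)) \<le> exp (- a * (x - s))"
          using gamma_less L(1) mult_right_mono_neg[of "\<gamma>" a "x - s"] by simp
        with False e x L(1) show ?thesis by (simp add: g_def indicator_def mult.assoc)
      qed
    qed
    finally show ?thesis .
  qed
  \<comment> \<open>Keeps \<open>c * g\<close> below \<open>\<psi>\<close> on the negative
    half-line, where \<open>\<psi>\<close> is at least \<open>\<psi> 0\<close>.\<close>
  define c where "c = \<psi> 0 / G"
  have c: "0 < c" using G pos by (simp add: c_def)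
  define D where "D x = \<psi> x - c * g x" for x
  have int\<psi>: "integrable \<mu> (\<lambda>s. \<psi> (x - s))" for x
    by (rule integrable_const_bound[where B = 1]) (auto simp: le1 less_imp_le[OF pos])
  have intg: "integrable \<mu> (\<lambda>s. g (x - s))" for x
    by (rule integrable_const_bound[where B = G]) (auto simp: g_nonneg g_le)
  have "0 \<le> D x" for x
  proof (rule max_principle[of \<mu> 0 D "c * G"])
    show "finite_measure \<mu>" by unfold_locales
    show "measure \<mu> (space \<mu>) < 1" by (rule mass_less_1)
    show "0 \<le> D y" if "y < 0" for y
    proof -
      have "c * g y \<le> c * G" using c g_le by simp
      also have "\<dots> = \<psi> 0" using G by (simp add: c_def)
      also have "\<dots> \<le> \<psi> y" using anti that by (auto simp: antimono_def)
      finally show ?thesis by (simp add: D_def)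
    qed
    show "- (c * G) \<le> D y" for y
      using mult_left_mono[OF g_le[of y], of c] less_imp_le[OF c] pos[of y] unfolding D_def by linarith
    show "integrable \<mu> (\<lambda>s. D (y - s))" for y
      unfolding D_def using int\<psi> intg by auto
    show "(\<integral>s. D (y - s) \<partial>\<mu>) \<le> D y" if "0 \<le> y" for y
    proof -
      have "(\<integral>s. D (y - s) \<partial>\<mu>) = (\<integral>s. \<psi> (y - s) \<partial>\<mu>) - c * (\<integral>s. g (y - s) \<partial>\<mu>)"
        unfolding D_def using int\<psi> intg by simp
      also have "\<dots> \<le> \<psi> y - c * g y"
        using super[of y] sub[OF that] c by (intro diff_mono) auto
      finally show ?thesis by (simp add: D_def)
    qed
  qed
  then have "c * exp (- \<gamma> * x) \<le> \<psi> x" if "0 \<le> x" for x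
  proof -
    have "c * exp (- \<gamma> * x) \<le> c * g x"
      using that L(1) c by (simp add: g_def indicator_def)
    also have "\<dots> \<le> \<psi> x" using \<open>\<And>x. 0 \<le> D x\<close>[of x] by (simp add: D_def)
    finally show ?thesis .
  qed
  with c show ?thesis by (rule that)
qed

text \<open>Subtracting \<open>B * exp (- a * x)\<close> turns the harmonic function into a strict
  supersolution: the moment at \<open>a\<close> exceeds 1, which leaves a slack of order
  \<open>exp (- a * x)\<close> for the error. The cutoff at \<open>- L\<close> keeps the subtracted
  term from overtaking \<open>exp (- \<gamma> * x)\<close> far to the left, and costs at most half
  of the slack.\<close>

lemma upper_bound:
  fixes \<psi> :: "real \<Rightarrow> real"
  assumes [measurable]: "\<psi> \<in> borel_measurable borel"
    and nonneg: "\<And>x. 0 \<le> \<psi> x" and le1: "\<And>x. \<psi> x \<le> 1"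
    and sub: "\<And>x. 0 \<le> x \<Longrightarrow> \<psi> x \<le> (\<integral>s. \<psi> (x - s) \<partial>\<mu>) + C * exp (- a * x)"
  obtains A where "0 < A" "\<And>x. \<psi> x \<le> A * exp (- \<gamma> * x)"
proof -
  define m where "m = mgf a - 1"
  have m: "0 < m" using mgf_greater_1 by (simp add: m_def)
  obtain L where L: "0 \<le> L" "(\<integral>s. exp (a * s) * indicator {L<..} s \<partial>\<mu>) \<le> m / 2"
    "integrable \<mu> (\<lambda>s. exp (a * s) * indicator {L<..} s)"
    using exp_tail_small[of "m / 2"] m by auto
  \<comment> \<open>The largest factor for which the subtracted term is at most half of
    \<open>exp (- \<gamma> * x)\<close> all the way down to \<open>- L\<close>.\<close>
  define B where "B = exp (- (a - \<gamma>) * L) / 2"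
  have B: "0 < B" by (simp add: B_def)
  \<comment> \<open>The 2 makes \<open>A * k\<close> at least 1 on the negative half-line, where
    \<open>k\<close> is at least 1/2; the other entry lets the slack \<open>A * B * m / 2\<close>
    cover \<open>C\<close>.\<close>
  define A where "A = max 2 (2 * C / (B * m))"
  have A: "2 \<le> A" "C \<le> A * B * m / 2"
  proof -
    have "2 * C / (B * m) \<le> A" by (simp add: A_def)
    then have "2 * C \<le> A * (B * m)" using B m by (simp add: pos_divide_le_eq)
    then show "C \<le> A * B * m / 2" by simp
  qed (simp add: A_def)
  define k where "k x = exp (- \<gamma> * x) - B * exp (- a * x) * indicator {- L..} x" for x :: real
  have [measurable]: "k \<in> borel_measurable borel" unfolding k_def by measurable
  have k_ge: "exp (- \<gamma> * x) / 2 \<le> k x" for x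
  proof (cases "- L \<le> x")
    case True
    have "B * exp (- a * x) = exp (- (a - \<gamma>) * L - a * x) / 2"
      by (simp add: B_def exp_add[symmetric] algebra_simps)
    also have "\<dots> \<le> exp (- \<gamma> * x) / 2"
      using mult_left_mono[of "- L" x "a - \<gamma>"] gamma_less True by (simp add: algebra_simps)
    finally show ?thesis using True by (simp add: k_def)
  qed (simp add: k_def)
  have k_le: "k x \<le> exp (- \<gamma> * x)" for x
    using B by (simp add: k_def indicator_def)
  have eg: "exp (- \<gamma> * (x - s)) = exp (- \<gamma> * x) * exp (\<gamma> * s)" for x s
    by (simp add: exp_add[symmetric] algebra_simps)
  have ea: "exp (- a * (x - s)) = exp (- a * x) * exp (a * s)" for x s
    by (simp add: exp_add[symmetric] algebra_simps)
  have intk: "integrable \<mu> (\<lambda>s. k (x - s))" for x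
  proof (rule Bochner_Integration.integrable_bound)
    show "integrable \<mu> (\<lambda>s. exp (- \<gamma> * x) * exp (\<gamma> * s))"
      using kappa_pos gamma_pos gamma_less by (intro integrable_mult_right integrable_exp) auto
    have "0 \<le> k y" for y by (rule order_trans[OF _ k_ge]) simp
    then show "AE s in \<mu>. norm (k (x - s)) \<le> norm (exp (- \<gamma> * x) * exp (\<gamma> * s))"
      using k_le[of "x - s" for s] unfolding eg by simp
  qed simp
  have super: "(\<integral>s. k (x - s) \<partial>\<mu>) \<le> k x - B * m / 2 * exp (- a * x)" if x: "0 \<le> x" for x
  proof -
    let ?r = "\<lambda>s. exp (- \<gamma> * x) * exp (\<gamma> * s) - B * exp (- a * x) * exp (a * s)
        + B * exp (- a * x) * (exp (a * s) * indicator {L<..} s)"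
    have "(\<integral>s. k (x - s) \<partial>\<mu>) \<le> (\<integral>s. ?r s \<partial>\<mu>)"
    proof (rule integral_mono[OF intk])
      show "integrable \<mu> ?r"
        using L(3) kappa_pos gamma_pos gamma_less by (simp add: integrable_exp)
      fix s
      show "k (x - s) \<le> ?r s"
        unfolding k_def eg ea using B x by (auto simp: indicator_def)
    qed
    also have "\<dots> = exp (- \<gamma> * x) * mgf \<gamma> - B * exp (- a * x) * mgf a
        + B * exp (- a * x) * (\<integral>s. exp (a * s) * indicator {L<..} s \<partial>\<mu>)"
      using L(3) kappa_pos gamma_pos gamma_less
      by (simp add: integrable_exp)
    also have "\<dots> \<le> exp (- \<gamma> * x) * mgf \<gamma> - B * exp (- a * x) * mgf a
        + B * exp (- a * x) * (m / 2)"
      using B by (intro add_left_mono mult_left_mono L) auto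
    also have "\<dots> = k x - B * m / 2 * exp (- a * x)"
      unfolding exp_gamma_eq using x L(1) by (simp add: k_def m_def field_simps)
    finally show ?thesis .
  qed
  define D where "D x = A * k x - \<psi> x" for x
  have int\<psi>: "integrable \<mu> (\<lambda>s. \<psi> (x - s))" for x
    by (rule integrable_const_bound[where B = 1]) (auto simp: le1 nonneg)
  have D: "0 \<le> D x" for x
  proof (rule max_principle[of \<mu> 0 D 1])
    show "finite_measure \<mu>" by unfold_locales
    show "measure \<mu> (space \<mu>) < 1" by (rule mass_less_1)
    show "0 \<le> D y" if "y < 0" for y
    proof -
      have "1 \<le> exp (- \<gamma> * y)" using that gamma_pos by (simp add: mult_nonneg_nonpos)
      then have "1 / 2 \<le> k y" using k_ge[of y] by linarith
      then have "1 \<le> A * k y" using A(1) mult_mono[of 2 A "1/2" "k y"] by simp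
      then show ?thesis using le1[of y] by (simp add: D_def)
    qed
    show "- 1 \<le> D y" for y
    proof -
      have "0 \<le> k y" by (rule order_trans[OF _ k_ge]) simp
      then have "0 \<le> A * k y" using A(1) by simp
      then show ?thesis using le1[of y] by (simp add: D_def)
    qed
    show "integrable \<mu> (\<lambda>s. D (y - s))" for y
      unfolding D_def using int\<psi> intk by auto
    show "(\<integral>s. D (y - s) \<partial>\<mu>) \<le> D y" if "0 \<le> y" for y
    proof -
      have "(\<integral>s. D (y - s) \<partial>\<mu>) = A * (\<integral>s. k (y - s) \<partial>\<mu>) - (\<integral>s. \<psi> (y - s) \<partial>\<mu>)"
        unfolding D_def using int\<psi> intk by simp
      moreover have "A * (\<integral>s. k (y - s) \<partial>\<mu>) \<le> A * k y - A * B * m / 2 * exp (- a * y)"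
        using mult_left_mono[OF super[OF that], of A] A(1) by (simp add: algebra_simps)
      moreover have "C * exp (- a * y) \<le> A * B * m / 2 * exp (- a * y)"
        using A(2) by (intro mult_right_mono) auto
      ultimately show ?thesis using sub[OF that] unfolding D_def by linarith
    qed
  qed
  have "\<psi> x \<le> A * exp (- \<gamma> * x)" for x
    using D[of x] mult_left_mono[OF k_le[of x], of A] A(1) unfolding D_def by linarith
  with A(1) show ?thesis by (intro that[of A]) auto
qed

end

section \<open>Transforms of the smoothing equation\<close>

text \<open>With y i = q + z i and z i >= 0, the difference expands into the linear part on the left
  plus higher order terms, all nonnegative. For n = 0 the truncated exponent meets an empty
  sum.\<close>

lemma prod_minus_power_ge:
  fixes q :: real
  assumes "0 \<le> q" "\<And>i. i < n \<Longrightarrow> q \<le> y i"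
  shows "q ^ (n - 1) * (\<Sum>i<n. y i - q) \<le> (\<Prod>i<n. y i) - q ^ n"
  using assms
proof (induction n)
  case (Suc n)
  let ?P = "\<Prod>i<n. y i" and ?X = "\<Sum>i<n. y i - q"
  have IH: "q ^ (n - 1) * ?X \<le> ?P - q ^ n" using Suc by auto
  have X: "0 \<le> ?X" using Suc.prems by (auto intro!: sum_nonneg)
  have y: "q \<le> y n" using Suc.prems by simp
  have "q ^ n * ?X = q * (q ^ (n - 1) * ?X)" by (cases n) auto
  also have "\<dots> \<le> y n * (?P - q ^ n)"
    using IH y Suc.prems(1) X by (intro mult_mono) auto
  finally show ?case by (simp add: algebra_simps)
qed simp

text \<open>Replacing the factors \<open>q\<close> by \<open>y i\<close> one at a time changes the
  product by \<open>y i - q\<close> times n - 1 factors, each at most \<open>b\<close>.\<close>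

lemma prod_minus_power_le:
  fixes q b :: real
  assumes "0 \<le> q" "q \<le> b" "\<And>i. i < n \<Longrightarrow> q \<le> y i \<and> y i \<le> b"
  shows "(\<Prod>i<n. y i) - q ^ n \<le> b ^ (n - 1) * (\<Sum>i<n. y i - q)"
  using assms
proof (induction n)
  case (Suc n)
  let ?P = "\<Prod>i<n. y i" and ?X = "\<Sum>i<n. y i - q"
  have IH: "?P - q ^ n \<le> b ^ (n - 1) * ?X" using Suc by auto
  have X: "0 \<le> ?X" using Suc.prems by (auto intro!: sum_nonneg)
  have y: "q \<le> y n" "y n \<le> b" using Suc.prems by auto
  have P: "q ^ n \<le> ?P" using prod_mono[of "{..<n}" "\<lambda>_. q" y] Suc.prems by simp
  have "y n * (?P - q ^ n) \<le> b * (b ^ (n - 1) * ?X)"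
    using IH y Suc.prems(1,2) P by (intro mult_mono) auto
  also have "\<dots> = b ^ n * ?X" by (cases n) auto
  finally have "y n * (?P - q ^ n) \<le> b ^ n * ?X" .
  moreover have "q ^ n * (y n - q) \<le> b ^ n * (y n - q)"
    using y Suc.prems(1,2) by (intro mult_right_mono power_mono) auto
  ultimately show ?case by (simp add: algebra_simps)
qed simp

text \<open>The remainder beyond the linear part collects pairs of increments, each with n - 2
  further factors at most \<open>b\<close>, and the sum over pairs is at most the square of the sum.
  For n < 2 there are no pairs, so the truncation of \<open>n - 2\<close> is harmless.\<close>

lemma prod_second_order_le:
  fixes q b :: real
  assumes "0 \<le> q" "q \<le> b" "b \<le> 1" "\<And>i. i < n \<Longrightarrow> q \<le> y i \<and> y i \<le> b"
  shows "(\<Prod>i<n. y i) - q ^ n - q ^ (n - 1) * (\<Sum>i<n. y i - q) \<le> b ^ (n - 2) * (\<Sum>i<n. y i - q)\<^sup>2"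
  using assms
proof (induction n)
  case (Suc n)
  let ?P = "\<Prod>i<n. y i" and ?X = "\<Sum>i<n. y i - q" and ?z = "y n - q"
  let ?R = "?P - q ^ n - q ^ (n - 1) * ?X"
  have IH: "?R \<le> b ^ (n - 2) * ?X\<^sup>2" using Suc by auto
  have R: "0 \<le> ?R" using prod_minus_power_ge[of q n y] Suc.prems by simp
  have X: "0 \<le> ?X" using Suc.prems by (auto intro!: sum_nonneg)
  have y: "q \<le> y n" "y n \<le> b" using Suc.prems by auto
  have b: "0 \<le> b" using Suc.prems by simp
  \<comment> \<open>Multiplication by y n = q + ?z scales the old remainder by \<open>y n\<close>
    and lets the old linear part meet the new increment.\<close>
  have eq: "(\<Prod>i<Suc n. y i) - q ^ Suc n - q ^ n * (?X + ?z) = y n * ?R + ?z * q ^ (n - 1) * ?X"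
    by (cases n) (simp_all add: algebra_simps)
  have "y n * ?R \<le> b ^ (n - 1) * ?X\<^sup>2"
  proof (cases "n \<ge> 2")
    case True
    have "y n * ?R \<le> b * (b ^ (n - 2) * ?X\<^sup>2)"
      using IH R y b by (intro mult_mono) auto
    also have "\<dots> = b ^ Suc (n - 2) * ?X\<^sup>2" by simp
    also have "Suc (n - 2) = n - 1" using True by simp
    finally show ?thesis .
  next
    case False
    then have "n = 0 \<or> n = 1" by auto
    then have "?R = 0" by auto
    then show ?thesis using b by simp
  qed
  moreover have "?z * q ^ (n - 1) * ?X \<le> ?z * b ^ (n - 1) * ?X"
    using y X Suc.prems(1,2) by (intro mult_right_mono mult_left_mono power_mono) auto
  moreover have "0 \<le> b ^ (n - 1) * (?z * ?X + ?z\<^sup>2)" using b y X by (intro mult_nonneg_nonneg add_nonneg_nonneg) auto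
  ultimately have "y n * ?R + ?z * q ^ (n - 1) * ?X \<le> b ^ (n - 1) * (?X + ?z)\<^sup>2"
    by (simp add: algebra_simps power2_eq_square)
  then show ?case using eq by simp
qed simp

section \<open>The equation for the transform in logarithmic coordinates\<close>

locale branching_transform = prob_space M for M :: "'a measure" +
  fixes N :: "'a \<Rightarrow> nat" and V :: "nat \<Rightarrow> 'a \<Rightarrow> real" and \<Phi> :: "real \<Rightarrow> real"
  assumes measurable_N [measurable]: "N \<in> measurable M (count_space UNIV)"
    and measurable_V [measurable]: "\<And>i. V i \<in> borel_measurable M"
    and antimono_\<Phi>: "antimono \<Phi>"
    and \<Phi>_pos: "\<And>x. 0 < \<Phi> x" and \<Phi>_le_1: "\<And>x. \<Phi> x \<le> 1"
    and \<Phi>_eq: "\<And>x. \<Phi> x = (\<integral>\<omega>. (\<Prod>i<N \<omega>. \<Phi> (x - V i \<omega>)) \<partial>M)"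
begin

lemma measurable_\<Phi> [measurable]: "\<Phi> \<in> borel_measurable borel"
  using borel_measurable_mono[of "\<lambda>x. - \<Phi> x"] antimono_\<Phi> by (auto simp: mono_def antimono_def)

lemma measurable_sum_N [measurable (raw)]:
  fixes f :: "nat \<Rightarrow> 'a \<Rightarrow> real"
  assumes [measurable]: "\<And>i. f i \<in> borel_measurable M"
  shows "(\<lambda>\<omega>. \<Sum>i<N \<omega>. f i \<omega>) \<in> borel_measurable M"
  by (rule measurable_compose_countable[OF _ measurable_N]) simp

lemma measurable_prod_N [measurable (raw)]:
  fixes f :: "nat \<Rightarrow> 'a \<Rightarrow> real"
  assumes [measurable]: "\<And>i. f i \<in> borel_measurable M"
  shows "(\<lambda>\<omega>. \<Prod>i<N \<omega>. f i \<omega>) \<in> borel_measurable M"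
  by (rule measurable_compose_countable[OF _ measurable_N]) simp

lemma integrable_moment:
  assumes "integrable M (\<lambda>\<omega>. \<Sum>i<N \<omega>. exp (- \<kappa> * V i \<omega>))" "integrable M (\<lambda>\<omega>. \<Sum>i<N \<omega>. exp (a * V i \<omega>))"
    and c: "- \<kappa> \<le> c" "c \<le> a"
  shows "integrable M (\<lambda>\<omega>. \<Sum>i<N \<omega>. exp (c * V i \<omega>))"
proof (rule Bochner_Integration.integrable_bound)
  show "integrable M (\<lambda>\<omega>. (\<Sum>i<N \<omega>. exp (- \<kappa> * V i \<omega>)) + (\<Sum>i<N \<omega>. exp (a * V i \<omega>)))"
    using assms(1,2) by (rule Bochner_Integration.integrable_add)
  have "norm (\<Sum>i<N \<omega>. exp (c * V i \<omega>)) \<le> norm ((\<Sum>i<N \<omega>. exp (- \<kappa> * V i \<omega>)) + (\<Sum>i<N \<omega>. exp (a * V i \<omega>)))" for \<omega>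
    unfolding sum.distrib[symmetric] using exp_le_exp_add_exp[OF c]
    by (auto intro!: sum_mono simp: abs_of_nonneg sum_nonneg add_nonneg_nonneg)
  then show "AE \<omega> in M. norm (\<Sum>i<N \<omega>. exp (c * V i \<omega>))
      \<le> norm ((\<Sum>i<N \<omega>. exp (- \<kappa> * V i \<omega>)) + (\<Sum>i<N \<omega>. exp (a * V i \<omega>)))" by simp
qed simp

lemma prod_\<Phi>_bounds: "0 \<le> (\<Prod>i<n. \<Phi> (x i))" "(\<Prod>i<n. \<Phi> (x i)) \<le> 1"
  using less_imp_le[OF \<Phi>_pos] \<Phi>_le_1 by (auto intro!: prod_nonneg prod_le_1)

lemma integrable_prod_\<Phi>: "integrable M (\<lambda>\<omega>. \<Prod>i<N \<omega>. \<Phi> (x - V i \<omega>))"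
  by (rule integrable_const_bound[where B = 1]) (auto simp: prod_\<Phi>_bounds)

text \<open>For \<open>N \<omega> = 0\<close> the exponent \<open>N \<omega> - 1\<close> is truncated, but then there are no points to weigh.\<close>

definition kernel :: "real \<Rightarrow> real measure" where
  "kernel b = distr (density (M \<Otimes>\<^sub>M count_space UNIV)
     (\<lambda>(\<omega>, i). ennreal (b ^ (N \<omega> - 1)) * indicator {..<N \<omega>} i)) borel (\<lambda>(\<omega>, i). V i \<omega>)"

lemma sets_kernel [simp, measurable_cong]: "sets (kernel b) = sets borel"
  and space_kernel [simp]: "space (kernel b) = UNIV"
  by (simp_all add: kernel_def)

text \<open>The many-to-one formula for one generation: counting measure on the index turns the
  weighted sum over children into an integral, and Tonelli applies. The base \<open>b\<close> stays
  free because both \<open>q\<close> and slightly larger values of \<open>\<Phi>\<close> are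
  used.\<close>

lemma nn_integral_kernel:
  assumes [measurable]: "f \<in> borel_measurable borel" and nonneg: "\<And>s. 0 \<le> f s" and b: "0 \<le> b"
  shows "(\<integral>\<^sup>+s. ennreal (f s) \<partial>kernel b) = (\<integral>\<^sup>+\<omega>. ennreal (b ^ (N \<omega> - 1) * (\<Sum>i<N \<omega>. f (V i \<omega>))) \<partial>M)"
proof -
  interpret S: sigma_finite_measure "count_space (UNIV :: nat set)"
    by (rule sigma_finite_measure_count_space_countable) simp
  have [measurable]: "(\<lambda>(\<omega>, i). V i \<omega>) \<in> borel_measurable (M \<Otimes>\<^sub>M count_space UNIV)"
    unfolding split_beta' by (rule measurable_compose_countable[where g = snd]) auto
  have [measurable]: "(\<lambda>(\<omega>, i). ennreal (b ^ (N \<omega> - 1)) * indicator {..<N \<omega>} i)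
      \<in> borel_measurable (M \<Otimes>\<^sub>M count_space UNIV)"
    unfolding split_beta' indicator_def
    by (rule measurable_compose_countable[where g = snd]) auto
  have "(\<integral>\<^sup>+s. ennreal (f s) \<partial>kernel b)
      = (\<integral>\<^sup>+p. (case p of (\<omega>, i) \<Rightarrow> ennreal (b ^ (N \<omega> - 1)) * indicator {..<N \<omega>} i) *
            ennreal (f (case p of (\<omega>, i) \<Rightarrow> V i \<omega>)) \<partial>(M \<Otimes>\<^sub>M count_space UNIV))"
    unfolding kernel_def by (subst nn_integral_distr) (auto simp: nn_integral_density)
  also have "\<dots> = (\<integral>\<^sup>+\<omega>. \<integral>\<^sup>+i. ennreal (b ^ (N \<omega> - 1)) * indicator {..<N \<omega>} i * ennreal (f (V i \<omega>))
      \<partial>count_space UNIV \<partial>M)"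
    by (subst S.nn_integral_fst[symmetric]) auto
  also have "\<dots> = (\<integral>\<^sup>+\<omega>. ennreal (b ^ (N \<omega> - 1) * (\<Sum>i<N \<omega>. f (V i \<omega>))) \<partial>M)"
  proof (rule nn_integral_cong)
    fix \<omega>
    have "(\<integral>\<^sup>+i. ennreal (b ^ (N \<omega> - 1)) * indicator {..<N \<omega>} i * ennreal (f (V i \<omega>)) \<partial>count_space UNIV)
        = (\<Sum>i<N \<omega>. ennreal (b ^ (N \<omega> - 1)) * ennreal (f (V i \<omega>)))"
      unfolding nn_integral_count_space_nat by (subst suminf_finite[of "{..<N \<omega>}"]) auto
    also have "\<dots> = ennreal (b ^ (N \<omega> - 1) * (\<Sum>i<N \<omega>. f (V i \<omega>)))"
      using b nonneg by (simp add: ennreal_mult[symmetric] sum_distrib_left)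
    finally show "(\<integral>\<^sup>+i. ennreal (b ^ (N \<omega> - 1)) * indicator {..<N \<omega>} i * ennreal (f (V i \<omega>)) \<partial>count_space UNIV)
        = ennreal (b ^ (N \<omega> - 1) * (\<Sum>i<N \<omega>. f (V i \<omega>)))" .
  qed
  finally show ?thesis .
qed

lemma
  assumes [measurable]: "f \<in> borel_measurable borel" and nonneg: "\<And>s. 0 \<le> f s" and b: "0 \<le> b"
    and int: "integrable M (\<lambda>\<omega>. b ^ (N \<omega> - 1) * (\<Sum>i<N \<omega>. f (V i \<omega>)))"
  shows integrable_kernel: "integrable (kernel b) f"
    and integral_kernel: "(\<integral>s. f s \<partial>kernel b) = (\<integral>\<omega>. b ^ (N \<omega> - 1) * (\<Sum>i<N \<omega>. f (V i \<omega>)) \<partial>M)"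
proof -
  have nn: "0 \<le> b ^ (N \<omega> - 1) * (\<Sum>i<N \<omega>. f (V i \<omega>))" for \<omega>
    using nonneg b by (intro mult_nonneg_nonneg sum_nonneg) auto
  have *: "(\<integral>\<^sup>+s. ennreal (f s) \<partial>kernel b) = ennreal (\<integral>\<omega>. b ^ (N \<omega> - 1) * (\<Sum>i<N \<omega>. f (V i \<omega>)) \<partial>M)"
    unfolding nn_integral_kernel[OF assms(1-3)] by (rule nn_integral_eq_integral[OF int AE_I2[OF nn]])
  show "integrable (kernel b) f"
    by (rule integrableI_nonneg) (auto simp: nonneg *)
  show "(\<integral>s. f s \<partial>kernel b) = (\<integral>\<omega>. b ^ (N \<omega> - 1) * (\<Sum>i<N \<omega>. f (V i \<omega>)) \<partial>M)"
    by (subst integral_eq_nn_integral) (simp_all add: nonneg * integral_nonneg nn del: One_nat_def)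
qed

end

section \<open>The Schroeder case\<close>

text \<open>The condition \<open>a < 2 * \<gamma>\<close> can be arranged by lowering
  \<open>a\<close> through interpolation of moments; it places \<open>a / 2\<close> where the moment
  of \<open>kernel q\<close> is below 1.\<close>

locale schroeder_transform = branching_transform +
  fixes q \<kappa> \<gamma> a :: real
  assumes q_nonneg: "0 \<le> q" and q_less: "\<And>x. q < \<Phi> x" and tendsto_q: "(\<Phi> \<longlongrightarrow> q) at_top"
    and q_fixed: "(\<integral>\<omega>. q ^ N \<omega> \<partial>M) = q"
    and kappa_pos: "0 < \<kappa>" and gamma_pos: "0 < \<gamma>" and gamma_less: "\<gamma> < a" and a_less: "a < 2 * \<gamma>"
    and integrable_kappa: "integrable M (\<lambda>\<omega>. \<Sum>i<N \<omega>. exp (- \<kappa> * V i \<omega>))"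
    and mean_kappa: "(\<integral>\<omega>. (\<Sum>i<N \<omega>. exp (- \<kappa> * V i \<omega>)) \<partial>M) \<le> 1"
    and integrable_a: "integrable M (\<lambda>\<omega>. \<Sum>i<N \<omega>. exp (a * V i \<omega>))"
    and mean_gamma: "(\<integral>\<omega>. q ^ (N \<omega> - 1) * (\<Sum>i<N \<omega>. exp (\<gamma> * V i \<omega>)) \<partial>M) = 1"
    and branching: "\<not> (AE \<omega> in M. N \<omega> \<le> 1)"
begin

lemma q_less_1: "q < 1"
  using q_less[of 0] \<Phi>_le_1[of 0] by simp

lemma weighted_le:
  assumes "0 \<le> b" "b \<le> 1"
  shows "norm (b ^ (N \<omega> - 1) * (\<Sum>i<N \<omega>. exp (c * V i \<omega>))) \<le> (\<Sum>i<N \<omega>. exp (c * V i \<omega>))"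
  using assms mult_right_mono[of "b ^ (N \<omega> - 1)" 1 "\<Sum>i<N \<omega>. exp (c * V i \<omega>)"]
  by (auto simp: sum_nonneg abs_mult power_le_one)

lemma integrable_weighted:
  assumes "0 \<le> b" "b \<le> 1" "- \<kappa> \<le> c" "c \<le> a"
  shows "integrable M (\<lambda>\<omega>. b ^ (N \<omega> - 1) * (\<Sum>i<N \<omega>. exp (c * V i \<omega>)))"
proof (rule Bochner_Integration.integrable_bound[OF integrable_moment[OF integrable_kappa integrable_a assms(3,4)]])
  show "AE \<omega> in M. norm (b ^ (N \<omega> - 1) * (\<Sum>i<N \<omega>. exp (c * V i \<omega>))) \<le> norm (\<Sum>i<N \<omega>. exp (c * V i \<omega>))"
    using weighted_le[OF assms(1,2)] by (auto simp: sum_nonneg)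
qed simp

lemma integrable_kernel_exp:
  assumes "0 \<le> b" "b \<le> 1" "- \<kappa> \<le> c" "c \<le> a"
  shows "integrable (kernel b) (\<lambda>s. exp (c * s))"
  using integrable_weighted[OF assms] assms(1) by (intro integrable_kernel) auto

lemma integral_kernel_exp:
  assumes "0 \<le> b" "b \<le> 1" "- \<kappa> \<le> c" "c \<le> a"
  shows "(\<integral>s. exp (c * s) \<partial>kernel b) = (\<integral>\<omega>. b ^ (N \<omega> - 1) * (\<Sum>i<N \<omega>. exp (c * V i \<omega>)) \<partial>M)"
  using integrable_weighted[OF assms] assms(1) by (intro integral_kernel) auto

lemma finite_kernel:
  assumes "0 \<le> b" "b \<le> 1"
  shows "finite_measure (kernel b)"
proof
  have "integrable (kernel b) (\<lambda>s. 1 :: real)"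
    using integrable_kernel_exp[OF assms, of 0] kappa_pos gamma_pos gamma_less by simp
  then show "emeasure (kernel b) (space (kernel b)) \<noteq> \<infinity>"
    by (auto simp: integrable_iff_bounded)
qed

text \<open>The weight \<open>q ^ (N \<omega> - 1)\<close> is less than 1 when there are at least
  two children, which has positive probability, and there the sum is positive. So the weighted mean
  is strictly below a mean that is at most 1.\<close>

lemma kernel_kappa_less: "(\<integral>s. exp (- \<kappa> * s) \<partial>kernel q) < 1"
proof (rule ccontr)
  let ?S = "\<lambda>\<omega>. \<Sum>i<N \<omega>. exp (- \<kappa> * V i \<omega>)"
  assume *: "\<not> ?thesis"
  have int: "integrable M (\<lambda>\<omega>. q ^ (N \<omega> - 1) * ?S \<omega>)"
    using integrable_weighted[of q "- \<kappa>"] q_nonneg q_less_1 kappa_pos gamma_pos gamma_less by simp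
  let ?d = "\<lambda>\<omega>. ?S \<omega> - q ^ (N \<omega> - 1) * ?S \<omega>"
  have d: "0 \<le> ?d \<omega>" for \<omega>
    using weighted_le[of q \<omega> "- \<kappa>"] q_nonneg q_less_1 by simp
  have "(\<integral>\<omega>. ?d \<omega> \<partial>M) = (\<integral>\<omega>. ?S \<omega> \<partial>M) - (\<integral>s. exp (- \<kappa> * s) \<partial>kernel q)"
    using integral_kernel_exp[of q "- \<kappa>"] q_nonneg q_less_1 kappa_pos gamma_pos gamma_less
      int integrable_kappa by simp
  with * mean_kappa have "(\<integral>\<omega>. ?d \<omega> \<partial>M) \<le> 0" by simp
  moreover have "0 \<le> (\<integral>\<omega>. ?d \<omega> \<partial>M)" using d by (intro integral_nonneg_AE) simp
  ultimately have "(\<integral>\<omega>. ?d \<omega> \<partial>M) = 0" by simp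
  then have "AE \<omega> in M. ?d \<omega> = 0"
    using integral_nonneg_eq_0_iff_AE[of M ?d] d int integrable_kappa by simp
  then have "AE \<omega> in M. N \<omega> \<le> 1"
  proof eventually_elim
    case (elim \<omega>)
    show ?case
    proof (rule ccontr)
      assume n: "\<not> N \<omega> \<le> 1"
      then have "0 < ?S \<omega>" by (intro sum_pos) (auto simp: lessThan_empty_iff)
      moreover have "q ^ (N \<omega> - 1) < 1"
        using power_decreasing[of 1 "N \<omega> - 1" q] n q_nonneg q_less_1
        by (simp add: Suc_le_eq)
      ultimately have "q ^ (N \<omega> - 1) * ?S \<omega> < 1 * ?S \<omega>" by (intro mult_strict_right_mono)
      with elim show False by linarith
    qed
  qed
  with branching show False by simp
qed

sublocale renewal: renewal_kernel "kernel q" \<kappa> \<gamma> a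
proof (intro renewal_kernel.intro renewal_kernel_axioms.intro)
  show "finite_measure (kernel q)" using finite_kernel q_nonneg q_less_1 by simp
  show "(\<integral>s. exp (\<gamma> * s) \<partial>kernel q) = 1"
    using integral_kernel_exp[of q \<gamma>] mean_gamma q_nonneg q_less_1 kappa_pos gamma_pos gamma_less by simp
  show "integrable (kernel q) (\<lambda>s. exp (- \<kappa> * s))"
    using q_nonneg q_less_1 kappa_pos gamma_pos gamma_less by (intro integrable_kernel_exp) auto
  show "integrable (kernel q) (\<lambda>s. exp (a * s))"
    using q_nonneg q_less_1 kappa_pos gamma_pos gamma_less by (intro integrable_kernel_exp) auto
qed (simp_all add: kappa_pos gamma_pos gamma_less kernel_kappa_less[simplified])

abbreviation \<psi> :: "real \<Rightarrow> real" where "\<psi> x \<equiv> \<Phi> x - q"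

lemma integrable_q_power: "integrable M (\<lambda>\<omega>. q ^ N \<omega>)"
  using q_nonneg q_less_1 by (intro integrable_const_bound[where B = 1]) (auto simp: power_le_one)

lemma psi_eq: "\<psi> x = (\<integral>\<omega>. (\<Prod>i<N \<omega>. \<Phi> (x - V i \<omega>)) - q ^ N \<omega> \<partial>M)"
  using \<Phi>_eq[of x] q_fixed integrable_prod_\<Phi>[of x] integrable_q_power by simp

lemma psi_bounds: "0 < \<psi> x" "0 \<le> \<psi> x" "\<psi> x \<le> 1"
  using q_less[of x] \<Phi>_le_1[of x] q_nonneg by auto

lemma integrable_weighted_psi:
  assumes "0 \<le> b" "b \<le> 1"
  shows "integrable M (\<lambda>\<omega>. b ^ (N \<omega> - 1) * (\<Sum>i<N \<omega>. \<psi> (x - V i \<omega>)))"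
proof (rule Bochner_Integration.integrable_bound)
  show "integrable M (\<lambda>\<omega>. b ^ (N \<omega> - 1) * (\<Sum>i<N \<omega>. exp (0 * V i \<omega>)))"
    using assms kappa_pos gamma_pos gamma_less by (intro integrable_weighted) auto
  have "norm (b ^ (N \<omega> - 1) * (\<Sum>i<N \<omega>. \<psi> (x - V i \<omega>)))
      \<le> norm (b ^ (N \<omega> - 1) * (\<Sum>i<N \<omega>. exp (0 * V i \<omega>)))" for \<omega>
    using assms sum_mono[of "{..<N \<omega>}" "\<lambda>i. \<psi> (x - V i \<omega>)" "\<lambda>_. 1"] psi_bounds
    by (auto simp: abs_mult sum_nonneg simp del: sum_subtractf intro!: mult_left_mono)
  then show "AE \<omega> in M. norm (b ^ (N \<omega> - 1) * (\<Sum>i<N \<omega>. \<psi> (x - V i \<omega>)))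
      \<le> norm (b ^ (N \<omega> - 1) * (\<Sum>i<N \<omega>. exp (0 * V i \<omega>)))" by simp
qed simp

lemma integral_kernel_psi:
  assumes "0 \<le> b" "b \<le> 1"
  shows "(\<integral>s. \<psi> (x - s) \<partial>kernel b) = (\<integral>\<omega>. b ^ (N \<omega> - 1) * (\<Sum>i<N \<omega>. \<psi> (x - V i \<omega>)) \<partial>M)"
  using assms psi_bounds integrable_weighted_psi[OF assms, of x]
  by (intro integral_kernel) (auto simp del: sum_subtractf)

lemma psi_superharmonic: "(\<integral>s. \<psi> (x - s) \<partial>kernel q) \<le> \<psi> x"
  unfolding integral_kernel_psi[OF q_nonneg less_imp_le[OF q_less_1]] psi_eq[of x]
proof (rule integral_mono)
  fix \<omega>
  show "q ^ (N \<omega> - 1) * (\<Sum>i<N \<omega>. \<psi> (x - V i \<omega>)) \<le> (\<Prod>i<N \<omega>. \<Phi> (x - V i \<omega>)) - q ^ N \<omega>"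
    using q_less by (intro prod_minus_power_ge q_nonneg) (auto intro: less_imp_le)
  show "integrable M (\<lambda>\<omega>. q ^ (N \<omega> - 1) * (\<Sum>i<N \<omega>. \<psi> (x - V i \<omega>)))"
    by (intro integrable_weighted_psi q_nonneg less_imp_le[OF q_less_1])
  show "integrable M (\<lambda>\<omega>. (\<Prod>i<N \<omega>. \<Phi> (x - V i \<omega>)) - q ^ N \<omega>)"
    by (intro Bochner_Integration.integrable_diff integrable_prod_\<Phi> integrable_q_power)
qed

lemma psi_lower:
  obtains c where "0 < c" "\<And>x. 0 \<le> x \<Longrightarrow> c * exp (- \<gamma> * x) \<le> \<psi> x"
proof (rule renewal.lower_bound[of \<psi>])
  show "antimono \<psi>"
    by (intro antimonoI diff_right_mono antimonoD[OF antimono_\<Phi>])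
  show "0 < \<psi> x" "\<psi> x \<le> 1" "(\<integral>s. \<psi> (x - s) \<partial>kernel q) \<le> \<psi> x" for x
    by (rule psi_bounds psi_superharmonic)+
qed (rule that)

text \<open>A displacement above \<open>x - x0\<close> costs \<open>e\<^sup>-\<^sup>a\<^sup>x\<close>; otherwise every factor is at most \<open>\<Phi> x0\<close>.\<close>

lemma indicator_far_le:
  fixes n :: nat
  assumes "\<not> (\<forall>i<n. v i \<le> x - x0)"
  shows "1 \<le> exp (a * x0) * exp (- a * x) * (\<Sum>i<n. exp (a * v i))"
proof -
  from assms obtain i where i: "i < n" "x - x0 < v i" by auto
  have "a * (x - x0) \<le> a * v i" using i gamma_pos gamma_less by (intro mult_left_mono) auto
  then have "1 \<le> exp (a * x0 + - a * x + a * v i)" by (simp add: algebra_simps)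
  also have "\<dots> = exp (a * x0) * exp (- a * x) * exp (a * v i)" by (simp only: exp_add)
  also have "\<dots> \<le> exp (a * x0) * exp (- a * x) * (\<Sum>i<n. exp (a * v i))"
    using i by (intro mult_left_mono member_le_sum) auto
  finally show ?thesis .
qed

text \<open>The rate \<open>a / 2 < \<gamma>\<close> is chosen so that \<open>\<psi>\<^sup>2\<close> decays at rate \<open>a > \<gamma>\<close>.\<close>

lemma psi_crude: obtains A where "0 < A" "\<And>x. \<psi> x \<le> A * exp (- (a / 2) * x)"
proof -
  \<comment> \<open>The moments of \<open>kernel b\<close> are continuous as \<open>b\<close>
    approaches \<open>q\<close> along values of \<open>\<Phi>\<close>. Hence the strict inequalities
    for \<open>kernel q\<close> at the exponents 0 and \<open>a / 2\<close> survive for b =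
    \<open>\<Phi> (real n)\<close> with \<open>n\<close> large.\<close>
  have lim: "(\<lambda>n. \<integral>s. exp (c * s) \<partial>kernel (\<Phi> (real n))) \<longlonglongrightarrow> (\<integral>s. exp (c * s) \<partial>kernel q)"
    if "- \<kappa> \<le> c" "c \<le> a" for c
  proof -
    have b: "0 \<le> \<Phi> x" "\<Phi> x \<le> 1" for x using \<Phi>_pos[of x] \<Phi>_le_1[of x] by auto
    have q: "0 \<le> q" "q \<le> 1" using q_nonneg q_less_1 by auto
    show ?thesis
      unfolding integral_kernel_exp[OF b that] integral_kernel_exp[OF q that]
    proof (rule integral_dominated_convergence[where w = "\<lambda>\<omega>. \<Sum>i<N \<omega>. exp (c * V i \<omega>)"])
      show "integrable M (\<lambda>\<omega>. \<Sum>i<N \<omega>. exp (c * V i \<omega>))" by (rule integrable_moment[OF integrable_kappa integrable_a that])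
      show "AE \<omega> in M. (\<lambda>n. \<Phi> (real n) ^ (N \<omega> - 1) * (\<Sum>i<N \<omega>. exp (c * V i \<omega>)))
          \<longlonglongrightarrow> q ^ (N \<omega> - 1) * (\<Sum>i<N \<omega>. exp (c * V i \<omega>))"
        by (intro AE_I2 tendsto_mult tendsto_power tendsto_const
            filterlim_compose[OF tendsto_q filterlim_real_sequentially])
      show "AE \<omega> in M. norm (\<Phi> (real n) ^ (N \<omega> - 1) * (\<Sum>i<N \<omega>. exp (c * V i \<omega>)))
          \<le> (\<Sum>i<N \<omega>. exp (c * V i \<omega>))" for n
        by (intro AE_I2 weighted_le b)
    qed auto
  qed
  have "\<forall>\<^sub>F n in sequentially. (\<integral>s. exp (0 * s) \<partial>kernel (\<Phi> (real n))) < 1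
      \<and> (\<integral>s. exp (a / 2 * s) \<partial>kernel (\<Phi> (real n))) < 1"
    using kappa_pos gamma_pos gamma_less a_less
    by (intro eventually_conj order_tendstoD(2)[OF lim] renewal.mgf_less_1) auto
  then obtain n :: nat where n: "(\<integral>s. exp (0 * s) \<partial>kernel (\<Phi> (real n))) < 1"
      "(\<integral>s. exp (a / 2 * s) \<partial>kernel (\<Phi> (real n))) < 1"
    by (auto simp: eventually_sequentially)
  define x0 where "x0 = real n"
  define b where "b = \<Phi> x0"
  define C where "C = exp (a * x0) * (\<integral>\<omega>. (\<Sum>i<N \<omega>. exp (a * V i \<omega>)) \<partial>M)"
  have b: "0 \<le> b" "b \<le> 1" "q \<le> b" using \<Phi>_pos[of x0] \<Phi>_le_1[of x0] q_less[of x0] by (auto simp: b_def)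
  have fin: "finite_measure (kernel b)" using b by (intro finite_kernel)
  have sub: "\<psi> x \<le> (\<integral>s. \<psi> (x - s) \<partial>kernel b) + C * exp (- a * x)" for x
  proof -
    let ?f = "\<lambda>\<omega>. b ^ (N \<omega> - 1) * (\<Sum>i<N \<omega>. \<psi> (x - V i \<omega>))"
    let ?e = "\<lambda>\<omega>. exp (a * x0) * exp (- a * x) * (\<Sum>i<N \<omega>. exp (a * V i \<omega>))"
    have int: "integrable M ?f" "integrable M ?e"
      by (intro integrable_weighted_psi b integrable_mult_right integrable_a)+
    have "\<psi> x \<le> (\<integral>\<omega>. ?f \<omega> + ?e \<omega> \<partial>M)"
      unfolding psi_eq[of x]
    proof (rule integral_mono)
      show "integrable M (\<lambda>\<omega>. (\<Prod>i<N \<omega>. \<Phi> (x - V i \<omega>)) - q ^ N \<omega>)"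
        by (intro Bochner_Integration.integrable_diff integrable_prod_\<Phi> integrable_q_power)
      show "integrable M (\<lambda>\<omega>. ?f \<omega> + ?e \<omega>)" using int by (rule Bochner_Integration.integrable_add)
      fix \<omega>
      have f: "0 \<le> ?f \<omega>" using b psi_bounds by (intro mult_nonneg_nonneg sum_nonneg) auto
      have e: "0 \<le> ?e \<omega>" by (intro mult_nonneg_nonneg sum_nonneg) auto
      show "(\<Prod>i<N \<omega>. \<Phi> (x - V i \<omega>)) - q ^ N \<omega> \<le> ?f \<omega> + ?e \<omega>"
      proof (cases "\<forall>i<N \<omega>. V i \<omega> \<le> x - x0")
        case True
        then have "\<forall>i<N \<omega>. q \<le> \<Phi> (x - V i \<omega>) \<and> \<Phi> (x - V i \<omega>) \<le> b"
          using antimono_\<Phi> less_imp_le[OF q_less] by (auto simp: b_def antimono_def)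
        then have "(\<Prod>i<N \<omega>. \<Phi> (x - V i \<omega>)) - q ^ N \<omega> \<le> ?f \<omega>"
          using q_nonneg b by (intro prod_minus_power_le) auto
        then show ?thesis using e by linarith
      next
        case False
        have "(\<Prod>i<N \<omega>. \<Phi> (x - V i \<omega>)) - q ^ N \<omega> \<le> 1"
          using prod_\<Phi>_bounds(2)[of "\<lambda>i. x - V i \<omega>" "N \<omega>"] zero_le_power[OF q_nonneg, of "N \<omega>"] by linarith
        also have "\<dots> \<le> ?e \<omega>" by (rule indicator_far_le[OF False])
        finally show ?thesis using f by linarith
      qed
    qed
    also have "\<dots> = (\<integral>s. \<psi> (x - s) \<partial>kernel b) + C * exp (- a * x)"
      unfolding Bochner_Integration.integral_add[OF int] integral_kernel_psi[OF b(1,2)] by (simp add: C_def)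
    finally show ?thesis .
  qed
  show ?thesis
  proof (rule crude_upper_bound[of "kernel b" \<psi> "a / 2" a C])
    show "measure (kernel b) (space (kernel b)) < 1"
      using n(1) by (simp add: b_def x0_def)
    show "integrable (kernel b) (\<lambda>s. exp (a / 2 * s))"
      using b kappa_pos gamma_pos gamma_less by (intro integrable_kernel_exp) auto
    show "(\<integral>s. exp (a / 2 * s) \<partial>kernel b) < 1"
      using n(2) by (simp only: b_def x0_def)
    show "0 \<le> a / 2" "a / 2 \<le> a" using gamma_pos gamma_less by auto
    show "\<psi> \<in> borel_measurable borel" by measurable
  qed (rule fin sets_kernel psi_bounds sub that; assumption?)+
qed

text \<open>By Cauchy-Schwarz the quadratic remainder is at most N * b ^ (N - 2) times the sum of
  the squares of \<open>\<psi>\<close>. The prefactor is bounded since b < 1, and the crude bound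
  turns each square into a multiple of the summand at exponent \<open>a\<close>, so a first moment
  suffices.\<close>

lemma psi_upper: obtains A where "0 < A" "\<And>x. \<psi> x \<le> A * exp (- \<gamma> * x)"
proof -
  obtain A where A: "0 < A" "\<And>x. \<psi> x \<le> A * exp (- (a / 2) * x)" by (rule psi_crude) blast
  have "\<forall>\<^sub>F x in at_top. \<Phi> x < 1" using tendsto_q q_less_1 by (rule order_tendstoD(2))
  then obtain x0 where "\<Phi> x0 < 1" by (auto simp: eventually_at_top_linorder)
  define b where "b = \<Phi> x0"
  have b: "0 < b" "b < 1" "q \<le> b"
    using \<Phi>_pos[of x0] \<open>\<Phi> x0 < 1\<close> q_less[of x0] by (auto simp: b_def)
  have "(\<lambda>n. real n * b ^ n) \<longlonglongrightarrow> 0"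
    using powser_times_n_limit_0[of b] b by simp
  then have "Bseq (\<lambda>n. real n * b ^ n)" by (intro convergent_imp_Bseq convergentI)
  then obtain C0 where C0: "\<And>n. norm (real n * b ^ n) \<le> C0" by (auto simp: Bseq_def)
  \<comment> \<open>Division by the square of \<open>b\<close> passes from \<open>b ^ n\<close> to
    \<open>b ^ (n - 2)\<close>; for n < 2 the truncated power is 1 and the comparison still
    holds.\<close>
  define C1 where "C1 = C0 / b\<^sup>2"
  have C1: "real n * b ^ (n - 2) \<le> C1" for n
  proof -
    have "b ^ (n - 2) * b\<^sup>2 \<le> b ^ n"
    proof (cases "n \<ge> 2")
      case True
      then have "n - 2 + 2 = n" by simp
      then show ?thesis using power_add[of b "n - 2" 2] by (metis order_refl)
    next
      case False
      then have "n = 0 \<or> n = 1" by auto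
      then show ?thesis using b by (auto simp: power2_eq_square mult_le_one)
    qed
    then have "real n * (b ^ (n - 2) * b\<^sup>2) \<le> real n * b ^ n" by (intro mult_left_mono) auto
    also have "\<dots> \<le> C0" using C0[of n] by simp
    finally show ?thesis using b by (simp add: C1_def pos_le_divide_eq mult.assoc)
  qed
  have C1_nonneg: "0 \<le> C1" using C1[of 0] by simp
  define C where "C = (C1 * A\<^sup>2 + exp (a * x0)) * (\<integral>\<omega>. (\<Sum>i<N \<omega>. exp (a * V i \<omega>)) \<partial>M)"
  have q: "0 \<le> q" "q \<le> 1" using q_nonneg q_less_1 by auto
  have sub: "\<psi> x \<le> (\<integral>s. \<psi> (x - s) \<partial>kernel q) + C * exp (- a * x)" for x
  proof -
    let ?f = "\<lambda>\<omega>. q ^ (N \<omega> - 1) * (\<Sum>i<N \<omega>. \<psi> (x - V i \<omega>))"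
    let ?S = "\<lambda>\<omega>. \<Sum>i<N \<omega>. exp (a * V i \<omega>)"
    let ?e = "\<lambda>\<omega>. exp (a * x0) * exp (- a * x) * ?S \<omega>"
    let ?r = "\<lambda>\<omega>. C1 * A\<^sup>2 * exp (- a * x) * ?S \<omega>"
    have int: "integrable M ?f" "integrable M ?e" "integrable M ?r"
      by (intro integrable_weighted_psi q integrable_mult_right integrable_a)+
    have "\<psi> x \<le> (\<integral>\<omega>. ?f \<omega> + (?e \<omega> + ?r \<omega>) \<partial>M)"
      unfolding psi_eq[of x]
    proof (rule integral_mono)
      show "integrable M (\<lambda>\<omega>. (\<Prod>i<N \<omega>. \<Phi> (x - V i \<omega>)) - q ^ N \<omega>)"
        by (intro Bochner_Integration.integrable_diff integrable_prod_\<Phi> integrable_q_power)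
      show "integrable M (\<lambda>\<omega>. ?f \<omega> + (?e \<omega> + ?r \<omega>))"
        using int by (intro Bochner_Integration.integrable_add)
      fix \<omega>
      have f: "0 \<le> ?f \<omega>" using q psi_bounds by (intro mult_nonneg_nonneg sum_nonneg) auto
      have e: "0 \<le> ?e \<omega>" by (intro mult_nonneg_nonneg sum_nonneg) auto
      have r: "0 \<le> ?r \<omega>" using C1_nonneg by (intro mult_nonneg_nonneg sum_nonneg) auto
      show "(\<Prod>i<N \<omega>. \<Phi> (x - V i \<omega>)) - q ^ N \<omega> \<le> ?f \<omega> + (?e \<omega> + ?r \<omega>)"
      proof (cases "\<forall>i<N \<omega>. V i \<omega> \<le> x - x0")
        case True
        then have "\<forall>i<N \<omega>. q \<le> \<Phi> (x - V i \<omega>) \<and> \<Phi> (x - V i \<omega>) \<le> b"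
          using antimono_\<Phi> less_imp_le[OF q_less] by (auto simp: b_def antimono_def)
        then have "(\<Prod>i<N \<omega>. \<Phi> (x - V i \<omega>)) - q ^ N \<omega> - ?f \<omega>
            \<le> b ^ (N \<omega> - 2) * (\<Sum>i<N \<omega>. \<psi> (x - V i \<omega>))\<^sup>2"
          using q_nonneg b by (intro prod_second_order_le) auto
        also have "\<dots> \<le> b ^ (N \<omega> - 2) * (real (N \<omega>) * (\<Sum>i<N \<omega>. (\<psi> (x - V i \<omega>))\<^sup>2))"
          using sum_squared_le_sum_of_squares[of "\<lambda>i. \<psi> (x - V i \<omega>)" "{..<N \<omega>}"] b
          by (intro mult_left_mono) (simp_all only: card_lessThan mult.commute zero_le_power less_imp_le)
        also have "\<dots> = (real (N \<omega>) * b ^ (N \<omega> - 2)) * (\<Sum>i<N \<omega>. (\<psi> (x - V i \<omega>))\<^sup>2)"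
          by simp
        also have "\<dots> \<le> C1 * (\<Sum>i<N \<omega>. A\<^sup>2 * exp (- a * x) * exp (a * V i \<omega>))"
        proof (intro mult_mono C1 sum_mono)
          fix i
          have "(\<psi> (x - V i \<omega>))\<^sup>2 \<le> (A * exp (- (a / 2) * (x - V i \<omega>)))\<^sup>2"
            by (intro power_mono A psi_bounds)
          also have "\<dots> = A\<^sup>2 * exp (- a * x + a * V i \<omega>)"
            by (simp add: power_mult_distrib exp_double[symmetric] field_simps)
          finally show "(\<psi> (x - V i \<omega>))\<^sup>2 \<le> A\<^sup>2 * exp (- a * x) * exp (a * V i \<omega>)"
            by (simp only: exp_add mult.assoc)
        qed (auto intro!: C1_nonneg sum_nonneg)
        also have "\<dots> = ?r \<omega>" by (simp add: sum_distrib_left mult.assoc)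
        finally show ?thesis using e by linarith
      next
        case False
        have "(\<Prod>i<N \<omega>. \<Phi> (x - V i \<omega>)) - q ^ N \<omega> \<le> 1"
          using prod_\<Phi>_bounds(2)[of "\<lambda>i. x - V i \<omega>" "N \<omega>"] zero_le_power[OF q_nonneg, of "N \<omega>"] by linarith
        also have "\<dots> \<le> ?e \<omega>" by (rule indicator_far_le[OF False])
        finally show ?thesis using f r by linarith
      qed
    qed
    also have "\<dots> = (\<integral>s. \<psi> (x - s) \<partial>kernel q) + C * exp (- a * x)"
      unfolding Bochner_Integration.integral_add[OF int(1) Bochner_Integration.integrable_add[OF int(2,3)]]
        Bochner_Integration.integral_add[OF int(2,3)] integral_kernel_psi[OF q]
      by (simp add: C_def algebra_simps)
    finally show ?thesis .
  qed
  show ?thesis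
    by (rule renewal.upper_bound[of \<psi> C]) (measurable, (rule psi_bounds sub that; assumption?)+)
qed

end

section \<open>The Boettcher case\<close>

context branching_transform
begin

text \<open>If some child has displacement at most \<open>\<eta>\<close>, it contributes almost 1
  and any second child adds at least \<open>exp (- a * K)\<close>. Otherwise all displacements
  exceed \<open>\<eta>\<close>, and lowering the exponent from \<open>a'\<close> to \<open>a\<close>
  multiplies every term by at least \<open>exp ((a' - a) * \<eta>)\<close>. Clipping at 0 gives up
  the surplus of negative displacements, so that later no argument moves to the right.\<close>

lemma boettcher_gap:
  assumes a: "0 < a" "a < a'" and K: "0 < K"
    and two: "AE \<omega> in M. 2 \<le> N \<omega>" and le_K: "AE \<omega> in M. \<forall>i<N \<omega>. V i \<omega> \<le> K"
    and ge: "AE \<omega> in M. 1 \<le> (\<Sum>i<N \<omega>. exp (- a' * V i \<omega>))"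
  obtains g where "0 < g" "AE \<omega> in M. 1 + g \<le> (\<Sum>i<N \<omega>. exp (- a * max 0 (V i \<omega>)))"
proof -
  \<comment> \<open>Makes \<open>a * \<eta>\<close> half of \<open>exp (- a * K)\<close>, so the
    deficit of the first child uses up only half of what the second one adds.\<close>
  define \<eta> where "\<eta> = exp (- a * K) / (2 * a)"
  define g where "g = min (exp (- a * K) / 2) ((a' - a) * \<eta>)"
  have \<eta>: "0 < \<eta>" using a by (simp add: \<eta>_def)
  have g: "0 < g" using a \<eta> by (simp add: g_def)
  have "AE \<omega> in M. 1 + g \<le> (\<Sum>i<N \<omega>. exp (- a * max 0 (V i \<omega>)))"
    using two le_K ge
  proof eventually_elim
    case (elim \<omega>)
    show ?case
    proof (cases "\<exists>i<N \<omega>. V i \<omega> \<le> \<eta>")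
      case True
      then obtain i where i: "i < N \<omega>" "V i \<omega> \<le> \<eta>" by auto
      define j where "j = (if i = 0 then 1 else 0 :: nat)"
      have j: "j < N \<omega>" "j \<noteq> i" using elim(1) by (auto simp: j_def)
      have "1 + - (a * \<eta>) \<le> exp (- (a * \<eta>))" by (rule exp_ge_add_one_self)
      also have "\<dots> \<le> exp (- a * max 0 (V i \<omega>))"
      proof -
        have "a * max 0 (V i \<omega>) \<le> a * \<eta>" using a i(2) \<eta> by (intro mult_left_mono) auto
        then show ?thesis by simp
      qed
      finally have "1 - exp (- a * K) / 2 \<le> exp (- a * max 0 (V i \<omega>))"
        using a by (simp add: \<eta>_def)
      moreover have "exp (- a * K) \<le> exp (- a * max 0 (V j \<omega>))"
      proof -
        have "V j \<omega> \<le> K" using elim(2) j(1) by blast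
        then have "a * max 0 (V j \<omega>) \<le> a * K" using a K by (intro mult_left_mono) auto
        then show ?thesis by simp
      qed
      moreover have "(\<Sum>k\<in>{i, j}. exp (- a * max 0 (V k \<omega>))) \<le> (\<Sum>k<N \<omega>. exp (- a * max 0 (V k \<omega>)))"
        using i j by (intro sum_mono2) auto
      moreover have "(\<Sum>k\<in>{i, j}. exp (- a * max 0 (V k \<omega>))) = exp (- a * max 0 (V i \<omega>)) + exp (- a * max 0 (V j \<omega>))"
        using j by simp
      moreover have "g \<le> exp (- a * K) / 2" by (simp add: g_def)
      ultimately show ?thesis by linarith
    next
      case False
      have "1 + (a' - a) * \<eta> \<le> exp ((a' - a) * \<eta>)" by (rule exp_ge_add_one_self)
      also have "\<dots> \<le> exp ((a' - a) * \<eta>) * (\<Sum>i<N \<omega>. exp (- a' * V i \<omega>))"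
        using elim(3) by simp
      also have "\<dots> \<le> (\<Sum>i<N \<omega>. exp (- a * max 0 (V i \<omega>)))"
        unfolding sum_distrib_left
      proof (rule sum_mono)
        fix i assume "i \<in> {..<N \<omega>}"
        then have i: "\<eta> < V i \<omega>" using False by auto
        have "(a' - a) * \<eta> + - a' * V i \<omega> \<le> - a * V i \<omega>"
          using mult_left_mono[of \<eta> "V i \<omega>" "a' - a"] a i by (simp add: algebra_simps)
        then show "exp ((a' - a) * \<eta>) * exp (- a' * V i \<omega>) \<le> exp (- a * max 0 (V i \<omega>))"
          unfolding exp_add[symmetric] using i \<eta> by simp
      qed
      finally have "1 + (a' - a) * \<eta> \<le> (\<Sum>i<N \<omega>. exp (- a * max 0 (V i \<omega>)))" .
      moreover have "g \<le> (a' - a) * \<eta>" by (simp add: g_def)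
      ultimately show ?thesis by linarith
    qed
  qed
  with g show ?thesis by (rule that)
qed

text \<open>Beyond \<open>x0 + K\<close> the equation improves a bound
  \<open>u x \<ge> I * exp (a * x)\<close> by the factor \<open>1 + g\<close>. The infimum of
  \<open>u x * exp (- a * x)\<close> therefore cannot come from there, and is controlled by the
  initial strip, uniformly in \<open>T\<close>.\<close>

lemma boettcher_upper:
  assumes a: "0 < a" "a < a'" and K: "0 < K"
    and two: "AE \<omega> in M. 2 \<le> N \<omega>" and le_K: "AE \<omega> in M. \<forall>i<N \<omega>. V i \<omega> \<le> K"
    and ge: "AE \<omega> in M. 1 \<le> (\<Sum>i<N \<omega>. exp (- a' * V i \<omega>))"
    and x0: "\<Phi> x0 < 1"
  obtains c where "0 < c" "\<And>x. x0 \<le> x \<Longrightarrow> \<Phi> x \<le> exp (- c * exp (a * x))"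
proof -
  obtain g where g: "0 < g" "AE \<omega> in M. 1 + g \<le> (\<Sum>i<N \<omega>. exp (- a * max 0 (V i \<omega>)))"
    using boettcher_gap[OF a K two le_K ge] by blast
  define u where "u x = - ln (\<Phi> x)" for x
  have \<Phi>u: "\<Phi> x = exp (- u x)" for x using \<Phi>_pos by (simp add: u_def)
  have u_mono: "u x \<le> u y" if "x \<le> y" for x y
    using antimonoD[OF antimono_\<Phi> that] \<Phi>_pos by (simp add: u_def)
  have u0: "0 < u x0" using x0 \<Phi>_pos[of x0] by (simp add: u_def)
  \<comment> \<open>The lower bound that monotonicity of \<open>u\<close> gives for
    \<open>u x * exp (- a * x)\<close> on the strip from \<open>x0\<close> to \<open>x0 + K\<close>;
    from any point beyond it, a displacement of at most \<open>K\<close> does not lead below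
    \<open>x0\<close>.\<close>
  define c where "c = u x0 * exp (- a * (x0 + K))"
  have c: "0 < c" using u0 by (simp add: c_def)
  have "c \<le> u T * exp (- a * T)" if "x0 \<le> T" for T
  proof -
    \<comment> \<open>On a bounded window positivity of the infimum is free, by monotonicity of
      \<open>u\<close>; on the whole half-line it is what has to be shown.\<close>
    define I where "I = (INF x\<in>{x0..T}. u x * exp (- a * x))"
    have low: "u x0 * exp (- a * T) \<le> u x * exp (- a * x)" if "x \<in> {x0..T}" for x
      using that u_mono[of x0 x] u0 a by (intro mult_mono) auto
    have bdd: "bdd_below ((\<lambda>x. u x * exp (- a * x)) ` {x0..T})"
      using low by (intro bdd_belowI2)
    have "u x0 * exp (- a * T) \<le> I"
      unfolding I_def using that low by (intro cINF_greatest) auto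
    with u0 have I: "0 < I" by (meson exp_gt_zero mult_pos_pos less_le_trans)
    have I_le: "I * exp (a * x) \<le> u x" if "x0 \<le> x" "x \<le> T" for x
    proof -
      have "I \<le> u x * exp (- a * x)"
        unfolding I_def using that by (intro cINF_lower bdd) auto
      then have "I * exp (a * x) \<le> u x * exp (- a * x) * exp (a * x)"
        by (intro mult_right_mono) auto
      then show ?thesis by (simp add: mult.assoc exp_add[symmetric])
    qed
    have "min c ((1 + g) * I) \<le> u x * exp (- a * x)" if x: "x0 \<le> x" "x \<le> T" for x
    proof (cases "x \<le> x0 + K")
      case True
      have "c \<le> u x * exp (- a * x)"
        unfolding c_def using x True u_mono[of x0 x] u0 a by (intro mult_mono) auto
      then show ?thesis by simp
    next
      case False
      have "\<Phi> x = (\<integral>\<omega>. (\<Prod>i<N \<omega>. \<Phi> (x - V i \<omega>)) \<partial>M)" by (rule \<Phi>_eq)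
      also have "\<dots> \<le> (\<integral>\<omega>. exp (- ((1 + g) * I * exp (a * x))) \<partial>M)"
      proof (rule integral_mono_AE)
        show "AE \<omega> in M. (\<Prod>i<N \<omega>. \<Phi> (x - V i \<omega>)) \<le> exp (- ((1 + g) * I * exp (a * x)))"
          using g(2) le_K
        proof eventually_elim
          case (elim \<omega>)
          have "(\<Prod>i<N \<omega>. \<Phi> (x - V i \<omega>)) \<le> (\<Prod>i<N \<omega>. exp (- (I * exp (a * x) * exp (- a * max 0 (V i \<omega>)))))"
          proof (rule prod_mono, intro conjI)
            fix i assume i: "i \<in> {..<N \<omega>}"
            show "0 \<le> \<Phi> (x - V i \<omega>)" using \<Phi>_pos less_imp_le by blast
            \<comment> \<open>Treating a negative displacement as 0 keeps the argument below
              \<open>T\<close>, inside the window of the infimum; since \<open>\<Phi>\<close> is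
              decreasing, this only enlarges the factor.\<close>
            let ?y = "x - max 0 (V i \<omega>)"
            have "\<Phi> (x - V i \<omega>) \<le> \<Phi> ?y" by (intro antimonoD[OF antimono_\<Phi>]) simp
            also have "\<dots> \<le> exp (- (I * exp (a * ?y)))"
              unfolding \<Phi>u using I_le[of ?y] x False elim(2) i K by auto
            also have "I * exp (a * ?y) = I * exp (a * x) * exp (- a * max 0 (V i \<omega>))"
              by (simp add: exp_add[symmetric] algebra_simps)
            finally show "\<Phi> (x - V i \<omega>) \<le> exp (- (I * exp (a * x) * exp (- a * max 0 (V i \<omega>))))" .
          qed
          also have "\<dots> = exp (- (I * exp (a * x) * (\<Sum>i<N \<omega>. exp (- a * max 0 (V i \<omega>)))))"
            by (simp add: exp_sum[symmetric] sum_negf sum_distrib_left)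
          also have "\<dots> \<le> exp (- (I * exp (a * x) * (1 + g)))"
            using elim(1) I by simp
          finally show ?case by (simp add: mult_ac)
        qed
      qed (auto intro: integrable_prod_\<Phi>)
      also have "\<dots> = exp (- ((1 + g) * I * exp (a * x)))" by (simp add: prob_space)
      finally have "(1 + g) * I * exp (a * x) \<le> u x" unfolding \<Phi>u by simp
      then have "(1 + g) * I * exp (a * x) * exp (- a * x) \<le> u x * exp (- a * x)"
        by (intro mult_right_mono) auto
      then have "(1 + g) * I \<le> u x * exp (- a * x)" by (simp add: mult.assoc exp_add[symmetric])
      then show ?thesis by simp
    qed
    then have "min c ((1 + g) * I) \<le> I"
      unfolding I_def using that by (intro cINF_greatest) auto
    moreover have "I < (1 + g) * I" using g(1) I by simp
    ultimately have "c \<le> I" by linarith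
    also have "\<dots> \<le> u T * exp (- a * T)"
      unfolding I_def using that by (intro cINF_lower bdd) auto
    finally show ?thesis .
  qed
  then have "\<Phi> x \<le> exp (- c * exp (a * x))" if "x0 \<le> x" for x
    using that mult_right_mono[of c "u x * exp (- a * x)" "exp (a * x)"]
    unfolding \<Phi>u by (simp add: mult.assoc exp_add[symmetric])
  with c show ?thesis by (rule that)
qed

text \<open>On an event where the sum is at most \<open>1 - \<eta>\<close>, one step of the equation
  saves \<open>C * \<eta> * exp (a * x)\<close> in the exponent, which pays for the probability of
  the event. All displacements there are at least \<open>\<eta>\<close>, so the bound spreads to the
  right in steps of \<open>\<eta>\<close>.\<close>

lemma boettcher_lower:
  assumes a: "0 < a" and K: "0 < K"
    and le_K: "AE \<omega> in M. \<forall>i<N \<omega>. V i \<omega> \<le> K"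
    and less: "\<not> (AE \<omega> in M. 1 \<le> (\<Sum>i<N \<omega>. exp (- a * V i \<omega>)))"
  obtains C where "0 < C" "\<And>x. 0 \<le> x \<Longrightarrow> exp (- C * exp (a * x)) \<le> \<Phi> x"
proof -
  define S where "S \<omega> = (\<Sum>i<N \<omega>. exp (- a * V i \<omega>))" for \<omega>
  have [measurable]: "S \<in> borel_measurable M" unfolding S_def by measurable
  \<comment> \<open>These events exhaust the set where \<open>S\<close> is below 1: each term is
    then below 1, hence each displacement is positive, and finitely many positive numbers have a
    positive minimum.\<close>
  define E where "E n = {\<omega> \<in> space M. S \<omega> \<le> 1 - 1 / real (Suc n) \<and> (\<forall>i. i < N \<omega> \<longrightarrow> 1 / real (Suc n) \<le> V i \<omega>)}" for n
  have [measurable]: "E n \<in> sets M" for n unfolding E_def by measurable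
  obtain n where n: "prob (E n) \<noteq> 0"
  proof (rule ccontr)
    assume "\<not> thesis"
    then have "\<And>n. prob (E n) = 0" using that by blast
    then have "AE \<omega> in M. \<omega> \<notin> E n" for n
      using \<open>\<And>n. prob (E n) = 0\<close>[of n] by (simp add: AE_not_in null_setsI emeasure_eq_measure)
    then have "AE \<omega> in M. \<forall>n. \<omega> \<notin> E n" by (simp add: AE_all_countable)
    then have "AE \<omega> in M. 1 \<le> S \<omega>"
      using AE_space
    proof eventually_elim
      case (elim \<omega>)
      show ?case
      proof (rule ccontr)
        assume l: "\<not> 1 \<le> S \<omega>"
        have pos: "0 < V i \<omega>" if "i < N \<omega>" for i
        proof -
          have "exp (- a * V i \<omega>) \<le> S \<omega>" unfolding S_def using that by (intro member_le_sum) auto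
          then have "exp (- a * V i \<omega>) < 1" using l by linarith
          then show ?thesis using a by (simp add: zero_less_mult_iff)
        qed
        \<comment> \<open>Inserting \<open>1 - S \<omega>\<close> also keeps the minimum meaningful
          when there are no children.\<close>
        define \<eta> where "\<eta> = Min (insert (1 - S \<omega>) ((\<lambda>i. V i \<omega>) ` {..<N \<omega>}))"
        have "0 < \<eta>" unfolding \<eta>_def using pos l by (subst Min_gr_iff) auto
        then obtain m where m: "inverse (real (Suc m)) < \<eta>" using reals_Archimedean by blast
        have "\<eta> \<le> 1 - S \<omega>" "\<And>i. i < N \<omega> \<Longrightarrow> \<eta> \<le> V i \<omega>"
          unfolding \<eta>_def by (auto intro!: Min_le)
        moreover from m have m': "1 / real (Suc m) \<le> \<eta>" unfolding inverse_eq_divide by linarith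
        ultimately have "S \<omega> \<le> 1 - 1 / real (Suc m)" "\<And>i. i < N \<omega> \<Longrightarrow> 1 / real (Suc m) \<le> V i \<omega>"
          by (linarith, blast intro: order_trans)
        then have "\<omega> \<in> E m" unfolding E_def using elim(2) by blast
        with elim show False by blast
      qed
    qed
    with less show False by (simp add: S_def)
  qed
  define \<eta> where "\<eta> = 1 / real (Suc n)"
  define p where "p = prob (E n)"
  have \<eta>: "0 < \<eta>" by (simp add: \<eta>_def)
  have p: "0 < p" using n measure_nonneg[of M "E n"] unfolding p_def by linarith
  \<comment> \<open>\<open>- ln p / \<eta>\<close> pays for the restriction to \<open>E n\<close>,
    and \<open>- ln (\<Phi> K)\<close> starts the induction on the interval from 0 to
    \<open>K\<close>.\<close>
  define C where "C = max 1 (max (- ln p / \<eta>) (- ln (\<Phi> K)))"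
  have C: "1 \<le> C" "- ln p / \<eta> \<le> C" "- ln (\<Phi> K) \<le> C" by (auto simp: C_def)
  have base: "exp (- C * exp (a * x)) \<le> \<Phi> x" if "0 \<le> x" "x \<le> K" for x
  proof -
    have "1 \<le> exp (a * x)" using that a by simp
    then have "C \<le> C * exp (a * x)" using C(1) by simp
    then have "exp (- C * exp (a * x)) \<le> exp (- C)" by simp
    also have "\<dots> \<le> exp (ln (\<Phi> K))" using C(3) by simp
    also have "\<dots> = \<Phi> K" using \<Phi>_pos by simp
    also have "\<dots> \<le> \<Phi> x" using antimonoD[OF antimono_\<Phi>] that by simp
    finally show ?thesis .
  qed
  \<comment> \<open>Each unit of \<open>m\<close> extends the range by \<open>\<eta>\<close>.
    Arguments beyond \<open>K\<close> stay nonnegative after a displacement, which is at most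
    \<open>K\<close>.\<close>
  have "exp (- C * exp (a * x)) \<le> \<Phi> x" if "0 \<le> x" "x \<le> K + real m * \<eta>" for x m
    using that
  proof (induction m arbitrary: x)
    case 0
    then show ?case using base by simp
  next
    case (Suc m)
    show ?case
    proof (cases "x \<le> K")
      case True
      then show ?thesis using base Suc.prems by simp
    next
      case False
      let ?d = "exp (- C * ((1 - \<eta>) * exp (a * x)))"
      have "- ln p = - ln p / \<eta> * \<eta>" using \<eta> by simp
      also have "\<dots> \<le> C * \<eta>" using C(2) \<eta> by (intro mult_right_mono) auto
      also have "\<dots> \<le> C * \<eta> * exp (a * x)"
        using C(1) \<eta> a Suc.prems(1) mult_left_mono[of 1 "exp (a * x)" "C * \<eta>"] by simp
      finally have "- C * exp (a * x) \<le> ln p - C * ((1 - \<eta>) * exp (a * x))"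
        by (simp add: algebra_simps)
      then have "exp (- C * exp (a * x)) \<le> exp (ln p - C * ((1 - \<eta>) * exp (a * x)))" by simp
      also have "\<dots> = (\<integral>\<omega>. ?d * indicator (E n) \<omega> \<partial>M)"
        using p by (simp add: exp_diff exp_minus divide_inverse p_def)
      also have "\<dots> \<le> (\<integral>\<omega>. (\<Prod>i<N \<omega>. \<Phi> (x - V i \<omega>)) \<partial>M)"
      proof (rule integral_mono_AE)
        show "integrable M (\<lambda>\<omega>. ?d * indicator (E n) \<omega>)"
          by (intro integrable_mult_right integrable_real_indicator) (auto simp: emeasure_eq_measure)
        show "integrable M (\<lambda>\<omega>. \<Prod>i<N \<omega>. \<Phi> (x - V i \<omega>))" by (rule integrable_prod_\<Phi>)
        show "AE \<omega> in M. ?d * indicator (E n) \<omega> \<le> (\<Prod>i<N \<omega>. \<Phi> (x - V i \<omega>))"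
          using le_K
        proof eventually_elim
          case (elim \<omega>)
          show ?case
          proof (cases "\<omega> \<in> E n")
            case True
            have "?d \<le> exp (- C * (S \<omega> * exp (a * x)))"
              using True C(1) by (simp add: E_def \<eta>_def)
            also have "- C * (S \<omega> * exp (a * x)) = (\<Sum>i<N \<omega>. - C * (exp (- a * V i \<omega>) * exp (a * x)))"
              unfolding S_def sum_distrib_right by (rule sum_distrib_left)
            also have "\<dots> = (\<Sum>i<N \<omega>. - C * exp (a * (x - V i \<omega>)))"
              unfolding exp_add[symmetric] by (simp add: algebra_simps)
            also have "exp \<dots> = (\<Prod>i<N \<omega>. exp (- C * exp (a * (x - V i \<omega>))))"
              by (rule exp_sum) simp
            also have "\<dots> \<le> (\<Prod>i<N \<omega>. \<Phi> (x - V i \<omega>))"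
            proof (rule prod_mono, intro conjI)
              fix i assume i: "i \<in> {..<N \<omega>}"
              have "\<eta> \<le> V i \<omega>" using True i by (simp add: E_def \<eta>_def)
              then have "x - V i \<omega> \<le> K + real m * \<eta>" using Suc.prems by (simp add: algebra_simps)
              moreover have "0 \<le> x - V i \<omega>" using elim i False by (auto dest!: spec[of _ i])
              ultimately show "exp (- C * exp (a * (x - V i \<omega>))) \<le> \<Phi> (x - V i \<omega>)"
                by (intro Suc.IH)
            qed simp
            finally show ?thesis using True by simp
          next
            case False
            then show ?thesis by (simp add: prod_\<Phi>_bounds)
          qed
        qed
      qed
      also have "\<dots> = \<Phi> x" by (rule \<Phi>_eq[symmetric])
      finally show ?thesis .
    qed
  qed
  moreover have "\<exists>m. x \<le> K + real m * \<eta>" for x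
  proof -
    obtain m where "x / \<eta> \<le> real m" using real_arch_simple by blast
    then show ?thesis using \<eta> K by (intro exI[of _ m]) (simp add: pos_divide_le_eq)
  qed
  ultimately have "exp (- C * exp (a * x)) \<le> \<Phi> x" if "0 \<le> x" for x using that by blast
  with C(1) show ?thesis by (intro that[of C]) auto
qed

end

section \<open>From the Laplace transform to small values\<close>

lemma same_orderI:
  assumes "F \<noteq> bot" "0 < c" "\<forall>\<^sub>F x in F. c \<le> f x / g x" "\<forall>\<^sub>F x in F. f x / g x \<le> A"
  shows "same_order f g F"
proof -
  have "ereal c \<le> Liminf F (\<lambda>x. ereal (f x / g x))"
    using assms(3) by (intro Liminf_bounded) auto
  moreover have "0 < ereal c" using assms(2) by simp
  ultimately have "0 < Liminf F (\<lambda>x. ereal (f x / g x))" by (rule less_le_trans[rotated])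
  moreover have "Limsup F (\<lambda>x. ereal (f x / g x)) \<le> ereal A"
    using assms(4) by (intro Limsup_bounded) auto
  then have "Limsup F (\<lambda>x. ereal (f x / g x)) < \<infinity>" by (rule le_less_trans) simp
  ultimately show ?thesis
    unfolding same_order_def using Liminf_le_Limsup[OF assms(1)] by auto
qed

lemma powr_at_top:
  fixes e :: real
  assumes "0 < e"
  shows "filterlim (\<lambda>x. x powr e) at_top at_top"
proof -
  have "filterlim (\<lambda>x :: real. exp (e * ln x)) at_top at_top"
    by (intro filterlim_compose[OF exp_at_top] filterlim_tendsto_pos_mult_at_top[OF tendsto_const assms ln_at_top])
  moreover have "\<forall>\<^sub>F x :: real in at_top. exp (e * ln x) = x powr e"
    using eventually_gt_at_top[of 0] by eventually_elim (simp add: powr_def)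
  ultimately show ?thesis by (rule filterlim_cong[OF refl refl, THEN iffD1, rotated])
qed

text \<open>After division by \<open>ln t\<close> a constant factor contributes
  \<open>ln c / ln t\<close>, which vanishes; bounds with all exponents near \<open>b\<close>
  therefore force ln (r t) / ln t to tend to \<open>b\<close>.\<close>

lemma exponent_limit:
  fixes r :: "real \<Rightarrow> real"
  assumes "l < b" "b < u"
    and lower: "\<And>a. l < a \<Longrightarrow> a < b \<Longrightarrow> \<exists>c>0. \<forall>\<^sub>F t in at_top. c * t powr a \<le> r t"
    and upper: "\<And>a. b < a \<Longrightarrow> a < u \<Longrightarrow> \<exists>C>0. \<forall>\<^sub>F t in at_top. r t \<le> C * t powr a"
  obtains \<delta> where "(\<delta> \<longlongrightarrow> 0) at_top" "\<forall>\<^sub>F t in at_top. r t = t powr (b + \<delta> t)"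
proof -
  define \<delta> where "\<delta> t = ln (r t) / ln t - b" for t
  have small: "\<forall>\<^sub>F t in at_top. \<bar>k / ln t\<bar> < e" if "0 < e" for k e :: real
    using tendstoD[OF tendsto_divide_0[OF tendsto_const[of k] filterlim_at_top_imp_at_infinity[OF ln_at_top]] that]
    by (simp add: dist_real_def)
  have pos: "\<forall>\<^sub>F t in at_top. 0 < r t"
  proof -
    obtain c where "0 < c" "\<forall>\<^sub>F t in at_top. c * t powr ((l + b) / 2) \<le> r t"
      using lower[of "(l + b) / 2"] assms(1) by auto
    from this(2) eventually_gt_at_top[of 0] show ?thesis
    proof eventually_elim
      case (elim t)
      have "0 < c * t powr ((l + b) / 2)" using \<open>0 < c\<close> elim(2) by simp
      then show ?case using elim(1) by linarith
    qed
  qed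
  have "(\<delta> \<longlongrightarrow> 0) at_top"
  proof (rule tendstoI)
    fix e :: real assume e: "0 < e"
    \<comment> \<open>The midpoints keep \<open>a1\<close> and \<open>a2\<close> inside the
      admissible ranges when \<open>e\<close> is large.\<close>
    define a1 where "a1 = max (b - e / 2) ((l + b) / 2)"
    define a2 where "a2 = min (b + e / 2) ((u + b) / 2)"
    have a1: "l < a1" "a1 < b" "b - e / 2 \<le> a1" using e assms(1) by (auto simp: a1_def less_max_iff_disj)
    have a2: "b < a2" "a2 < u" "a2 \<le> b + e / 2" using e assms(2) by (auto simp: a2_def min_less_iff_disj)
    obtain c where c: "0 < c" "\<forall>\<^sub>F t in at_top. c * t powr a1 \<le> r t" using lower[OF a1(1,2)] by blast
    obtain C where C: "0 < C" "\<forall>\<^sub>F t in at_top. r t \<le> C * t powr a2" using upper[OF a2(1,2)] by blast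
    have e2: "0 < e / 2" using e by simp
    show "\<forall>\<^sub>F t in at_top. dist (\<delta> t) 0 < e"
      using c(2) C(2) pos small[OF e2, of "ln c"] small[OF e2, of "ln C"] eventually_gt_at_top[of 1]
    proof eventually_elim
      case (elim t)
      have t: "0 < ln t" using elim(6) by simp
      have "ln c + a1 * ln t = ln (c * t powr a1)" using c(1) elim(6) by (simp add: ln_mult)
      also have "\<dots> \<le> ln (r t)" using elim(1,3,6) c(1) by simp
      finally have "(ln c + a1 * ln t) / ln t \<le> ln (r t) / ln t" using t by (intro divide_right_mono) auto
      moreover have "(ln c + a1 * ln t) / ln t = ln c / ln t + a1" using t by (simp add: add_divide_distrib)
      moreover have "ln (r t) \<le> ln (C * t powr a2)" using elim(2,3,6) C(1) by simp
      then have "ln (r t) \<le> ln C + a2 * ln t" using C(1) elim(6) by (simp add: ln_mult)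
      then have "ln (r t) / ln t \<le> (ln C + a2 * ln t) / ln t" using t by (intro divide_right_mono) auto
      moreover have "(ln C + a2 * ln t) / ln t = ln C / ln t + a2" using t by (simp add: add_divide_distrib)
      ultimately show ?case using elim(4,5) a1(3) a2(3) unfolding \<delta>_def dist_real_def by linarith
    qed
  qed
  moreover have "\<forall>\<^sub>F t in at_top. r t = t powr (b + \<delta> t)"
    using pos eventually_gt_at_top[of 1]
  proof eventually_elim
    case (elim t)
    have "0 < ln t" using elim(2) by simp
    then show ?case using elim by (simp add: \<delta>_def powr_def)
  qed
  ultimately show ?thesis by (rule that)
qed

section \<open>Exponential Chebyshev estimates for a nonnegative variable\<close>

locale nonneg_random_variable = prob_space P for P :: "'b measure" +
  fixes Z :: "'b \<Rightarrow> real"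
  assumes measurable_Z [measurable]: "Z \<in> borel_measurable P"
    and Z_nonneg: "AE x in P. 0 \<le> Z x"
begin

definition laplace :: "real \<Rightarrow> real" where
  "laplace t = (\<integral>x. exp (- t * Z x) \<partial>P)"

definition laplace_pos :: "real \<Rightarrow> real" where
  "laplace_pos t = (\<integral>x. exp (- t * Z x) * indicator {x. 0 < Z x} x \<partial>P)"

lemma integrable_laplace: "0 \<le> t \<Longrightarrow> integrable P (\<lambda>x. exp (- t * Z x))"
proof (rule integrable_const_bound[where B = 1])
  assume "0 \<le> t"
  show "AE x in P. norm (exp (- t * Z x)) \<le> 1"
    using Z_nonneg by eventually_elim (simp add: \<open>0 \<le> t\<close>)
qed simp

lemma integrable_laplace_pos: "0 \<le> t \<Longrightarrow> integrable P (\<lambda>x. exp (- t * Z x) * indicator {x. 0 < Z x} x)"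
proof (rule integrable_const_bound[where B = 1])
  assume "0 \<le> t"
  then show "AE x in P. norm (exp (- t * Z x) * indicator {x. 0 < Z x} x) \<le> 1"
    by (intro AE_I2) (simp add: indicator_def)
qed simp

text \<open>The upper bound is Chebyshev at t = 1 / \<epsilon>. For the lower bound t = m /
  \<epsilon>, and on Z >= \<epsilon> the exponential is split in two halves: one gives the small
  factor \<open>exp (- m / 2)\<close>, the other retains the decay of order
  \<open>t powr (- \<gamma>)\<close>. For \<open>m\<close> large this part is at most half of the
  lower bound for the transform, so values below \<epsilon> carry the rest.\<close>

lemma same_order_small_values:
  assumes \<gamma>: "0 < \<gamma>" and c: "0 < c"
    and bounds: "\<And>t. 1 \<le> t \<Longrightarrow> c * t powr (- \<gamma>) \<le> laplace_pos t"
      "\<And>t. 1 \<le> t \<Longrightarrow> laplace_pos t \<le> A * t powr (- \<gamma>)"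
  shows "same_order (\<lambda>\<epsilon>. measure P {x \<in> space P. 0 < Z x \<and> Z x < \<epsilon>}) (\<lambda>\<epsilon>. \<epsilon> powr \<gamma>) (at_right 0)"
proof -
  let ?E = "\<lambda>\<epsilon>. {x \<in> space P. 0 < Z x \<and> Z x < \<epsilon>}"
  have int_E: "integrable P (indicator (?E \<epsilon>) :: _ \<Rightarrow> real)" for \<epsilon>
    by (intro integrable_real_indicator) (auto simp: emeasure_eq_measure)
  have upper: "measure P (?E \<epsilon>) / \<epsilon> powr \<gamma> \<le> exp 1 * A" if "0 < \<epsilon>" "\<epsilon> \<le> 1" for \<epsilon>
  proof -
    have "measure P (?E \<epsilon>) = (\<integral>x. indicator (?E \<epsilon>) x \<partial>P)" by simp
    also have "\<dots> \<le> (\<integral>x. exp 1 * (exp (- (1 / \<epsilon>) * Z x) * indicator {x. 0 < Z x} x) \<partial>P)"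
    proof (intro integral_mono int_E integrable_mult_right integrable_laplace_pos)
      show "indicator (?E \<epsilon>) x \<le> exp 1 * (exp (- (1 / \<epsilon>) * Z x) * indicator {x. 0 < Z x} x)" for x
        using that by (auto simp: indicator_def exp_add[symmetric] field_simps)
    qed (use that in auto)
    also have "\<dots> = exp 1 * laplace_pos (1 / \<epsilon>)" by (simp add: laplace_pos_def)
    also have "\<dots> \<le> exp 1 * (A * (1 / \<epsilon>) powr (- \<gamma>))"
      using that by (intro mult_left_mono bounds(2)) auto
    also have "(1 / \<epsilon>) powr (- \<gamma>) = \<epsilon> powr \<gamma>" using that by (simp add: powr_def ln_div)
    finally show ?thesis using that by (simp add: pos_divide_le_eq mult.assoc)
  qed
  have "0 < laplace_pos 1" using bounds(1)[of 1] c by simp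
  then have A: "0 < A" using bounds(2)[of 1] by simp
  have "((\<lambda>m. exp (- m / 2) * (A * 2 powr \<gamma>)) \<longlongrightarrow> 0 * (A * 2 powr \<gamma>)) at_top"
  proof (intro tendsto_mult tendsto_const filterlim_compose[OF exp_at_bot])
    have "filterlim (\<lambda>m :: real. 1 / 2 * m) at_top at_top"
      by (rule filterlim_tendsto_pos_mult_at_top[OF tendsto_const _ filterlim_ident]) simp
    then show "filterlim (\<lambda>m :: real. - m / 2) at_bot at_top"
      by (simp add: filterlim_uminus_at_bot)
  qed
  then have "\<forall>\<^sub>F m in at_top. exp (- m / 2) * (A * 2 powr \<gamma>) < c / 2"
    using c by (intro order_tendstoD) auto
  then have "\<forall>\<^sub>F m in at_top. exp (- m / 2) * (A * 2 powr \<gamma>) < c / 2 \<and> 2 \<le> m"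
    using eventually_ge_at_top[of "2 :: real"] by (rule eventually_conj)
  \<comment> \<open>\<open>2 \<le> m\<close> puts t / 2 = m / (2 \<epsilon>) into the range t >= 1
    of the upper bound.\<close>
  then obtain m where m: "exp (- m / 2) * (A * 2 powr \<gamma>) < c / 2" "2 \<le> m"
    by (auto simp: eventually_at_top_linorder)
  have lower: "c / 2 * m powr (- \<gamma>) \<le> measure P (?E \<epsilon>) / \<epsilon> powr \<gamma>" if e: "0 < \<epsilon>" "\<epsilon> \<le> 1" for \<epsilon>
  proof -
    define t where "t = m / \<epsilon>"
    have t: "2 \<le> t" using m(2) e mult_mono[of 2 m \<epsilon> 1] by (simp add: t_def pos_le_divide_eq)
    have "laplace_pos t \<le> (\<integral>x. indicator (?E \<epsilon>) x + exp (- m / 2) * (exp (- (t / 2) * Z x) * indicator {x. 0 < Z x} x) \<partial>P)"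
      unfolding laplace_pos_def
    proof (intro integral_mono_AE Bochner_Integration.integrable_add int_E integrable_mult_right integrable_laplace_pos)
      show "AE x in P. exp (- t * Z x) * indicator {x. 0 < Z x} x
          \<le> indicator (?E \<epsilon>) x + exp (- m / 2) * (exp (- (t / 2) * Z x) * indicator {x. 0 < Z x} x)"
        using AE_space
      proof eventually_elim
        case (elim x)
        show ?case
        proof (cases "0 < Z x \<and> Z x < \<epsilon>")
          case True
          then have "exp (- t * Z x) \<le> 1" using t by simp
          then show ?thesis using True elim by (simp add: add_increasing2)
        next
          case False
          show ?thesis
          proof (cases "0 < Z x")
            case True
            then have "m \<le> t * Z x" using False e m(2) mult_left_mono[of \<epsilon> "Z x" t] t
              by (simp add: t_def)
            then have "- t * Z x \<le> - m / 2 + - (t / 2) * Z x" by (simp add: field_simps)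
            then have "exp (- t * Z x) \<le> exp (- m / 2) * exp (- (t / 2) * Z x)"
              unfolding exp_add[symmetric] exp_le_cancel_iff .
            then show ?thesis using True by (simp add: add_increasing)
          qed simp
        qed
      qed
    qed (use t in auto)
    also have "\<dots> = measure P (?E \<epsilon>) + exp (- m / 2) * laplace_pos (t / 2)"
      using integrable_laplace_pos[of "t / 2"] t int_E
      by (subst Bochner_Integration.integral_add) (auto simp: laplace_pos_def)
    also have "\<dots> \<le> measure P (?E \<epsilon>) + exp (- m / 2) * (A * (t / 2) powr (- \<gamma>))"
      using t by (intro add_left_mono mult_left_mono bounds(2)) auto
    also have "(t / 2) powr (- \<gamma>) = 2 powr \<gamma> * t powr (- \<gamma>)"
      using t by (simp add: powr_def ln_div exp_add[symmetric] right_diff_distrib)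
    finally have "laplace_pos t \<le> measure P (?E \<epsilon>) + (exp (- m / 2) * (A * 2 powr \<gamma>)) * t powr (- \<gamma>)"
      by (simp add: mult.assoc)
    moreover have "(exp (- m / 2) * (A * 2 powr \<gamma>)) * t powr (- \<gamma>) \<le> c / 2 * t powr (- \<gamma>)"
      using m(1) by (intro mult_right_mono) auto
    moreover have "c * t powr (- \<gamma>) \<le> laplace_pos t" using t by (intro bounds(1)) simp
    ultimately have "c / 2 * t powr (- \<gamma>) \<le> measure P (?E \<epsilon>)" by linarith
    moreover have "t powr (- \<gamma>) = m powr (- \<gamma>) * \<epsilon> powr \<gamma>"
      using e m(2) by (simp add: t_def powr_def ln_div exp_add[symmetric] right_diff_distrib)
    ultimately show ?thesis using e by (simp add: pos_le_divide_eq mult.assoc)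
  qed
  have ev: "\<forall>\<^sub>F \<epsilon> :: real in at_right 0. 0 < \<epsilon> \<and> \<epsilon> \<le> 1"
    unfolding eventually_at_right_field by (intro exI[of _ 1]) auto
  show ?thesis
  proof (rule same_orderI)
    show "0 < c / 2 * m powr (- \<gamma>)" using c m(2) by simp
    show "\<forall>\<^sub>F \<epsilon> in at_right 0. c / 2 * m powr (- \<gamma>) \<le> measure P (?E \<epsilon>) / \<epsilon> powr \<gamma>"
      using ev by eventually_elim (use lower in blast)
    show "\<forall>\<^sub>F \<epsilon> in at_right 0. measure P (?E \<epsilon>) / \<epsilon> powr \<gamma> \<le> exp 1 * A"
      using ev by eventually_elim (use upper in blast)
  qed simp
qed

lemma same_order_laplace_pos:
  assumes c: "0 < c"
    and bounds: "\<And>t. 1 \<le> t \<Longrightarrow> c * t powr (- \<gamma>) \<le> laplace_pos t"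
      "\<And>t. 1 \<le> t \<Longrightarrow> laplace_pos t \<le> A * t powr (- \<gamma>)"
  shows "same_order laplace_pos (\<lambda>t. t powr (- \<gamma>)) at_top"
proof (rule same_orderI)
  show "\<forall>\<^sub>F t in at_top. c \<le> laplace_pos t / t powr (- \<gamma>)"
    using eventually_ge_at_top[of 1]
    by eventually_elim (use bounds in \<open>simp add: pos_le_divide_eq\<close>)
  show "\<forall>\<^sub>F t in at_top. laplace_pos t / t powr (- \<gamma>) \<le> A"
    using eventually_ge_at_top[of 1]
    by eventually_elim (use bounds in \<open>simp add: pos_divide_le_eq\<close>)
qed (use c in auto)

lemma laplace_exponent:
  assumes \<beta>: "0 < \<beta>" "\<beta> < 1"
    and upper: "\<And>a. 0 < a \<Longrightarrow> a < \<beta> \<Longrightarrow> \<exists>c>0. \<forall>\<^sub>F t in at_top. laplace t \<le> exp (- c * t powr a)"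
    and lower: "\<And>a. \<beta> < a \<Longrightarrow> a < 1 \<Longrightarrow> \<exists>C>0. \<forall>\<^sub>F t in at_top. exp (- C * t powr a) \<le> laplace t"
  obtains \<delta> where "(\<delta> \<longlongrightarrow> 0) at_top" "\<forall>\<^sub>F t in at_top. laplace t = exp (- (t powr (\<beta> + \<delta> t)))"
proof -
  obtain C' where "\<forall>\<^sub>F t in at_top. exp (- C' * t powr ((\<beta> + 1) / 2)) \<le> laplace t"
    using lower[of "(\<beta> + 1) / 2"] \<beta> by auto
  then have pos: "\<forall>\<^sub>F t in at_top. 0 < laplace t"
    by eventually_elim (rule less_le_trans[OF exp_gt_zero])
  obtain \<delta> where \<delta>: "(\<delta> \<longlongrightarrow> 0) at_top" "\<forall>\<^sub>F t in at_top. - ln (laplace t) = t powr (\<beta> + \<delta> t)"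
  proof (rule exponent_limit[of 0 \<beta> 1 "\<lambda>t. - ln (laplace t)"])
    fix a assume a: "0 < a" "a < \<beta>"
    obtain c where c: "0 < c" "\<forall>\<^sub>F t in at_top. laplace t \<le> exp (- c * t powr a)" using upper[OF a] by blast
    from c(2) pos have "\<forall>\<^sub>F t in at_top. c * t powr a \<le> - ln (laplace t)"
    proof eventually_elim
      case (elim t)
      then have "ln (laplace t) \<le> ln (exp (- c * t powr a))" by (subst ln_le_cancel_iff) auto
      then show ?case by simp
    qed
    with c(1) show "\<exists>c>0. \<forall>\<^sub>F t in at_top. c * t powr a \<le> - ln (laplace t)" by blast
  next
    fix a assume a: "\<beta> < a" "a < 1"
    obtain C where C: "0 < C" "\<forall>\<^sub>F t in at_top. exp (- C * t powr a) \<le> laplace t" using lower[OF a] by blast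
    from C(2) pos have "\<forall>\<^sub>F t in at_top. - ln (laplace t) \<le> C * t powr a"
    proof eventually_elim
      case (elim t)
      then have "ln (exp (- C * t powr a)) \<le> ln (laplace t)" by (subst ln_le_cancel_iff) auto
      then show ?case by simp
    qed
    with C(1) show "\<exists>C>0. \<forall>\<^sub>F t in at_top. - ln (laplace t) \<le> C * t powr a" by blast
  qed (use \<beta> in auto)
  have "\<forall>\<^sub>F t in at_top. laplace t = exp (- (t powr (\<beta> + \<delta> t)))"
    using pos \<delta>(2)
  proof eventually_elim
    case (elim t)
    have "laplace t = exp (- (- ln (laplace t)))" using elim(1) by simp
    then show ?case unfolding elim(2) .
  qed
  with \<delta>(1) show ?thesis by (rule that)
qed

text \<open>With s = 1 / \<epsilon>, the Chebyshev cost t / s and the size t powr a of the logarithm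
  of the transform balance when t is of order s powr (1 + b') and a = b' / (1 + b'); both are then
  of order s powr b'. The relation between a and b' is increasing and sends b' = \<beta> / (1 -
  \<beta>) to a = \<beta>, so bounds on either side of \<open>\<beta>\<close> transfer.\<close>

lemma small_value_exponent:
  assumes \<beta>: "0 < \<beta>" "\<beta> < 1"
    and upper: "\<And>a. 0 < a \<Longrightarrow> a < \<beta> \<Longrightarrow> \<exists>c>0. \<forall>\<^sub>F t in at_top. laplace t \<le> exp (- c * t powr a)"
    and lower: "\<And>a. \<beta> < a \<Longrightarrow> a < 1 \<Longrightarrow> \<exists>C>0. \<forall>\<^sub>F t in at_top. exp (- C * t powr a) \<le> laplace t"
  obtains \<delta> where "(\<delta> \<longlongrightarrow> 0) (at_right 0)"
    "\<forall>\<^sub>F \<epsilon> in at_right 0. measure P {x \<in> space P. Z x < \<epsilon>} = exp (- (\<epsilon> powr (- (\<beta> / (1 - \<beta>)) + \<delta> \<epsilon>)))"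
proof -
  let ?b = "\<beta> / (1 - \<beta>)"
  define G where "G s = measure P {x \<in> space P. Z x < 1 / s}" for s
  have int_E: "integrable P (indicator {x \<in> space P. Z x < 1 / s} :: _ \<Rightarrow> real)" for s
    by (intro integrable_real_indicator) (auto simp: emeasure_eq_measure)
  have G_le: "G s \<le> exp (t / s) * laplace t" if "0 < s" "0 \<le> t" for s t
  proof -
    have "G s = (\<integral>x. indicator {x \<in> space P. Z x < 1 / s} x \<partial>P)" by (simp add: G_def)
    also have "\<dots> \<le> (\<integral>x. exp (t / s) * exp (- t * Z x) \<partial>P)"
    proof (intro integral_mono int_E integrable_mult_right integrable_laplace)
      show "indicator {x \<in> space P. Z x < 1 / s} x \<le> exp (t / s) * exp (- t * Z x)" for x
        using mult_left_mono[of "Z x" "1 / s" t] that by (auto simp: indicator_def exp_add[symmetric])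
    qed (use that in auto)
    finally show ?thesis by (simp add: laplace_def)
  qed
  have G_ge: "laplace t - exp (- (t / s)) \<le> G s" if "0 < s" "0 \<le> t" for s t
  proof -
    have "laplace t \<le> (\<integral>x. indicator {x \<in> space P. Z x < 1 / s} x + exp (- (t / s)) \<partial>P)"
      unfolding laplace_def
    proof (intro integral_mono_AE integrable_laplace Bochner_Integration.integrable_add int_E)
      show "AE x in P. exp (- t * Z x) \<le> indicator {x \<in> space P. Z x < 1 / s} x + exp (- (t / s))"
        using Z_nonneg AE_space
      proof eventually_elim
        case (elim x)
        show ?case
        proof (cases "Z x < 1 / s")
          case True
          have "exp (- t * Z x) \<le> 1" using elim that by simp
          then show ?thesis using True elim by (simp add: add_increasing2)
        next
          case False
          then show ?thesis using mult_left_mono[of "1 / s" "Z x" t] that by simp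
        qed
      qed
    qed (use that in auto)
    also have "\<dots> = G s + exp (- (t / s))"
      using int_E by (subst Bochner_Integration.integral_add) (auto simp: G_def prob_space)
    finally show ?thesis by simp
  qed
  have exponents: "0 < b' / (1 + b')" "b' / (1 + b') < 1" "(1 + b') * (b' / (1 + b')) = b'" if "0 < b'" for b' :: real
    using that by (auto simp: field_simps)
  have scale_at_top: "filterlim (\<lambda>s :: real. (k * s) powr (1 + b')) at_top at_top" if "0 < k" "0 < b'" for k b' :: real
    using that by (intro filterlim_compose[OF powr_at_top] filterlim_tendsto_pos_mult_at_top[OF tendsto_const _ filterlim_ident]) auto
  have scale_div: "(k * s) powr (1 + b') / s = k * (k * s) powr b'" if "0 < s" "0 < k" for k b' s :: real
    using that by (simp add: powr_add)
  have up: "\<exists>C>0. \<forall>\<^sub>F s in at_top. exp (- C * s powr b') \<le> G s" if b': "?b < b'" for b'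
  proof -
    have "0 < ?b" using \<beta> by simp
    then have b'_pos: "0 < b'" using b' by linarith
    let ?a = "b' / (1 + b')"
    have "\<beta> < ?a" using b' b'_pos \<beta> by (simp add: field_simps)
    then obtain C where C: "0 < C" "\<forall>\<^sub>F t in at_top. exp (- C * t powr ?a) \<le> laplace t"
      using lower exponents(2)[OF b'_pos] by blast
    \<comment> \<open>The factor \<open>2 * C\<close> makes t / s twice as large as the exponent of
      the transform, so the subtracted exponential is the square of the main term, which is
      eventually at most 1/2.\<close>
    let ?t = "\<lambda>s. (2 * C * s) powr (1 + b')"
    have pow: "?t s powr ?a = (2 * C * s) powr b'" for s
      unfolding powr_powr exponents(3)[OF b'_pos] ..
    have "\<forall>\<^sub>F s in at_top. exp (- C * ?t s powr ?a) \<le> laplace (?t s)"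
      using C(1) b'_pos by (intro eventually_compose_filterlim[OF C(2)] scale_at_top) auto
    moreover have "\<forall>\<^sub>F s in at_top. ln 2 / C \<le> (2 * C * s) powr b'"
    proof -
      have "filterlim (\<lambda>s. (2 * C * s) powr b') at_top at_top"
        using C(1) b'_pos by (intro filterlim_compose[OF powr_at_top] filterlim_tendsto_pos_mult_at_top[OF tendsto_const _ filterlim_ident]) auto
      then show ?thesis by (auto simp: filterlim_at_top)
    qed
    ultimately have "\<forall>\<^sub>F s in at_top. exp (- (2 * C * (2 * C) powr b') * s powr b') \<le> G s"
      using eventually_gt_at_top[of 0]
    proof eventually_elim
      case (elim s)
      define w where "w = (2 * C * s) powr b'"
      have "ln 2 \<le> C * w" using elim(2) C(1) by (simp add: w_def pos_divide_le_eq mult.commute)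
      then have "exp (- C * w) \<le> exp (- ln 2)" by simp
      then have half: "exp (- C * w) \<le> 1 / 2" by (simp add: exp_minus)
      have "exp (- (2 * C) * w) = exp (- C * w) * exp (- C * w)"
        by (simp add: exp_add[symmetric])
      also have "\<dots> \<le> exp (- C * w) * (1 - exp (- C * w))"
        using half by (intro mult_left_mono) auto
      also have "\<dots> = exp (- C * w) - exp (- (2 * C) * w)"
        by (simp add: right_diff_distrib exp_add[symmetric])
      also have "\<dots> \<le> laplace (?t s) - exp (- (?t s / s))"
        using elim(1) scale_div[of s "2 * C" b'] elim(3) C(1) unfolding pow by (simp add: w_def)
      also have "\<dots> \<le> G s" using elim(3) by (intro G_ge) auto
      also have "w = (2 * C) powr b' * s powr b'" unfolding w_def by (rule powr_mult)
      finally show ?case by (simp add: mult.assoc)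
    qed
    moreover have "0 < 2 * C * (2 * C) powr b'" using C(1) by simp
    ultimately show ?thesis by blast
  qed
  have low: "\<exists>c>0. \<forall>\<^sub>F s in at_top. G s \<le> exp (- c * s powr b')" if b': "0 < b'" "b' < ?b" for b'
  proof -
    let ?a = "b' / (1 + b')"
    have "?a < \<beta>" using b' \<beta> by (simp add: field_simps)
    then obtain c where c: "0 < c" "\<forall>\<^sub>F t in at_top. laplace t \<le> exp (- c * t powr ?a)"
      using upper exponents(1)[OF b'(1)] by blast
    \<comment> \<open>The factor \<open>c / 2\<close> makes the Chebyshev cost half of the exponent
      gained from the transform.\<close>
    let ?t = "\<lambda>s. (c / 2 * s) powr (1 + b')"
    have pow: "?t s powr ?a = (c / 2 * s) powr b'" for s
      unfolding powr_powr exponents(3)[OF b'(1)] ..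
    have "\<forall>\<^sub>F s in at_top. laplace (?t s) \<le> exp (- c * ?t s powr ?a)"
      using c(1) b'(1) by (intro eventually_compose_filterlim[OF c(2)] scale_at_top) auto
    then have "\<forall>\<^sub>F s in at_top. G s \<le> exp (- (c / 2 * (c / 2) powr b') * s powr b')"
      using eventually_gt_at_top[of 0]
    proof eventually_elim
      case (elim s)
      define w where "w = (c / 2 * s) powr b'"
      have "G s \<le> exp (?t s / s) * laplace (?t s)" using elim(2) by (intro G_le) auto
      also have "\<dots> \<le> exp (c / 2 * w) * exp (- c * w)"
        using elim(1) scale_div[of s "c / 2" b'] elim(2) c(1) unfolding pow w_def
        by (simp only: half_gt_zero mult_left_mono exp_ge_zero)
      also have "\<dots> = exp (- (c / 2) * w)" unfolding exp_add[symmetric] by (simp add: field_simps)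
      also have "w = (c / 2) powr b' * s powr b'" unfolding w_def by (rule powr_mult)
      finally show ?case by (simp add: mult.assoc)
    qed
    moreover have "0 < c / 2 * (c / 2) powr b'" using c(1) by simp
    ultimately show ?thesis by blast
  qed
  have b: "0 < ?b" using \<beta> by simp
  have pos: "\<forall>\<^sub>F s in at_top. 0 < G s"
  proof -
    obtain C where "\<forall>\<^sub>F s in at_top. exp (- C * s powr (?b + 1)) \<le> G s"
      using up[of "?b + 1"] by auto
    then show ?thesis by eventually_elim (rule less_le_trans[OF exp_gt_zero])
  qed
  obtain \<delta> where \<delta>: "(\<delta> \<longlongrightarrow> 0) at_top" "\<forall>\<^sub>F s in at_top. - ln (G s) = s powr (?b + \<delta> s)"
  proof (rule exponent_limit[of 0 ?b "?b + 1" "\<lambda>s. - ln (G s)"])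
    fix b' assume b': "0 < b'" "b' < ?b"
    obtain c where c: "0 < c" "\<forall>\<^sub>F s in at_top. G s \<le> exp (- c * s powr b')" using low[OF b'] by blast
    from c(2) pos have "\<forall>\<^sub>F s in at_top. c * s powr b' \<le> - ln (G s)"
    proof eventually_elim
      case (elim s)
      then have "ln (G s) \<le> ln (exp (- c * s powr b'))" by (subst ln_le_cancel_iff) auto
      then show ?case by simp
    qed
    with c(1) show "\<exists>c>0. \<forall>\<^sub>F s in at_top. c * s powr b' \<le> - ln (G s)" by blast
  next
    fix b' assume b': "?b < b'" "b' < ?b + 1"
    obtain C where C: "0 < C" "\<forall>\<^sub>F s in at_top. exp (- C * s powr b') \<le> G s" using up[OF b'(1)] by blast
    from C(2) pos have "\<forall>\<^sub>F s in at_top. - ln (G s) \<le> C * s powr b'"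
    proof eventually_elim
      case (elim s)
      then have "ln (exp (- C * s powr b')) \<le> ln (G s)" by (subst ln_le_cancel_iff) auto
      then show ?case by simp
    qed
    with C(1) show "\<exists>C>0. \<forall>\<^sub>F s in at_top. - ln (G s) \<le> C * s powr b'" by blast
  qed (use b in auto)
  have inv: "filterlim (\<lambda>\<epsilon> :: real. inverse \<epsilon>) at_top (at_right 0)" by (rule filterlim_inverse_at_top_right)
  show ?thesis
  proof (rule that[of "\<lambda>\<epsilon>. - \<delta> (inverse \<epsilon>)"])
    show "((\<lambda>\<epsilon>. - \<delta> (inverse \<epsilon>)) \<longlongrightarrow> 0) (at_right 0)"
      using tendsto_minus[OF filterlim_compose[OF \<delta>(1) inv]] by simp
    have "\<forall>\<^sub>F s in at_top. G s = exp (- (s powr (?b + \<delta> s)))"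
      using pos \<delta>(2)
    proof eventually_elim
      case (elim s)
      have "G s = exp (- (- ln (G s)))" using elim(1) by simp
      then show ?case unfolding elim(2) .
    qed
    then have "\<forall>\<^sub>F \<epsilon> in at_right 0. G (inverse \<epsilon>) = exp (- (inverse \<epsilon> powr (?b + \<delta> (inverse \<epsilon>))))"
      by (rule eventually_compose_filterlim[OF _ inv])
    moreover have "\<forall>\<^sub>F \<epsilon> :: real in at_right 0. 0 < \<epsilon>" by (rule eventually_at_right_less)
    ultimately show "\<forall>\<^sub>F \<epsilon> in at_right 0. measure P {x \<in> space P. Z x < \<epsilon>}
        = exp (- (\<epsilon> powr (- ?b + - \<delta> (inverse \<epsilon>))))"
    proof eventually_elim
      case (elim \<epsilon>)
      have "inverse \<epsilon> powr (?b + \<delta> (inverse \<epsilon>)) = \<epsilon> powr (- ?b + - \<delta> (inverse \<epsilon>))"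
        using elim(2) by (simp add: powr_def ln_inverse algebra_simps)
      with elim(1) show ?case by (simp add: G_def inverse_eq_divide)
    qed
  qed
qed

end

section \<open>The functional equation\<close>

text \<open>The index type is general because the fact serves both the sequence of copies of
  \<open>Z\<close> and the randomness attached to all words of the tree.\<close>

lemma indep_vars_PiM_coordinates:
  assumes "prob_space L"
  shows "prob_space.indep_vars (PiM (UNIV :: 'i set) (\<lambda>_. L)) (\<lambda>_. L) (\<lambda>i z. z i) UNIV"
proof -
  interpret Q: prob_space "PiM (UNIV :: 'i set) (\<lambda>_. L)"
    by (intro prob_space_PiM assms)
  show ?thesis
  proof (subst Q.indep_vars_iff_distr_eq_PiM)
    have "distr (PiM (UNIV :: 'i set) (\<lambda>_. L)) L (\<lambda>z. z i) = L" for i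
      using assms by (intro distr_PiM_component) auto
    then show "distr (PiM UNIV (\<lambda>_. L)) (PiM UNIV (\<lambda>_. L)) (\<lambda>x. \<lambda>i\<in>UNIV. x i)
        = PiM (UNIV :: 'i set) (\<lambda>i. distr (PiM UNIV (\<lambda>_. L)) L (\<lambda>z. z i))"
      by (simp add: restrict_def distr_id)
  qed auto
qed

lemma nn_integral_PiM_prod:
  fixes L :: "real measure" and f :: "nat \<Rightarrow> real \<Rightarrow> ennreal"
  assumes L: "prob_space L" and f: "\<And>i. f i \<in> borel_measurable L"
  shows "(\<integral>\<^sup>+z. (\<Prod>i<n. f i (z i)) \<partial>PiM (UNIV :: nat set) (\<lambda>_. L)) = (\<Prod>i<n. \<integral>\<^sup>+x. f i x \<partial>L)"
proof -
  interpret Q: prob_space "PiM (UNIV :: nat set) (\<lambda>_. L)"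
    by (intro prob_space_PiM L)
  have "Q.indep_vars (\<lambda>_. L) (\<lambda>i z. z i) {..<n}"
    by (rule Q.indep_vars_subset[OF indep_vars_PiM_coordinates[OF L]]) simp
  then have "Q.indep_vars (\<lambda>_. borel) (\<lambda>i z. f i (z i)) {..<n}"
    by (rule Q.indep_vars_compose2) (rule f)
  then have "(\<integral>\<^sup>+z. (\<Prod>i<n. f i (z i)) \<partial>PiM (UNIV :: nat set) (\<lambda>_. L))
      = (\<Prod>i<n. \<integral>\<^sup>+z. f i (z i) \<partial>PiM (UNIV :: nat set) (\<lambda>_. L))"
    by (intro Q.indep_vars_nn_integral) auto
  also have "\<dots> = (\<Prod>i<n. \<integral>\<^sup>+x. f i x \<partial>L)"
  proof (rule prod.cong[OF refl])
    fix i
    have "(\<integral>\<^sup>+x. f i x \<partial>L) = (\<integral>\<^sup>+x. f i x \<partial>distr (PiM (UNIV :: nat set) (\<lambda>_. L)) L (\<lambda>z. z i))"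
      using L by (subst distr_PiM_component) auto
    also have "\<dots> = (\<integral>\<^sup>+z. f i (z i) \<partial>PiM (UNIV :: nat set) (\<lambda>_. L))"
      using f by (intro nn_integral_distr) auto
    finally show "(\<integral>\<^sup>+z. f i (z i) \<partial>PiM (UNIV :: nat set) (\<lambda>_. L)) = (\<integral>\<^sup>+x. f i x \<partial>L)" ..
  qed
  finally show ?thesis .
qed

lemma child_sum_finite:
  assumes "\<nu> \<omega> \<noteq> \<infinity>"
  shows "child_sum \<nu> \<omega> f = (\<Sum>i<the_enat (\<nu> \<omega>). f i)"
proof -
  obtain n where n: "\<nu> \<omega> = enat n" using assms by auto
  have "(\<Sum>i. if enat i < \<nu> \<omega> then f i else 0) = (\<Sum>i<n. if enat i < \<nu> \<omega> then f i else 0)"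
    by (rule suminf_finite) (auto simp: n)
  then show ?thesis by (simp add: child_sum_def n)
qed

lemma child_sum_infinite:
  assumes "\<nu> \<omega> = \<infinity>" "0 < c" "\<And>i. ennreal c \<le> f i"
  shows "child_sum \<nu> \<omega> f = \<top>"
proof (rule ccontr)
  assume "child_sum \<nu> \<omega> f \<noteq> \<top>"
  then obtain r where r: "child_sum \<nu> \<omega> f = ennreal r" "0 \<le> r"
    by (cases "child_sum \<nu> \<omega> f") auto
  obtain n where n: "r < of_nat n * c"
    using reals_Archimedean3[OF assms(2)] by blast
  have "ennreal (of_nat n * c) = (\<Sum>i<n. ennreal c)"
    using assms(2) by (simp add: ennreal_mult ennreal_of_nat_eq_real_of_nat)
  also have "\<dots> \<le> (\<Sum>i<n. f i)" using assms(3) by (intro sum_mono)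
  also have "\<dots> \<le> (\<Sum>i. f i)" by (intro sum_le_suminf) auto
  also have "\<dots> = ennreal r" using r(1) by (simp add: child_sum_def assms(1))
  finally show False using n r(2) by (simp add: ennreal_le_iff)
qed

context point_process
begin

text \<open>The value at \<infinity> is unspecified; the results that interpret it as the number of
  children assume that \<infinity> has probability 0.\<close>

definition offspring :: "'a \<Rightarrow> nat" where
  "offspring \<omega> = the_enat (\<nu> \<omega>)"

lemma measurable_offspring [measurable]: "offspring \<in> measurable M (count_space UNIV)"
  unfolding offspring_def by (rule measurable_compose[OF measurable_number]) simp

lemma pred_less_number [measurable]: "Measurable.pred M (\<lambda>\<omega>. enat i < \<nu> \<omega>)"
  by (rule measurable_compose[OF measurable_number]) simp

declare measurable_position [measurable]

lemma measurable_child_sum [measurable (raw)]: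
  assumes [measurable]: "\<And>i. f i \<in> borel_measurable M"
  shows "(\<lambda>\<omega>. child_sum \<nu> \<omega> (\<lambda>i. f i \<omega>)) \<in> borel_measurable M"
  unfolding child_sum_def by measurable

end

locale finite_point_process = point_process +
  assumes finite_number: "AE \<omega> in M. \<nu> \<omega> \<noteq> \<infinity>"
begin

lemma nn_integral_child_sum:
  assumes "\<And>i \<omega>. 0 \<le> f i \<omega>"
  shows "(\<integral>\<^sup>+\<omega>. g \<omega> * child_sum \<nu> \<omega> (\<lambda>i. ennreal (f i \<omega>)) \<partial>M)
    = (\<integral>\<^sup>+\<omega>. g \<omega> * ennreal (\<Sum>i<offspring \<omega>. f i \<omega>) \<partial>M)"
proof (rule nn_integral_cong_AE)
  show "AE \<omega> in M. g \<omega> * child_sum \<nu> \<omega> (\<lambda>i. ennreal (f i \<omega>)) = g \<omega> * ennreal (\<Sum>i<offspring \<omega>. f i \<omega>)"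
    using finite_number by eventually_elim (simp add: child_sum_finite offspring_def assms)
qed

end

section \<open>The Laplace transform of a solution and its atom at zero\<close>

locale smoothing_solution = finite_point_process +
  fixes P :: "'b measure" and Z :: "'b \<Rightarrow> real"
  assumes solution: "nontrivial_solution M \<nu> V P Z"
begin

sublocale Z: nonneg_random_variable P Z
  using solution
  by (simp add: nontrivial_solution_def nonneg_random_variable_def nonneg_random_variable_axioms_def)

lemma laplace_bounds: "0 \<le> t \<Longrightarrow> 0 < Z.laplace t" "0 \<le> t \<Longrightarrow> Z.laplace t \<le> 1"
proof -
  assume t: "0 \<le> t"
  have "Z.laplace t \<noteq> 0"
  proof
    assume "Z.laplace t = 0"
    then have "AE x in P. exp (- t * Z x) = 0"
      unfolding Z.laplace_def using integral_nonneg_eq_0_iff_AE[OF Z.integrable_laplace[OF t]] by simp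
    then show False by (simp add: Z.AE_False)
  qed
  moreover have "0 \<le> Z.laplace t" unfolding Z.laplace_def by (intro integral_nonneg_AE AE_I2) simp
  ultimately show "0 < Z.laplace t" by simp
  have "Z.laplace t \<le> (\<integral>x. 1 \<partial>P)"
    unfolding Z.laplace_def
  proof (rule integral_mono_AE[OF Z.integrable_laplace[OF t]])
    show "AE x in P. exp (- t * Z x) \<le> 1" using Z.Z_nonneg by eventually_elim (simp add: t)
  qed simp
  then show "Z.laplace t \<le> 1" by (simp add: Z.prob_space)
qed

lemma laplace_antimono:
  assumes "0 \<le> s" "s \<le> t"
  shows "Z.laplace t \<le> Z.laplace s"
  unfolding Z.laplace_def
proof (rule integral_mono_AE)
  show "AE x in P. exp (- t * Z x) \<le> exp (- s * Z x)"
    using Z.Z_nonneg by eventually_elim (simp add: assms mult_right_mono)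
qed (use assms Z.integrable_laplace in auto)

text \<open>Given the point process, the exponential of the sum is a product of functions of
  independent coordinates, so its integral factorises. Working with nonnegative integrals lets
  Tonelli apply at once; real integrals return only at the end.\<close>

lemma laplace_functional_equation:
  assumes t: "0 \<le> t"
  shows "Z.laplace t = (\<integral>\<omega>. (\<Prod>i<offspring \<omega>. Z.laplace (t * exp (- V i \<omega>))) \<partial>M)"
proof -
  define L where "L = distr P borel Z"
  have L: "prob_space L" unfolding L_def by (rule Z.prob_space_distr) simp
  have [measurable_cong, simp]: "sets L = sets borel" by (simp add: L_def)
  let ?Q = "PiM (UNIV :: nat set) (\<lambda>_. L)"
  interpret Q: prob_space ?Q by (intro prob_space_PiM L)
  \<comment> \<open>\<open>enn2real\<close> sends \<infinity> to 0, which is harmless: the sum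
    almost surely has finitely many terms, each of them finite.\<close>
  define h where "h y = ennreal (exp (- t * enn2real y))" for y
  have [measurable]: "h \<in> borel_measurable borel" unfolding h_def by measurable
  define S where "S = (\<lambda>(\<omega>, z). child_sum \<nu> \<omega> (\<lambda>i. ennreal (exp (- V i \<omega>)) * ennreal (z i)))"
  have S [measurable]: "S \<in> borel_measurable (M \<Otimes>\<^sub>M ?Q)"
    unfolding S_def child_sum_def split_beta' by measurable
  \<comment> \<open>\<open>ennreal\<close> truncates negative arguments to 0, hence the
    \<open>max 0\<close>; as \<open>Z\<close> is almost surely nonnegative, the integral does not
    change.\<close>
  have exp_L: "(\<integral>\<^sup>+z. ennreal (exp (- s * max 0 z)) \<partial>L) = ennreal (Z.laplace s)" if "0 \<le> s" for s
  proof -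
    have "(\<integral>\<^sup>+z. ennreal (exp (- s * max 0 z)) \<partial>L) = (\<integral>\<^sup>+x. ennreal (exp (- s * max 0 (Z x))) \<partial>P)"
      unfolding L_def by (intro nn_integral_distr) auto
    also have "\<dots> = (\<integral>\<^sup>+x. ennreal (exp (- s * Z x)) \<partial>P)"
    proof (rule nn_integral_cong_AE)
      show "AE x in P. ennreal (exp (- s * max 0 (Z x))) = ennreal (exp (- s * Z x))"
        using Z.Z_nonneg by eventually_elim simp
    qed
    also have "\<dots> = ennreal (Z.laplace s)"
      unfolding Z.laplace_def by (intro nn_integral_eq_integral Z.integrable_laplace that) auto
    finally show ?thesis .
  qed
  have inner: "(\<integral>\<^sup>+z. h (S (\<omega>, z)) \<partial>?Q) = ennreal (\<Prod>i<offspring \<omega>. Z.laplace (t * exp (- V i \<omega>)))"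
    if fin: "\<nu> \<omega> \<noteq> \<infinity>" for \<omega>
  proof -
    have "h (S (\<omega>, z)) = (\<Prod>i<offspring \<omega>. ennreal (exp (- (t * exp (- V i \<omega>)) * max 0 (z i))))" for z
    proof -
      have "S (\<omega>, z) = (\<Sum>i<offspring \<omega>. ennreal (exp (- V i \<omega>)) * ennreal (z i))"
        by (simp add: S_def child_sum_finite[of \<nu> \<omega>, OF fin] offspring_def)
      also have "\<dots> = (\<Sum>i<offspring \<omega>. ennreal (exp (- V i \<omega>) * max 0 (z i)))"
      proof (rule sum.cong[OF refl])
        fix i
        show "ennreal (exp (- V i \<omega>)) * ennreal (z i) = ennreal (exp (- V i \<omega>) * max 0 (z i))"
          by (cases "0 \<le> z i") (auto simp: max_def ennreal_mult ennreal_neg)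
      qed
      also have "\<dots> = ennreal (\<Sum>i<offspring \<omega>. exp (- V i \<omega>) * max 0 (z i))"
        by (intro sum_ennreal) simp
      finally have "enn2real (S (\<omega>, z)) = (\<Sum>i<offspring \<omega>. exp (- V i \<omega>) * max 0 (z i))"
        by (simp add: sum_nonneg)
      then have "h (S (\<omega>, z)) = ennreal (exp (\<Sum>i<offspring \<omega>. - (t * exp (- V i \<omega>)) * max 0 (z i)))"
        by (simp add: h_def sum_distrib_left sum_negf mult.assoc)
      also have "\<dots> = (\<Prod>i<offspring \<omega>. ennreal (exp (- (t * exp (- V i \<omega>)) * max 0 (z i))))"
        by (simp add: exp_sum prod_ennreal)
      finally show ?thesis .
    qed
    then have "(\<integral>\<^sup>+z. h (S (\<omega>, z)) \<partial>?Q)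
        = (\<Prod>i<offspring \<omega>. \<integral>\<^sup>+x. ennreal (exp (- (t * exp (- V i \<omega>)) * max 0 x)) \<partial>L)"
      using nn_integral_PiM_prod[OF L, of "\<lambda>i x. ennreal (exp (- (t * exp (- V i \<omega>)) * max 0 x))" "offspring \<omega>"]
      by simp
    also have "\<dots> = (\<Prod>i<offspring \<omega>. ennreal (Z.laplace (t * exp (- V i \<omega>))))"
      using t by (intro prod.cong refl exp_L) simp
    also have "\<dots> = ennreal (\<Prod>i<offspring \<omega>. Z.laplace (t * exp (- V i \<omega>)))"
      using t laplace_bounds(1) by (intro prod_ennreal less_imp_le) auto
    finally show ?thesis .
  qed
  have "ennreal (Z.laplace t) = (\<integral>\<^sup>+x. ennreal (exp (- t * Z x)) \<partial>P)"
    unfolding Z.laplace_def by (intro nn_integral_eq_integral[symmetric] Z.integrable_laplace t) auto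
  also have "\<dots> = (\<integral>\<^sup>+x. h (ennreal (Z x)) \<partial>P)"
  proof (rule nn_integral_cong_AE)
    show "AE x in P. ennreal (exp (- t * Z x)) = h (ennreal (Z x))"
      using Z.Z_nonneg by eventually_elim (simp add: h_def)
  qed
  also have "\<dots> = (\<integral>\<^sup>+y. h y \<partial>distr P borel (\<lambda>x. ennreal (Z x)))"
    by (intro nn_integral_distr[symmetric]) auto
  also have "distr P borel (\<lambda>x. ennreal (Z x)) = distr (M \<Otimes>\<^sub>M ?Q) borel S"
    using solution unfolding nontrivial_solution_def smoothing_law_def L_def S_def by blast
  also have "(\<integral>\<^sup>+y. h y \<partial>distr (M \<Otimes>\<^sub>M ?Q) borel S) = (\<integral>\<^sup>+p. h (S p) \<partial>(M \<Otimes>\<^sub>M ?Q))"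
    by (intro nn_integral_distr) auto
  also have "\<dots> = (\<integral>\<^sup>+\<omega>. \<integral>\<^sup>+z. h (S (\<omega>, z)) \<partial>?Q \<partial>M)"
    by (rule Q.nn_integral_fst[symmetric]) measurable
  also have "\<dots> = (\<integral>\<^sup>+\<omega>. ennreal (\<Prod>i<offspring \<omega>. Z.laplace (t * exp (- V i \<omega>))) \<partial>M)"
  proof (rule nn_integral_cong_AE)
    show "AE \<omega> in M. (\<integral>\<^sup>+z. h (S (\<omega>, z)) \<partial>?Q) = ennreal (\<Prod>i<offspring \<omega>. Z.laplace (t * exp (- V i \<omega>)))"
      using finite_number by eventually_elim (rule inner)
  qed
  finally have "ennreal (Z.laplace t) = (\<integral>\<^sup>+\<omega>. ennreal (\<Prod>i<offspring \<omega>. Z.laplace (t * exp (- V i \<omega>))) \<partial>M)" .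
  then have "enn2real (ennreal (Z.laplace t)) = (\<integral>\<omega>. (\<Prod>i<offspring \<omega>. Z.laplace (t * exp (- V i \<omega>))) \<partial>M)"
  proof (subst integral_eq_nn_integral)
    have "antimono (\<lambda>x. Z.laplace (exp x))"
      by (intro antimonoI laplace_antimono) auto
    then have [measurable]: "(\<lambda>x. Z.laplace (exp x)) \<in> borel_measurable borel"
      using borel_measurable_mono[of "\<lambda>x. - Z.laplace (exp x)"] by (simp add: mono_def antimono_def)
    have "(\<lambda>\<omega>. \<Prod>i<offspring \<omega>. Z.laplace (t * exp (- V i \<omega>))) \<in> borel_measurable M"
    proof (cases "t = 0")
      case True
      then show ?thesis by (simp add: measurable_compose[OF measurable_offspring])
    next
      case False
      then have "t * exp (- v) = exp (ln t - v)" for v using t by (simp add: exp_diff exp_minus divide_inverse)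
      then show ?thesis
        by (simp only:) (rule measurable_compose_countable[OF _ measurable_offspring], measurable)
    qed
    then show "(\<lambda>\<omega>. \<Prod>i<offspring \<omega>. Z.laplace (t * exp (- V i \<omega>))) \<in> borel_measurable M" .
    show "AE \<omega> in M. 0 \<le> (\<Prod>i<offspring \<omega>. Z.laplace (t * exp (- V i \<omega>)))"
      using t laplace_bounds(1) by (intro AE_I2 prod_nonneg) (auto intro: less_imp_le)
  qed simp
  then show ?thesis using laplace_bounds(1)[OF t] by simp
qed

sublocale transform: branching_transform M offspring V "\<lambda>x. Z.laplace (exp x)"
proof
  show "antimono (\<lambda>x. Z.laplace (exp x))" by (intro antimonoI laplace_antimono) auto
  show "Z.laplace (exp x) = (\<integral>\<omega>. (\<Prod>i<offspring \<omega>. Z.laplace (exp (x - V i \<omega>))) \<partial>M)" for x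
    using laplace_functional_equation[of "exp x"] by (simp add: exp_diff exp_minus divide_inverse)
qed (use laplace_bounds measurable_offspring measurable_position in auto)

definition mass_zero :: real where
  "mass_zero = measure P {x \<in> space P. Z x = 0}"

lemma laplace_split:
  assumes "0 \<le> t"
  shows "Z.laplace t = mass_zero + Z.laplace_pos t"
proof -
  have "Z.laplace t = (\<integral>x. indicator {x \<in> space P. Z x = 0} x + exp (- t * Z x) * indicator {x. 0 < Z x} x \<partial>P)"
    unfolding Z.laplace_def
  proof (rule integral_cong_AE)
    show "AE x in P. exp (- t * Z x) = indicator {x \<in> space P. Z x = 0} x + exp (- t * Z x) * indicator {x. 0 < Z x} x"
      using Z.Z_nonneg AE_space by eventually_elim (auto simp: indicator_def)
  qed auto
  also have "\<dots> = mass_zero + Z.laplace_pos t"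
    using Z.integrable_laplace_pos[OF assms]
    by (subst Bochner_Integration.integral_add)
      (auto simp: mass_zero_def Z.laplace_pos_def Z.emeasure_eq_measure intro!: integrable_real_indicator)
  finally show ?thesis .
qed

lemma laplace_pos_pos:
  assumes "0 \<le> t"
  shows "0 < Z.laplace_pos t"
proof -
  have "Z.laplace_pos t \<noteq> 0"
  proof
    assume "Z.laplace_pos t = 0"
    then have "AE x in P. exp (- t * Z x) * indicator {x. 0 < Z x} x = 0"
      unfolding Z.laplace_pos_def
      using integral_nonneg_eq_0_iff_AE[OF Z.integrable_laplace_pos[OF assms]] by simp
    then have "AE x in P. Z x = 0"
      using Z.Z_nonneg by eventually_elim (auto simp: indicator_def split: if_splits)
    then show False using solution by (simp add: nontrivial_solution_def)
  qed
  moreover have "0 \<le> Z.laplace_pos t" unfolding Z.laplace_pos_def by (intro integral_nonneg_AE AE_I2) simp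
  ultimately show ?thesis by simp
qed

lemma tendsto_laplace: "(Z.laplace \<longlongrightarrow> mass_zero) at_top"
proof -
  have "(Z.laplace_pos \<longlongrightarrow> (\<integral>x. 0 \<partial>P)) at_top"
    unfolding Z.laplace_pos_def
  proof (rule integral_dominated_convergence_at_top[where w = "\<lambda>_. 1"])
    show "\<forall>\<^sub>F t in at_top. AE x in P. norm (exp (- t * Z x) * indicator {x. 0 < Z x} x) \<le> 1"
      using eventually_ge_at_top[of 0] by eventually_elim (auto simp: indicator_def)
    show "AE x in P. ((\<lambda>t. exp (- t * Z x) * indicator {x. 0 < Z x} x) \<longlongrightarrow> 0) at_top"
    proof (rule AE_I2)
      fix x
      show "((\<lambda>t. exp (- t * Z x) * indicator {x. 0 < Z x} x) \<longlongrightarrow> 0) at_top"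
      proof (cases "0 < Z x")
        case True
        have "filterlim (\<lambda>t. Z x * t) at_top at_top"
          by (rule filterlim_tendsto_pos_mult_at_top[OF tendsto_const True filterlim_ident])
        then have "filterlim (\<lambda>t. - t * Z x) at_bot at_top"
          by (simp add: filterlim_uminus_at_bot mult.commute)
        then have "((\<lambda>t. exp (- t * Z x)) \<longlongrightarrow> 0) at_top" by (rule filterlim_compose[OF exp_at_bot])
        then show ?thesis using True by simp
      qed simp
    qed
  qed auto
  then have "((\<lambda>t. mass_zero + Z.laplace_pos t) \<longlongrightarrow> mass_zero + 0) at_top"
    by (intro tendsto_add tendsto_const) simp
  moreover have "\<forall>\<^sub>F t in at_top. mass_zero + Z.laplace_pos t = Z.laplace t"
    using eventually_ge_at_top[of 0] by eventually_elim (simp add: laplace_split)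
  ultimately show ?thesis by (simp add: tendsto_cong)
qed

lemma mass_zero_bounds: "0 \<le> mass_zero" "mass_zero < 1"
proof -
  show "0 \<le> mass_zero" by (simp add: mass_zero_def)
  show "mass_zero < 1" using laplace_split[of 0] laplace_pos_pos[of 0] laplace_bounds(2)[of 0] by simp
qed

text \<open>The limit of the functional equation at infinity: the argument of every child tends to
  infinity as well, so each of the finitely many factors tends to \<open>mass_zero\<close>. The
  successors as arguments keep the logarithm meaningful.\<close>

lemma mass_zero_fixed: "(\<integral>\<omega>. mass_zero ^ offspring \<omega> \<partial>M) = mass_zero"
proof (rule LIMSEQ_unique)
  have lim: "filterlim (\<lambda>n. real n * c) at_top sequentially" if "0 < c" for c :: real
    using filterlim_tendsto_pos_mult_at_top[OF tendsto_const that filterlim_real_sequentially]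
    by (simp add: mult.commute)
  show "(\<lambda>n. Z.laplace (real n)) \<longlonglongrightarrow> mass_zero"
    by (rule filterlim_compose[OF tendsto_laplace filterlim_real_sequentially])
  have "(\<lambda>n. \<integral>\<omega>. (\<Prod>i<offspring \<omega>. Z.laplace (exp (ln (real (Suc n)) - V i \<omega>))) \<partial>M)
      \<longlonglongrightarrow> (\<integral>\<omega>. mass_zero ^ offspring \<omega> \<partial>M)"
  proof (rule integral_dominated_convergence[where w = "\<lambda>_. 1"])
    show "AE \<omega> in M. (\<lambda>n. \<Prod>i<offspring \<omega>. Z.laplace (exp (ln (real (Suc n)) - V i \<omega>)))
        \<longlonglongrightarrow> mass_zero ^ offspring \<omega>"
    proof (rule AE_I2)
      fix \<omega>
      have "(\<lambda>n. \<Prod>i<offspring \<omega>. Z.laplace (real (Suc n) * exp (- V i \<omega>)))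
          \<longlonglongrightarrow> (\<Prod>i<offspring \<omega>. mass_zero)"
        by (intro tendsto_prod filterlim_compose[OF tendsto_laplace]
            filterlim_compose[OF lim filterlim_Suc]) simp
      then show "(\<lambda>n. \<Prod>i<offspring \<omega>. Z.laplace (exp (ln (real (Suc n)) - V i \<omega>)))
          \<longlonglongrightarrow> mass_zero ^ offspring \<omega>"
        by (simp add: exp_diff exp_minus divide_inverse)
    qed
    show "AE \<omega> in M. norm (\<Prod>i<offspring \<omega>. Z.laplace (exp (ln (real (Suc n)) - V i \<omega>))) \<le> 1" for n
    proof (rule AE_I2)
      fix \<omega>
      show "norm (\<Prod>i<offspring \<omega>. Z.laplace (exp (ln (real (Suc n)) - V i \<omega>))) \<le> 1"
        using transform.prod_\<Phi>_bounds[of "\<lambda>i. ln (real (Suc n)) - V i \<omega>" "offspring \<omega>"]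
        by (simp del: of_nat_Suc)
    qed
  qed auto
  then have "(\<lambda>n. Z.laplace (real (Suc n))) \<longlonglongrightarrow> (\<integral>\<omega>. mass_zero ^ offspring \<omega> \<partial>M)"
    using transform.\<Phi>_eq[of "ln (real (Suc n))" for n] by simp
  then show "(\<lambda>n. Z.laplace (real n)) \<longlonglongrightarrow> (\<integral>\<omega>. mass_zero ^ offspring \<omega> \<partial>M)"
    by (rule LIMSEQ_imp_Suc)
qed

end

section \<open>The extinction probability\<close>

text \<open>The tree is finite and all its words are shorter than \<open>n\<close>.\<close>

primrec dies_before :: "('a \<Rightarrow> enat) \<Rightarrow> nat \<Rightarrow> (nat list \<Rightarrow> 'a) \<Rightarrow> bool" where
  "dies_before \<nu> 0 \<omega> \<longleftrightarrow> False"
| "dies_before \<nu> (Suc n) \<omega> \<longleftrightarrow>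
     \<nu> (\<omega> []) \<noteq> \<infinity> \<and> (\<forall>i. enat i < \<nu> (\<omega> []) \<longrightarrow> dies_before \<nu> n (\<lambda>u. \<omega> (i # u)))"

lemma Nil_in_gw_tree: "[] \<in> gw_tree \<nu> \<omega>"
  by (simp add: gw_tree_def)

lemma Cons_in_gw_tree:
  "i # v \<in> gw_tree \<nu> \<omega> \<longleftrightarrow> enat i < \<nu> (\<omega> []) \<and> v \<in> gw_tree \<nu> (\<lambda>u. \<omega> (i # u))"
  by (auto simp: gw_tree_def less_Suc_eq_0_disj)

lemma gw_tree_eq:
  "gw_tree \<nu> \<omega> = insert [] (\<Union>i\<in>{i. enat i < \<nu> (\<omega> [])}. (#) i ` gw_tree \<nu> (\<lambda>u. \<omega> (i # u)))"
proof (rule set_eqI)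
  fix u
  show "u \<in> gw_tree \<nu> \<omega> \<longleftrightarrow>
      u \<in> insert [] (\<Union>i\<in>{i. enat i < \<nu> (\<omega> [])}. (#) i ` gw_tree \<nu> (\<lambda>u. \<omega> (i # u)))"
    by (cases u) (auto simp: Nil_in_gw_tree Cons_in_gw_tree)
qed

text \<open>Writes extinction as a countable increasing union of events that decompose at the root,
  which provides both measurability and the generation recursion.\<close>

lemma finite_gw_tree_iff: "finite (gw_tree \<nu> \<omega>) \<longleftrightarrow> (\<exists>n. dies_before \<nu> n \<omega>)"
proof
  assume "\<exists>n. dies_before \<nu> n \<omega>"
  then obtain n where "dies_before \<nu> n \<omega>" ..
  then show "finite (gw_tree \<nu> \<omega>)"
  proof (induction n arbitrary: \<omega>)
    case (Suc n)
    then obtain m where m: "\<nu> (\<omega> []) = enat m" by auto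
    have "finite {i. enat i < \<nu> (\<omega> [])}" by (simp add: m)
    with Suc show ?case by (subst gw_tree_eq) auto
  qed simp
next
  have "dies_before \<nu> n \<omega>"
    if "finite (gw_tree \<nu> \<omega>)" "\<forall>u\<in>gw_tree \<nu> \<omega>. length u < n" for n \<omega>
    using that
  proof (induction n arbitrary: \<omega>)
    case 0
    then show ?case using Nil_in_gw_tree by auto
  next
    case (Suc n)
    have "\<nu> (\<omega> []) \<noteq> \<infinity>"
    proof
      assume "\<nu> (\<omega> []) = \<infinity>"
      then have "(\<lambda>i. [i]) ` UNIV \<subseteq> gw_tree \<nu> \<omega>"
        by (auto simp: Cons_in_gw_tree Nil_in_gw_tree)
      then have "finite ((\<lambda>i :: nat. [i]) ` UNIV)" using Suc.prems(1) by (rule finite_subset)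
      then have "finite (UNIV :: nat set)" by (rule finite_imageD) (simp add: inj_on_def)
      then show False by simp
    qed
    moreover have "dies_before \<nu> n (\<lambda>u. \<omega> (i # u))" if i: "enat i < \<nu> (\<omega> [])" for i
    proof (rule Suc.IH)
      have "(#) i ` gw_tree \<nu> (\<lambda>u. \<omega> (i # u)) \<subseteq> gw_tree \<nu> \<omega>"
        using i by (auto simp: Cons_in_gw_tree)
      then have "finite ((#) i ` gw_tree \<nu> (\<lambda>u. \<omega> (i # u)))" using Suc.prems(1) by (rule finite_subset)
      then show "finite (gw_tree \<nu> (\<lambda>u. \<omega> (i # u)))" by (rule finite_imageD) simp
      show "\<forall>u\<in>gw_tree \<nu> (\<lambda>u. \<omega> (i # u)). length u < n"
      proof
        fix u assume "u \<in> gw_tree \<nu> (\<lambda>u. \<omega> (i # u))"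
        then have "i # u \<in> gw_tree \<nu> \<omega>" using i by (simp add: Cons_in_gw_tree)
        then show "length u < n" using Suc.prems(2) by fastforce
      qed
    qed
    ultimately show ?case by simp
  qed
  moreover assume fin: "finite (gw_tree \<nu> \<omega>)"
  moreover have "\<forall>u\<in>gw_tree \<nu> \<omega>. length u < Suc (Max (length ` gw_tree \<nu> \<omega>))"
    using fin by (auto simp: less_Suc_eq_le)
  ultimately show "\<exists>n. dies_before \<nu> n \<omega>" by blast
qed

lemma dies_before_Suc: "dies_before \<nu> n \<omega> \<Longrightarrow> dies_before \<nu> (Suc n) \<omega>"
  by (induction n arbitrary: \<omega>) auto

text \<open>
  \<open>(1 - w) (1 + w + \<dots> + w\<^bsup>N - 1\<^esup>) = 1 - w\<^bsup>N\<^esup>\<close> turns the fixed point equation into a sum with mean 1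
  that is strictly increasing in \<open>w\<close>.
\<close>

lemma (in prob_space) generating_function_fixpoint_unique:
  assumes [measurable]: "N \<in> measurable M (count_space (UNIV :: nat set))"
    and branching: "\<not> (AE \<omega> in M. N \<omega> \<le> 1)"
    and s: "0 \<le> s" "s \<le> z" "z < 1" "(\<integral>\<omega>. s ^ N \<omega> \<partial>M) = s" "(\<integral>\<omega>. z ^ N \<omega> \<partial>M) = z"
  shows "s = (z :: real)"
proof (rule ccontr)
  assume "s \<noteq> z"
  with s have "s < z" by simp
  let ?g = "\<lambda>w \<omega>. (\<Sum>k<N \<omega>. w ^ k) :: real"
  have g: "integrable M (?g w)" "(\<integral>\<omega>. ?g w \<omega> \<partial>M) = 1"
    if w: "0 \<le> w" "w < 1" "(\<integral>\<omega>. w ^ N \<omega> \<partial>M) = w" for w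
  proof -
    have eq: "?g w = (\<lambda>\<omega>. (1 - w ^ N \<omega>) / (1 - w))"
      using w by (simp add: fun_eq_iff sum_gp_strict)
    have int: "integrable M (\<lambda>\<omega>. w ^ N \<omega>)"
      using w by (intro integrable_const_bound[where B = 1]) (auto simp: power_le_one)
    show "integrable M (?g w)" unfolding eq using int by simp
    show "(\<integral>\<omega>. ?g w \<omega> \<partial>M) = 1" unfolding eq using int w by (simp add: prob_space)
  qed
  have gs: "integrable M (?g s)" "(\<integral>\<omega>. ?g s \<omega> \<partial>M) = 1" and gz: "integrable M (?g z)" "(\<integral>\<omega>. ?g z \<omega> \<partial>M) = 1"
    using g[of s] g[of z] s by auto
  have mono: "s ^ k \<le> z ^ k" for k using s by (intro power_mono)
  have "(\<integral>\<omega>. ?g z \<omega> - ?g s \<omega> \<partial>M) = 0" using gs gz by simp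
  moreover have "AE \<omega> in M. 0 \<le> ?g z \<omega> - ?g s \<omega>" using mono by (intro AE_I2) (simp add: sum_mono)
  ultimately have "AE \<omega> in M. ?g z \<omega> - ?g s \<omega> = 0"
    using integral_nonneg_eq_0_iff_AE[of M "\<lambda>\<omega>. ?g z \<omega> - ?g s \<omega>"] gs gz by simp
  then have "AE \<omega> in M. N \<omega> \<le> 1"
  proof eventually_elim
    case (elim \<omega>)
    show ?case
    proof (rule ccontr)
      assume "\<not> N \<omega> \<le> 1"
      then have "?g s \<omega> < ?g z \<omega>"
        using mono \<open>s < z\<close> by (intro sum_strict_mono_ex1) (auto intro!: bexI[of _ 1])
      with elim show False by simp
    qed
  qed
  with branching show False by simp
qed

section \<open>Independent subtrees and the Galton-Watson recursion\<close>

context finite_point_process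
begin

abbreviation environment :: "(nat list \<Rightarrow> 'a) measure" where
  "environment \<equiv> \<Pi>\<^sub>M u\<in>(UNIV :: nat list set). M"

interpretation E: prob_space environment
  by (intro prob_space_PiM) unfold_locales

lemma measurable_subtree:
  assumes "range ((#) i) \<subseteq> K"
  shows "(\<lambda>\<omega> u. \<omega> (i # u)) \<in> measurable (PiM K (\<lambda>_. M)) environment"
  using assms by (intro measurable_PiM_single') (auto simp: space_PiM intro!: measurable_component_singleton)

lemma measurable_root:
  assumes "[] \<in> K" "h \<in> measurable M N'"
  shows "(\<lambda>\<omega>. h (\<omega> [])) \<in> measurable (PiM K (\<lambda>_. M)) N'"
  by (rule measurable_compose[OF _ assms(2)]) (rule measurable_component_singleton[OF assms(1)])

lemma measurable_dies_before [measurable]: "Measurable.pred environment (dies_before \<nu> n)"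
proof (induction n)
  case (Suc n)
  note [measurable] = measurable_compose[OF measurable_subtree[OF subset_UNIV] Suc]
    measurable_root[OF UNIV_I pred_less_number]
  have [measurable]: "Measurable.pred environment (\<lambda>\<omega>. \<nu> (\<omega> []) \<noteq> \<infinity>)"
    by (rule measurable_root[OF UNIV_I measurable_compose[OF measurable_number]]) simp
  show ?case unfolding dies_before.simps(2) by measurable
qed simp

lemma distr_subtree: "distr environment environment (\<lambda>\<omega> u. \<omega> (i # u)) = environment"
  using distr_PiM_reindex[of UNIV "\<lambda>_. M" "(#) i" UNIV] prob_space_axioms
  by (simp add: restrict_def inj_on_def)

definition dies_prob :: "nat \<Rightarrow> real" where
  "dies_prob n = measure environment {\<omega> \<in> space environment. dies_before \<nu> n \<omega>}"

lemma prob_dies_before_subtree: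
  "measure environment {\<omega> \<in> space environment. dies_before \<nu> n (\<lambda>u. \<omega> (i # u))} = dies_prob n"
proof -
  have "dies_prob n = measure (distr environment environment (\<lambda>\<omega> u. \<omega> (i # u)))
      {\<omega> \<in> space environment. dies_before \<nu> n \<omega>}"
    unfolding distr_subtree dies_prob_def ..
  also have "\<dots> = measure environment ((\<lambda>\<omega> u. \<omega> (i # u)) -` {\<omega> \<in> space environment. dies_before \<nu> n \<omega>} \<inter> space environment)"
    by (rule measure_distr[OF measurable_subtree[OF subset_UNIV]]) measurable
  also have "(\<lambda>\<omega> u. \<omega> (i # u)) -` {\<omega> \<in> space environment. dies_before \<nu> n \<omega>} \<inter> space environment
      = {\<omega> \<in> space environment. dies_before \<nu> n (\<lambda>u. \<omega> (i # u))}"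
    by (auto simp: space_PiM)
  finally show ?thesis ..
qed

lemma prob_root_number:
  "measure environment {\<omega> \<in> space environment. \<nu> (\<omega> []) = k} = prob {\<omega> \<in> space M. \<nu> \<omega> = k}"
proof -
  have [measurable]: "{\<omega> \<in> space M. \<nu> \<omega> = k} \<in> sets M"
    using measurable_sets[OF measurable_number, of "{k}"] by (simp add: vimage_def Int_def conj_commute)
  have "prob {\<omega> \<in> space M. \<nu> \<omega> = k} = measure (distr environment M (\<lambda>\<omega>. \<omega> [])) {\<omega> \<in> space M. \<nu> \<omega> = k}"
    using prob_space_axioms by (subst distr_PiM_component) auto
  also have "\<dots> = measure environment ((\<lambda>\<omega>. \<omega> []) -` {\<omega> \<in> space M. \<nu> \<omega> = k} \<inter> space environment)"
    by (intro measure_distr) auto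
  also have "(\<lambda>\<omega>. \<omega> []) -` {\<omega> \<in> space M. \<nu> \<omega> = k} \<inter> space environment
      = {\<omega> \<in> space environment. \<nu> (\<omega> []) = k}"
    by (auto simp: space_PiM)
  finally show ?thesis ..
qed

text \<open>The root reads only the coordinate \<open>[]\<close>, and the subtree of child
  \<open>i\<close> only words starting with \<open>i\<close>. These blocks, indexed by
  \<open>nat option\<close>, are disjoint, hence independent, and each subtree has the law of the
  whole tree.\<close>

lemma prob_root_and_subtrees:
  "measure environment {\<omega> \<in> space environment. \<nu> (\<omega> []) = enat k \<and> (\<forall>i<k. dies_before \<nu> n (\<lambda>u. \<omega> (i # u)))}
    = prob {\<omega> \<in> space M. \<nu> \<omega> = enat k} * dies_prob n ^ k"
proof -
  define K :: "nat option \<Rightarrow> nat list set" where "K j = (case j of None \<Rightarrow> {[]} | Some i \<Rightarrow> range ((#) i))" for j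
  define Y where "Y j r = (case j of None \<Rightarrow> \<nu> (r []) = enat k | Some i \<Rightarrow> dies_before \<nu> n (\<lambda>u. r (i # u)))"
    for j and r :: "nat list \<Rightarrow> 'a"
  have "E.indep_vars (\<lambda>j. PiM (K j) (\<lambda>_. M)) (\<lambda>j \<omega>. restrict (\<lambda>u. \<omega> u) (K j)) UNIV"
    by (intro E.indep_vars_restrict[OF indep_vars_PiM_coordinates] prob_space_axioms)
      (auto simp: disjoint_family_on_def K_def split: option.splits)
  then have indep: "E.indep_vars (\<lambda>_. count_space UNIV) (\<lambda>j \<omega>. Y j (restrict (\<lambda>u. \<omega> u) (K j))) UNIV"
  proof (rule E.indep_vars_compose2)
    fix j :: "nat option"
    show "Y j \<in> measurable (PiM (K j) (\<lambda>_. M)) (count_space UNIV)"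
    proof (cases j)
      case None
      have "(\<lambda>r. \<nu> (r []) = enat k) \<in> measurable (PiM (K None) (\<lambda>_. M)) (count_space UNIV)"
        by (rule measurable_root[OF _ measurable_compose[OF measurable_number]]) (simp_all add: K_def)
      moreover have "Y None = (\<lambda>r. \<nu> (r []) = enat k)" by (simp add: Y_def fun_eq_iff)
      ultimately show ?thesis by (simp add: None)
    next
      case (Some i)
      have "(\<lambda>r. dies_before \<nu> n (\<lambda>u. r (i # u))) \<in> measurable (PiM (K (Some i)) (\<lambda>_. M)) (count_space UNIV)"
        by (rule measurable_compose[OF measurable_subtree measurable_dies_before]) (simp add: K_def)
      moreover have "Y (Some i) = (\<lambda>r. dies_before \<nu> n (\<lambda>u. r (i # u)))" by (simp add: Y_def fun_eq_iff)
      ultimately show ?thesis by (simp add: Some)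
    qed
  qed
  have YK: "Y j (restrict (\<lambda>u. \<omega> u) (K j)) = Y j \<omega>" for j \<omega>
    by (cases j) (simp_all add: Y_def K_def)
  define J where "J = insert None (Some ` {..<k})"
  have "E.prob (\<Inter>j\<in>J. (\<lambda>\<omega>. Y j (restrict (\<lambda>u. \<omega> u) (K j))) -` {True} \<inter> space environment)
      = (\<Prod>j\<in>J. E.prob ((\<lambda>\<omega>. Y j (restrict (\<lambda>u. \<omega> u) (K j))) -` {True} \<inter> space environment))"
    by (rule E.indep_varsD[OF indep]) (auto simp: J_def)
  also have "(\<Inter>j\<in>J. (\<lambda>\<omega>. Y j (restrict (\<lambda>u. \<omega> u) (K j))) -` {True} \<inter> space environment)
      = {\<omega> \<in> space environment. \<nu> (\<omega> []) = enat k \<and> (\<forall>i<k. dies_before \<nu> n (\<lambda>u. \<omega> (i # u)))}"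
    unfolding YK by (auto simp: J_def Y_def)
  also have "(\<Prod>j\<in>J. E.prob ((\<lambda>\<omega>. Y j (restrict (\<lambda>u. \<omega> u) (K j))) -` {True} \<inter> space environment))
      = (\<Prod>j\<in>J. E.prob {\<omega> \<in> space environment. Y j \<omega>})"
    unfolding YK by (intro prod.cong refl arg_cong[where f = E.prob]) auto
  also have "\<dots> = E.prob {\<omega> \<in> space environment. \<nu> (\<omega> []) = enat k}
      * (\<Prod>i<k. E.prob {\<omega> \<in> space environment. dies_before \<nu> n (\<lambda>u. \<omega> (i # u))})"
    unfolding J_def by (subst prod.insert) (auto simp: prod.reindex Y_def)
  also have "\<dots> = prob {\<omega> \<in> space M. \<nu> \<omega> = enat k} * dies_prob n ^ k"
    by (simp add: prob_root_number prob_dies_before_subtree)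
  finally show ?thesis .
qed

lemma dies_prob_bounds: "0 \<le> dies_prob n" "dies_prob n \<le> 1"
  by (auto simp: dies_prob_def)

text \<open>Each generation applies the offspring generating function once: dying before
  \<open>Suc n\<close> forces a finite number k of children of the root, so the event splits into
  disjoint pieces over k.\<close>

lemma dies_prob_Suc: "dies_prob (Suc n) = (\<integral>\<omega>. dies_prob n ^ offspring \<omega> \<partial>M)"
proof -
  let ?s = "dies_prob n"
  let ?D = "\<lambda>k. {\<omega> \<in> space environment. \<nu> (\<omega> []) = enat k \<and> (\<forall>i<k. dies_before \<nu> n (\<lambda>u. \<omega> (i # u)))}"
  have [measurable]: "Measurable.pred environment (\<lambda>\<omega>. dies_before \<nu> n (\<lambda>u. \<omega> (i # u)))" for i
    by (rule measurable_compose[OF measurable_subtree[OF subset_UNIV] measurable_dies_before])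
  have [measurable]: "Measurable.pred environment (\<lambda>\<omega>. \<nu> (\<omega> []) = enat k)" for k
    by (rule measurable_root[OF UNIV_I measurable_compose[OF measurable_number]]) simp
  have "(\<lambda>k. measure environment (?D k)) sums measure environment (\<Union>k. ?D k)"
    by (rule E.finite_measure_UNION) (auto simp: disjoint_family_on_def)
  also have "(\<Union>k. ?D k) = {\<omega> \<in> space environment. dies_before \<nu> (Suc n) \<omega>}"
  proof (intro set_eqI)
    fix \<omega>
    show "\<omega> \<in> (\<Union>k. ?D k) \<longleftrightarrow> \<omega> \<in> {\<omega> \<in> space environment. dies_before \<nu> (Suc n) \<omega>}"
      by (cases "\<nu> (\<omega> [])") auto
  qed
  finally have 1: "(\<lambda>k. prob {\<omega> \<in> space M. \<nu> \<omega> = enat k} * ?s ^ k) sums dies_prob (Suc n)"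
    unfolding prob_root_and_subtrees dies_prob_def[of "Suc n", symmetric] .
  have [measurable]: "{\<omega> \<in> space M. \<nu> \<omega> = enat k} \<in> sets M" for k
    using measurable_sets[OF measurable_number, of "{enat k}"] by (simp add: vimage_def Int_def conj_commute)
  have "(\<integral>\<^sup>+\<omega>. ennreal (?s ^ offspring \<omega>) \<partial>M)
      = (\<integral>\<^sup>+\<omega>. (\<Sum>k. ennreal (?s ^ k) * indicator {\<omega> \<in> space M. \<nu> \<omega> = enat k} \<omega>) \<partial>M)"
  proof (rule nn_integral_cong_AE)
    show "AE \<omega> in M. ennreal (?s ^ offspring \<omega>) = (\<Sum>k. ennreal (?s ^ k) * indicator {\<omega> \<in> space M. \<nu> \<omega> = enat k} \<omega>)"
      using finite_number AE_space
    proof eventually_elim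
      case (elim \<omega>)
      then obtain m where m: "\<nu> \<omega> = enat m" by auto
      have "(\<Sum>k. ennreal (?s ^ k) * indicator {\<omega> \<in> space M. \<nu> \<omega> = enat k} \<omega>)
          = (\<Sum>k\<in>{m}. ennreal (?s ^ k) * indicator {\<omega> \<in> space M. \<nu> \<omega> = enat k} \<omega>)"
        by (rule suminf_finite) (auto simp: m)
      then show ?case using elim(2) by (simp add: m offspring_def)
    qed
  qed
  also have "\<dots> = (\<Sum>k. \<integral>\<^sup>+\<omega>. ennreal (?s ^ k) * indicator {\<omega> \<in> space M. \<nu> \<omega> = enat k} \<omega> \<partial>M)"
    by (rule nn_integral_suminf) measurable
  also have "\<dots> = (\<Sum>k. ennreal (prob {\<omega> \<in> space M. \<nu> \<omega> = enat k} * ?s ^ k))"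
    using dies_prob_bounds
    by (intro suminf_cong) (simp add: nn_integral_cmult_indicator emeasure_eq_measure ennreal_mult[symmetric] mult.commute)
  also have "\<dots> = ennreal (dies_prob (Suc n))"
    using 1 dies_prob_bounds by (intro suminf_ennreal_eq) auto
  finally have "(\<integral>\<^sup>+\<omega>. ennreal (?s ^ offspring \<omega>) \<partial>M) = ennreal (dies_prob (Suc n))" .
  then show ?thesis
    using dies_prob_bounds by (subst integral_eq_nn_integral) auto
qed

lemma tendsto_dies_prob: "dies_prob \<longlonglongrightarrow> extinction_prob M \<nu>"
proof -
  let ?D = "\<lambda>n. {\<omega> \<in> space environment. dies_before \<nu> n \<omega>}"
  have "(\<lambda>n. measure environment (?D n)) \<longlonglongrightarrow> measure environment (\<Union>n. ?D n)"
  proof (rule E.finite_Lim_measure_incseq)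
    show "incseq ?D" by (rule incseq_SucI) (auto intro: dies_before_Suc simp del: dies_before.simps)
  qed auto
  also have "(\<Union>n. ?D n) = {\<omega> \<in> space environment. finite (gw_tree \<nu> \<omega>)}"
    by (auto simp: finite_gw_tree_iff)
  finally show ?thesis by (simp add: dies_prob_def[abs_def] extinction_prob_def)
qed

text \<open>The iterates of the generating function start at 0, so by monotonicity they stay below
  every fixed point \<open>z\<close>. Their limit is a fixed point below 1 itself, and there is only
  one.\<close>

lemma extinction_prob_eq:
  assumes branching: "\<not> (AE \<omega> in M. offspring \<omega> \<le> 1)"
    and z: "0 \<le> z" "z < 1" "(\<integral>\<omega>. z ^ offspring \<omega> \<partial>M) = z"
  shows "extinction_prob M \<nu> = z"
proof (rule generating_function_fixpoint_unique[OF measurable_offspring branching])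
  have int: "integrable M (\<lambda>\<omega>. w ^ offspring \<omega>)" if "0 \<le> w" "w \<le> 1" for w :: real
    using that by (intro integrable_const_bound[where B = 1]) (auto simp: power_le_one)
  have le: "dies_prob n \<le> z" for n
  proof (induction n)
    case (Suc n)
    have "dies_prob (Suc n) \<le> (\<integral>\<omega>. z ^ offspring \<omega> \<partial>M)"
      unfolding dies_prob_Suc using Suc z dies_prob_bounds
      by (intro integral_mono int power_mono) auto
    then show ?case using z by simp
  qed (use z in \<open>simp add: dies_prob_def\<close>)
  show "extinction_prob M \<nu> \<le> z"
    using le by (intro LIMSEQ_le_const2[OF tendsto_dies_prob]) auto
  have "(\<lambda>n. \<integral>\<omega>. dies_prob n ^ offspring \<omega> \<partial>M) \<longlonglongrightarrow> (\<integral>\<omega>. extinction_prob M \<nu> ^ offspring \<omega> \<partial>M)"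
    using dies_prob_bounds
    by (intro integral_dominated_convergence[where w = "\<lambda>_. 1"] AE_I2 tendsto_power tendsto_dies_prob)
      (auto simp: power_le_one)
  moreover have "(\<lambda>n. \<integral>\<omega>. dies_prob n ^ offspring \<omega> \<partial>M) \<longlonglongrightarrow> extinction_prob M \<nu>"
    unfolding dies_prob_Suc[symmetric] by (rule LIMSEQ_Suc[OF tendsto_dies_prob])
  ultimately show "(\<integral>\<omega>. extinction_prob M \<nu> ^ offspring \<omega> \<partial>M) = extinction_prob M \<nu>"
    by (rule LIMSEQ_unique)
qed (use z in \<open>auto simp: extinction_prob_def\<close>)

end

section \<open>Asymptotics of solutions\<close>

context point_process
begin

text \<open>Infinitely many terms of size at least \<open>c\<close> would make the sum infinite,
  which a finite mean excludes almost surely.\<close>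

lemma finite_number_if_bounded_below:
  assumes c: "0 < c" and f: "\<And>i. f i \<in> borel_measurable M"
    and fin: "(\<integral>\<^sup>+\<omega>. child_sum \<nu> \<omega> (\<lambda>i. f i \<omega>) \<partial>M) < \<infinity>"
    and ge: "AE \<omega> in M. \<forall>i. enat i < \<nu> \<omega> \<longrightarrow> ennreal c \<le> f i \<omega>"
  shows "AE \<omega> in M. \<nu> \<omega> \<noteq> \<infinity>"
proof -
  have "AE \<omega> in M. child_sum \<nu> \<omega> (\<lambda>i. f i \<omega>) \<noteq> \<infinity>"
    using fin f by (intro nn_integral_noteq_infinite measurable_child_sum) auto
  with ge show ?thesis
  proof eventually_elim
    case (elim \<omega>)
    show ?case
    proof
      assume "\<nu> \<omega> = \<infinity>"
      then have "child_sum \<nu> \<omega> (\<lambda>i. f i \<omega>) = \<top>" using elim(1) c by (intro child_sum_infinite) auto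
      with elim(2) show False by simp
    qed
  qed
qed

text \<open>A displacement cannot make both exponentials small:
  \<open>exp (- \<kappa> * v) + exp (a * v)\<close> is at least 1 for every real v.\<close>

lemma finite_number_if_moments:
  assumes "0 < \<kappa>" "0 < a"
    and "(\<integral>\<^sup>+\<omega>. child_sum \<nu> \<omega> (\<lambda>i. ennreal (exp (- \<kappa> * V i \<omega>))) \<partial>M) < \<infinity>"
    and "(\<integral>\<^sup>+\<omega>. child_sum \<nu> \<omega> (\<lambda>i. ennreal (exp (a * V i \<omega>))) \<partial>M) < \<infinity>"
  shows "AE \<omega> in M. \<nu> \<omega> \<noteq> \<infinity>"
proof (rule finite_number_if_bounded_below)
  let ?f = "\<lambda>i \<omega>. ennreal (exp (- \<kappa> * V i \<omega>)) + ennreal (exp (a * V i \<omega>))"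
  have "child_sum \<nu> \<omega> (\<lambda>i. ?f i \<omega>) = child_sum \<nu> \<omega> (\<lambda>i. ennreal (exp (- \<kappa> * V i \<omega>)))
      + child_sum \<nu> \<omega> (\<lambda>i. ennreal (exp (a * V i \<omega>)))" for \<omega>
    unfolding child_sum_def by (subst suminf_add) (auto intro!: suminf_cong simp del: ennreal_plus)
  then have "(\<integral>\<^sup>+\<omega>. child_sum \<nu> \<omega> (\<lambda>i. ?f i \<omega>) \<partial>M)
      = (\<integral>\<^sup>+\<omega>. child_sum \<nu> \<omega> (\<lambda>i. ennreal (exp (- \<kappa> * V i \<omega>))) \<partial>M)
      + (\<integral>\<^sup>+\<omega>. child_sum \<nu> \<omega> (\<lambda>i. ennreal (exp (a * V i \<omega>))) \<partial>M)"
    by (simp add: nn_integral_add)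
  with assms(3,4) show "(\<integral>\<^sup>+\<omega>. child_sum \<nu> \<omega> (\<lambda>i. ?f i \<omega>) \<partial>M) < \<infinity>" by simp
  have "ennreal 1 \<le> ?f i \<omega>" for i \<omega>
    using exp_le_exp_add_exp[of \<kappa> 0 a "V i \<omega>"] assms(1,2)
    by (simp add: ennreal_plus[symmetric] del: ennreal_plus ennreal_1)
  then show "AE \<omega> in M. \<forall>i. enat i < \<nu> \<omega> \<longrightarrow> ennreal 1 \<le> ?f i \<omega>" by blast
qed auto

lemma finite_number_if_bounded_above:
  assumes "0 < \<kappa>"
    and "(\<integral>\<^sup>+\<omega>. child_sum \<nu> \<omega> (\<lambda>i. ennreal (exp (- \<kappa> * V i \<omega>))) \<partial>M) < \<infinity>"
    and "AE \<omega> in M. \<forall>i. enat i < \<nu> \<omega> \<longrightarrow> V i \<omega> \<le> K"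
  shows "AE \<omega> in M. \<nu> \<omega> \<noteq> \<infinity>"
proof (rule finite_number_if_bounded_below[OF _ _ assms(2)])
  show "AE \<omega> in M. \<forall>i. enat i < \<nu> \<omega> \<longrightarrow> ennreal (exp (- \<kappa> * K)) \<le> ennreal (exp (- \<kappa> * V i \<omega>))"
    using assms(3) by eventually_elim (use assms(1) in auto)
qed auto

end

context finite_point_process
begin

lemma not_AE_offspring_le_1:
  assumes "1 < (\<integral>\<^sup>+\<omega>. ennreal_of_enat (\<nu> \<omega>) \<partial>M)"
  shows "\<not> (AE \<omega> in M. offspring \<omega> \<le> 1)"
proof
  assume "AE \<omega> in M. offspring \<omega> \<le> 1"
  with finite_number have "AE \<omega> in M. ennreal_of_enat (\<nu> \<omega>) \<le> 1"
  proof eventually_elim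
    case (elim \<omega>)
    then show ?case by (cases "\<nu> \<omega>") (auto simp: offspring_def ennreal_of_enat_enat)
  qed
  then have "(\<integral>\<^sup>+\<omega>. ennreal_of_enat (\<nu> \<omega>) \<partial>M) \<le> (\<integral>\<^sup>+\<omega>. 1 \<partial>M)" by (rule nn_integral_mono_AE)
  with assms show False by (simp add: emeasure_space_1)
qed

lemma measurable_exp_sum [measurable]:
  "(\<lambda>\<omega>. \<Sum>i<offspring \<omega>. exp (c * V i \<omega>)) \<in> borel_measurable M"
  by (rule measurable_compose_countable[OF _ measurable_offspring]) simp

lemma nn_integral_exp_sum:
  "(\<integral>\<^sup>+\<omega>. child_sum \<nu> \<omega> (\<lambda>i. ennreal (exp (c * V i \<omega>))) \<partial>M)
    = (\<integral>\<^sup>+\<omega>. ennreal (\<Sum>i<offspring \<omega>. exp (c * V i \<omega>)) \<partial>M)"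
  using nn_integral_child_sum[of "\<lambda>i \<omega>. exp (c * V i \<omega>)" "\<lambda>_. 1"] by simp

lemma integrable_exp_sum:
  assumes "(\<integral>\<^sup>+\<omega>. child_sum \<nu> \<omega> (\<lambda>i. ennreal (exp (c * V i \<omega>))) \<partial>M) < \<infinity>"
  shows "integrable M (\<lambda>\<omega>. \<Sum>i<offspring \<omega>. exp (c * V i \<omega>))"
  using assms unfolding nn_integral_exp_sum
  by (intro integrableI_nonneg) (auto simp: sum_nonneg)

lemma integral_exp_sum_le_1:
  assumes "(\<integral>\<^sup>+\<omega>. child_sum \<nu> \<omega> (\<lambda>i. ennreal (exp (c * V i \<omega>))) \<partial>M) \<le> 1"
  shows "(\<integral>\<omega>. (\<Sum>i<offspring \<omega>. exp (c * V i \<omega>)) \<partial>M) \<le> 1"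
proof -
  have "(\<integral>\<omega>. (\<Sum>i<offspring \<omega>. exp (c * V i \<omega>)) \<partial>M)
      = enn2real (\<integral>\<^sup>+\<omega>. child_sum \<nu> \<omega> (\<lambda>i. ennreal (exp (c * V i \<omega>))) \<partial>M)"
    unfolding nn_integral_exp_sum by (intro integral_eq_nn_integral) (auto simp: sum_nonneg)
  also have "\<dots> \<le> enn2real 1" using assms by (intro enn2real_mono) auto
  finally show ?thesis by simp
qed

end

context smoothing_solution
begin

lemma laplace_pos_asymptotics:
  assumes \<kappa>: "0 < \<kappa>" "(\<integral>\<^sup>+\<omega>. child_sum \<nu> \<omega> (\<lambda>i. ennreal (exp (- \<kappa> * V i \<omega>))) \<partial>M) \<le> 1"
    and mean: "1 < (\<integral>\<^sup>+\<omega>. ennreal_of_enat (\<nu> \<omega>) \<partial>M)"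
    and \<gamma>: "0 < \<gamma>" "(\<integral>\<^sup>+\<omega>. schroeder_weight (extinction_prob M \<nu>) (\<nu> \<omega>)
        * child_sum \<nu> \<omega> (\<lambda>i. ennreal (exp (\<gamma> * V i \<omega>))) \<partial>M) = 1"
    and a: "\<gamma> < a" "(\<integral>\<^sup>+\<omega>. child_sum \<nu> \<omega> (\<lambda>i. ennreal (exp (a * V i \<omega>))) \<partial>M) < \<infinity>"
  obtains c A where "0 < c" "\<And>t. 1 \<le> t \<Longrightarrow> c * t powr (- \<gamma>) \<le> Z.laplace_pos t"
    "\<And>t. 1 \<le> t \<Longrightarrow> Z.laplace_pos t \<le> A * t powr (- \<gamma>)"
proof -
  note branching = not_AE_offspring_le_1[OF mean]
  have q: "extinction_prob M \<nu> = mass_zero"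
    by (rule extinction_prob_eq[OF branching mass_zero_bounds mass_zero_fixed])
  have int_\<kappa>: "integrable M (\<lambda>\<omega>. \<Sum>i<offspring \<omega>. exp (- \<kappa> * V i \<omega>))"
    using \<kappa>(2) by (intro integrable_exp_sum) (auto intro: le_less_trans)
  \<comment> \<open>Any exponent strictly between \<open>\<gamma>\<close> and
    \<open>2 * \<gamma>\<close> and not above \<open>a\<close> would serve; its moment is finite by
    interpolation between \<open>- \<kappa>\<close> and \<open>a\<close>.\<close>
  define a' where "a' = min a (3 * \<gamma> / 2)"
  have a': "\<gamma> < a'" "a' < 2 * \<gamma>" "a' \<le> a" "- \<kappa> \<le> a'" using \<gamma>(1) a(1) \<kappa>(1) by (auto simp: a'_def)
  interpret S: schroeder_transform M offspring V "\<lambda>x. Z.laplace (exp x)" mass_zero \<kappa> \<gamma> a'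
  proof
    show "mass_zero < Z.laplace (exp x)" for x
      using laplace_split[of "exp x"] laplace_pos_pos[of "exp x"] by simp
    show "((\<lambda>x. Z.laplace (exp x)) \<longlongrightarrow> mass_zero) at_top"
      by (rule filterlim_compose[OF tendsto_laplace exp_at_top])
    show "integrable M (\<lambda>\<omega>. \<Sum>i<offspring \<omega>. exp (a' * V i \<omega>))"
      using a' by (intro transform.integrable_moment[OF int_\<kappa> integrable_exp_sum[OF a(2)]])
    show "(\<integral>\<omega>. (\<Sum>i<offspring \<omega>. exp (- \<kappa> * V i \<omega>)) \<partial>M) \<le> 1"
      by (rule integral_exp_sum_le_1[OF \<kappa>(2)])
    let ?h = "\<lambda>\<omega>. mass_zero ^ (offspring \<omega> - 1) * (\<Sum>i<offspring \<omega>. exp (\<gamma> * V i \<omega>))"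
    have "(\<integral>\<^sup>+\<omega>. ennreal (?h \<omega>) \<partial>M) = (\<integral>\<^sup>+\<omega>. schroeder_weight (extinction_prob M \<nu>) (\<nu> \<omega>)
        * ennreal (\<Sum>i<offspring \<omega>. exp (\<gamma> * V i \<omega>)) \<partial>M)"
    proof (rule nn_integral_cong_AE)
      \<comment> \<open>Without children the truncated power is 1 while
        \<open>schroeder_weight\<close> is 0; the empty sum makes both sides agree.\<close>
      show "AE \<omega> in M. ennreal (?h \<omega>) = schroeder_weight (extinction_prob M \<nu>) (\<nu> \<omega>)
          * ennreal (\<Sum>i<offspring \<omega>. exp (\<gamma> * V i \<omega>))"
        using finite_number
      proof eventually_elim
        case (elim \<omega>)
        then show ?case
          using mass_zero_bounds(1)
          by (cases "\<nu> \<omega>") (auto simp: schroeder_weight_def q offspring_def ennreal_mult sum_nonneg Suc_le_eq)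
      qed
    qed
    also have "\<dots> = 1"
      using \<gamma>(2) nn_integral_child_sum[of "\<lambda>i \<omega>. exp (\<gamma> * V i \<omega>)"
          "\<lambda>\<omega>. schroeder_weight (extinction_prob M \<nu>) (\<nu> \<omega>)"] by simp
    finally have "(\<integral>\<^sup>+\<omega>. ennreal (?h \<omega>) \<partial>M) = 1" .
    moreover have "(\<integral>\<omega>. ?h \<omega> \<partial>M) = enn2real (\<integral>\<^sup>+\<omega>. ennreal (?h \<omega>) \<partial>M)"
      using mass_zero_bounds(1) by (intro integral_eq_nn_integral) (auto simp: sum_nonneg)
    ultimately show "(\<integral>\<omega>. ?h \<omega> \<partial>M) = 1" by simp
  qed (fact mass_zero_bounds(1) mass_zero_fixed \<kappa>(1) \<gamma>(1) a'(1,2) int_\<kappa> branching)+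
  have eq: "Z.laplace_pos t = Z.laplace (exp (ln t)) - mass_zero" "t powr (- \<gamma>) = exp (- \<gamma> * ln t)"
    if "1 \<le> t" for t
    using that laplace_split[of t] by (auto simp: powr_def)
  obtain c where c: "0 < c" "\<And>x. 0 \<le> x \<Longrightarrow> c * exp (- \<gamma> * x) \<le> Z.laplace (exp x) - mass_zero"
    by (rule S.psi_lower) blast
  obtain A where A: "\<And>x. Z.laplace (exp x) - mass_zero \<le> A * exp (- \<gamma> * x)"
    by (rule S.psi_upper) blast
  show ?thesis
  proof (rule that[OF c(1)])
    fix t :: real assume "1 \<le> t"
    show "c * t powr (- \<gamma>) \<le> Z.laplace_pos t"
      unfolding eq[OF \<open>1 \<le> t\<close>] using \<open>1 \<le> t\<close> by (intro c(2)) simp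
    show "Z.laplace_pos t \<le> A * t powr (- \<gamma>)"
      unfolding eq[OF \<open>1 \<le> t\<close>] by (rule A)
  qed
qed

end

text \<open>If the sum is less than 1, all points are positive, so the sum decreases in the exponent.\<close>

lemma exp_sum_antimono:
  fixes v :: "nat \<Rightarrow> real"
  assumes "0 < a" "a \<le> b" "(\<Sum>i<n. exp (- a * v i)) < 1"
  shows "(\<Sum>i<n. exp (- b * v i)) \<le> (\<Sum>i<n. exp (- a * v i))"
proof (rule sum_mono)
  fix i assume i: "i \<in> {..<n}"
  have "exp (- a * v i) \<le> (\<Sum>i<n. exp (- a * v i))" using i by (intro member_le_sum) auto
  then have "exp (- a * v i) < 1" using assms(3) by linarith
  then have "0 < v i" using assms(1) by (simp add: zero_less_mult_iff)
  then show "exp (- b * v i) \<le> exp (- a * v i)" using assms(2) by simp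
qed

section \<open>Location of the critical exponent\<close>

locale boettcher_process = finite_point_process +
  fixes \<kappa> K :: real
  assumes kappa_pos: "0 < \<kappa>" and K_pos: "0 < K"
    and mean_kappa: "(\<integral>\<^sup>+\<omega>. child_sum \<nu> \<omega> (\<lambda>i. ennreal (exp (- \<kappa> * V i \<omega>))) \<partial>M) \<le> 1"
    and not_constant: "\<not> (AE \<omega> in M. child_sum \<nu> \<omega> (\<lambda>i. ennreal (exp (- \<kappa> * V i \<omega>))) = 1)"
    and two_le: "AE \<omega> in M. 2 \<le> offspring \<omega>"
    and le_K: "AE \<omega> in M. \<forall>i<offspring \<omega>. V i \<omega> \<le> K"
begin

abbreviation supercritical :: "real \<Rightarrow> bool" where
  "supercritical a \<equiv> AE \<omega> in M. 1 \<le> (\<Sum>i<offspring \<omega>. exp (- a * V i \<omega>))"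

lemma boettcher_exponent_eq: "boettcher_exponent M \<nu> V = Sup {a. 0 < a \<and> supercritical a}"
proof -
  have "prob {\<omega> \<in> space M. 1 \<le> child_sum \<nu> \<omega> (\<lambda>i. ennreal (exp (- a * V i \<omega>)))} = 1 \<longleftrightarrow> supercritical a" for a
  proof (subst prob_Collect_eq_1)
    show "(AE \<omega> in M. 1 \<le> child_sum \<nu> \<omega> (\<lambda>i. ennreal (exp (- a * V i \<omega>)))) \<longleftrightarrow> supercritical a"
    proof (rule eventually_subst)
      show "AE \<omega> in M. (1 \<le> child_sum \<nu> \<omega> (\<lambda>i. ennreal (exp (- a * V i \<omega>))))
          = (1 \<le> (\<Sum>i<offspring \<omega>. exp (- a * V i \<omega>)))"
        using finite_number
        by eventually_elim (simp add: child_sum_finite offspring_def ennreal_ge_1)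
    qed
  qed measurable
  then show ?thesis by (simp add: boettcher_exponent_def)
qed

lemma supercritical_antimono:
  assumes "supercritical b" "0 < a" "a \<le> b"
  shows "supercritical a"
  using assms(1)
proof eventually_elim
  case (elim \<omega>)
  show ?case
    using exp_sum_antimono[where v = "\<lambda>i. V i \<omega>" and n = "offspring \<omega>", OF assms(2,3)] elim by linarith
qed

text \<open>At this exponent a displacement of at most \<open>K\<close> contributes at least 1/2,
  and there are at least two children.\<close>

lemma supercritical_small: "supercritical (ln 2 / K)"
  using two_le le_K
proof eventually_elim
  case (elim \<omega>)
  have "exp (- (ln 2 / K) * V i \<omega>) \<ge> 1 / 2" if "i < offspring \<omega>" for i
  proof -
    have "ln 2 / K * V i \<omega> \<le> ln 2 / K * K" using elim(2) that K_pos by (intro mult_left_mono) auto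
    then have "exp (- ln 2) \<le> exp (- (ln 2 / K) * V i \<omega>)" using K_pos by simp
    then show ?thesis by (simp add: exp_minus)
  qed
  then have "(\<Sum>i<offspring \<omega>. 1 / 2) \<le> (\<Sum>i<offspring \<omega>. exp (- (ln 2 / K) * V i \<omega>))"
    by (intro sum_mono) auto
  with elim(1) show ?case by simp
qed

text \<open>A sum that is almost surely at least 1 and has mean at most 1 is almost surely equal to
  1.\<close>

lemma not_supercritical_kappa: "\<not> supercritical \<kappa>"
proof
  assume sup: "supercritical \<kappa>"
  let ?S = "\<lambda>\<omega>. \<Sum>i<offspring \<omega>. exp (- \<kappa> * V i \<omega>)"
  have int: "integrable M ?S" using mean_kappa by (intro integrable_exp_sum) (auto intro: le_less_trans)
  have "(\<integral>\<omega>. ?S \<omega> - 1 \<partial>M) \<le> 0" using integral_exp_sum_le_1[OF mean_kappa] int by (simp add: prob_space)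
  moreover have "0 \<le> (\<integral>\<omega>. ?S \<omega> - 1 \<partial>M)" using sup by (intro integral_nonneg_AE) auto
  ultimately have "(\<integral>\<omega>. ?S \<omega> - 1 \<partial>M) = 0" by simp
  moreover have "AE \<omega> in M. 0 \<le> ?S \<omega> - 1" using sup by eventually_elim linarith
  moreover have "integrable M (\<lambda>\<omega>. ?S \<omega> - 1)" using int by simp
  ultimately have "AE \<omega> in M. ?S \<omega> - 1 = 0"
    using integral_nonneg_eq_0_iff_AE[of M "\<lambda>\<omega>. ?S \<omega> - 1"] by blast
  with finite_number have "AE \<omega> in M. child_sum \<nu> \<omega> (\<lambda>i. ennreal (exp (- \<kappa> * V i \<omega>))) = 1"
  proof eventually_elim
    case (elim \<omega>)
    then have "?S \<omega> = 1" by linarith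
    then show ?case using elim(1) by (simp add: child_sum_finite offspring_def)
  qed
  with not_constant show False by simp
qed

text \<open>Supercriticality along a sequence increasing to \<open>\<kappa>\<close> would pass to
  \<open>\<kappa>\<close>, since countably many null sets can be discarded and finite sums are
  continuous in the exponent. The strict gap puts the critical exponent below
  \<open>\<kappa>\<close>, which keeps the denominator of \<open>\<beta> / (1 - \<beta>)\<close>
  positive when \<open>\<kappa> = 1\<close>.\<close>

lemma not_supercritical_below_kappa:
  obtains a where "0 < a" "a < \<kappa>" "\<not> supercritical a"
proof (rule ccontr)
  assume "\<not> thesis"
  \<comment> \<open>The offset 2 keeps every term at least \<open>\<kappa> / 2\<close>, hence
    positive.\<close>
  define a where "a n = \<kappa> - \<kappa> / real (n + 2)" for n
  have a: "0 < a n" "a n < \<kappa>" for n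
    using kappa_pos divide_strict_left_mono[of 1 "real (n + 2)" \<kappa>] by (auto simp: a_def)
  have "supercritical (a n)" for n using that a \<open>\<not> thesis\<close> by blast
  then have "AE \<omega> in M. \<forall>n. 1 \<le> (\<Sum>i<offspring \<omega>. exp (- a n * V i \<omega>))" by (simp add: AE_all_countable)
  then have "supercritical \<kappa>"
  proof eventually_elim
    case (elim \<omega>)
    have "(\<lambda>n. \<kappa> / real (n + 2)) \<longlonglongrightarrow> 0"
      by (intro tendsto_divide_0[OF tendsto_const] filterlim_at_top_imp_at_infinity
          filterlim_compose[OF filterlim_real_sequentially] filterlim_add_const_nat_at_top)
    then have "(\<lambda>n. \<kappa> - \<kappa> / real (n + 2)) \<longlonglongrightarrow> \<kappa> - 0"
      by (intro tendsto_diff tendsto_const)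
    then have "a \<longlonglongrightarrow> \<kappa>" by (simp add: a_def[abs_def])
    then have "(\<lambda>n. \<Sum>i<offspring \<omega>. exp (- a n * V i \<omega>)) \<longlonglongrightarrow> (\<Sum>i<offspring \<omega>. exp (- \<kappa> * V i \<omega>))"
      by (intro tendsto_intros)
    then show ?case using elim by (intro LIMSEQ_le_const) auto
  qed
  with not_supercritical_kappa show False by simp
qed

lemma boettcher_exponent_bounds: "0 < boettcher_exponent M \<nu> V" "boettcher_exponent M \<nu> V < \<kappa>"
  and supercritical_below: "a < boettcher_exponent M \<nu> V \<Longrightarrow> \<exists>b>a. supercritical b"
  and not_supercritical_above: "boettcher_exponent M \<nu> V < a \<Longrightarrow> \<not> supercritical a"
proof -
  let ?A = "{a. 0 < a \<and> supercritical a}"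
  obtain a0 where a0: "0 < a0" "a0 < \<kappa>" "\<not> supercritical a0" by (rule not_supercritical_below_kappa)
  have le: "b \<le> a0" if "b \<in> ?A" for b
    using that a0 supercritical_antimono[of b a0] by (cases "b \<le> a0") auto
  then have bdd: "bdd_above ?A" by (rule bdd_aboveI)
  have mem: "ln 2 / K \<in> ?A" using supercritical_small K_pos by simp
  show pos: "0 < boettcher_exponent M \<nu> V"
  proof -
    have "ln 2 / K \<le> boettcher_exponent M \<nu> V"
      unfolding boettcher_exponent_eq by (rule cSup_upper[OF mem bdd])
    moreover have "0 < ln 2 / K" using K_pos by simp
    ultimately show ?thesis by linarith
  qed
  show "boettcher_exponent M \<nu> V < \<kappa>"
  proof -
    have "boettcher_exponent M \<nu> V \<le> a0"
      unfolding boettcher_exponent_eq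
    proof (rule cSup_least)
      show "?A \<noteq> {}" using mem by blast
    qed (rule le)
    with a0(2) show ?thesis by linarith
  qed
  show "\<exists>b>a. supercritical b" if "a < boettcher_exponent M \<nu> V"
    using that mem bdd unfolding boettcher_exponent_eq by (subst (asm) less_cSup_iff) auto
  show "\<not> supercritical a" if "boettcher_exponent M \<nu> V < a"
  proof
    assume "supercritical a"
    then have "a \<in> ?A" using that pos by simp
    then have "a \<le> boettcher_exponent M \<nu> V" unfolding boettcher_exponent_eq using bdd by (rule cSup_upper)
    with that show False by simp
  qed
qed

end

locale boettcher_solution = boettcher_process M \<nu> V \<kappa> K + smoothing_solution M \<nu> V P Z
  for M :: "'a measure" and \<nu> V \<kappa> K and P :: "'b measure" and Z
begin

lemma laplace_upper:
  assumes "0 < a" "a < boettcher_exponent M \<nu> V"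
  shows "\<exists>c>0. \<forall>\<^sub>F t in at_top. Z.laplace t \<le> exp (- c * t powr a)"
proof -
  obtain b where b: "a < b" "supercritical b" using supercritical_below[OF assms(2)] by blast
  have "\<forall>\<^sub>F x in at_top. Z.laplace (exp x) < 1"
    by (rule order_tendstoD(2)[OF filterlim_compose[OF tendsto_laplace exp_at_top] mass_zero_bounds(2)])
  then obtain x0 where "Z.laplace (exp x0) < 1" by (auto simp: eventually_at_top_linorder)
  then obtain c where c: "0 < c" "\<And>x. x0 \<le> x \<Longrightarrow> Z.laplace (exp x) \<le> exp (- c * exp (a * x))"
    using transform.boettcher_upper[OF assms(1) b(1) K_pos two_le le_K b(2)] by blast
  have "\<forall>\<^sub>F t in at_top. Z.laplace t \<le> exp (- c * t powr a)"
    using eventually_ge_at_top[of "exp x0"]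
  proof eventually_elim
    case (elim t)
    have "0 < t" using less_le_trans[OF exp_gt_zero elim] .
    then show ?case using c(2)[of "ln t"] elim by (simp add: powr_def ln_ge_iff)
  qed
  with c(1) show ?thesis by blast
qed

lemma laplace_lower:
  assumes "boettcher_exponent M \<nu> V < a"
  shows "\<exists>C>0. \<forall>\<^sub>F t in at_top. exp (- C * t powr a) \<le> Z.laplace t"
proof -
  have "0 < a" using assms boettcher_exponent_bounds(1) by simp
  then obtain C where C: "0 < C" "\<And>x. 0 \<le> x \<Longrightarrow> exp (- C * exp (a * x)) \<le> Z.laplace (exp x)"
    using transform.boettcher_lower[OF _ K_pos le_K not_supercritical_above[OF assms]] by blast
  have "\<forall>\<^sub>F t in at_top. exp (- C * t powr a) \<le> Z.laplace t"
    using eventually_ge_at_top[of 1]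
  proof eventually_elim
    case (elim t)
    then show ?case using C(2)[of "ln t"] by (simp add: powr_def)
  qed
  with C(1) show ?thesis by blast
qed

end

theorem theorem1p3:
  fixes M :: "'a measure" and \<nu> :: "'a \<Rightarrow> enat" and V :: "nat \<Rightarrow> 'a \<Rightarrow> real"
    and P :: "'b measure" and Z :: "'b \<Rightarrow> real" and \<kappa> :: real
  assumes "point_process M \<nu> V"
    and "0 < \<kappa>" and "\<kappa> \<le> 1"
    and "(\<integral>\<^sup>+\<omega>. child_sum \<nu> \<omega> (\<lambda>i. ennreal (exp (- \<kappa> * V i \<omega>))) \<partial>M) \<le> 1"
    and "1 < (\<integral>\<^sup>+\<omega>. ennreal_of_enat (\<nu> \<omega>) \<partial>M)"
    and "nontrivial_solution M \<nu> V P Z"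
  shows
    "(\<forall>\<gamma>>0.
        (\<integral>\<^sup>+\<omega>. schroeder_weight (extinction_prob M \<nu>) (\<nu> \<omega>)
              * child_sum \<nu> \<omega> (\<lambda>i. ennreal (exp (\<gamma> * V i \<omega>))) \<partial>M) = 1 \<longrightarrow>
        (\<exists>a>\<gamma>. (\<integral>\<^sup>+\<omega>. child_sum \<nu> \<omega> (\<lambda>i. ennreal (exp (a * V i \<omega>))) \<partial>M) < \<infinity>) \<longrightarrow>
        same_order (\<lambda>\<epsilon>. measure P {x \<in> space P. 0 < Z x \<and> Z x < \<epsilon>}) (\<lambda>\<epsilon>. \<epsilon> powr \<gamma>) (at_right 0) \<and>
        same_order (\<lambda>t. \<integral>x. exp (- t * Z x) * indicator {x. 0 < Z x} x \<partial>P)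
          (\<lambda>t. t powr (- \<gamma>)) at_top)
     \<and>
     (measure M {\<omega> \<in> space M. \<nu> \<omega> = 0} = 0 \<longrightarrow>
      measure M {\<omega> \<in> space M. \<nu> \<omega> = 1} = 0 \<longrightarrow>
      (\<exists>K>0. AE \<omega> in M. \<forall>i. enat i < \<nu> \<omega> \<longrightarrow> V i \<omega> \<le> K) \<longrightarrow>
      \<not> (AE \<omega> in M. child_sum \<nu> \<omega> (\<lambda>i. ennreal (exp (- \<kappa> * V i \<omega>))) = 1) \<longrightarrow>
      (let \<beta> = boettcher_exponent M \<nu> V in
        (\<exists>\<delta>. (\<delta> \<longlongrightarrow> 0) at_top \<and>
          (\<forall>\<^sub>F t in at_top. (\<integral>x. exp (- t * Z x) \<partial>P) = exp (- (t powr (\<beta> + \<delta> t))))) \<and>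
        (\<exists>\<delta>. (\<delta> \<longlongrightarrow> 0) (at_right 0) \<and>
          (\<forall>\<^sub>F \<epsilon> in at_right 0.
            measure P {x \<in> space P. Z x < \<epsilon>} = exp (- (\<epsilon> powr (- (\<beta> / (1 - \<beta>)) + \<delta> \<epsilon>)))))))"
proof -
  interpret point_process M \<nu> V by fact
  have fin_\<kappa>: "(\<integral>\<^sup>+\<omega>. child_sum \<nu> \<omega> (\<lambda>i. ennreal (exp (- \<kappa> * V i \<omega>))) \<partial>M) < \<infinity>"
    using assms(4) by (rule le_less_trans) simp
  \<comment> \<open>Each case first derives finiteness of the family from its own hypotheses and
    only then enters the common setting.\<close>
  have solution: "smoothing_solution M \<nu> V P Z" if "AE \<omega> in M. \<nu> \<omega> \<noteq> \<infinity>"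
    by unfold_locales (fact that assms(6))+
  show ?thesis
  proof (intro conjI allI impI)
    fix \<gamma> :: real
    assume \<gamma>: "0 < \<gamma>" "(\<integral>\<^sup>+\<omega>. schroeder_weight (extinction_prob M \<nu>) (\<nu> \<omega>)
        * child_sum \<nu> \<omega> (\<lambda>i. ennreal (exp (\<gamma> * V i \<omega>))) \<partial>M) = 1"
      and "\<exists>a>\<gamma>. (\<integral>\<^sup>+\<omega>. child_sum \<nu> \<omega> (\<lambda>i. ennreal (exp (a * V i \<omega>))) \<partial>M) < \<infinity>"
    then obtain a where a: "\<gamma> < a" "(\<integral>\<^sup>+\<omega>. child_sum \<nu> \<omega> (\<lambda>i. ennreal (exp (a * V i \<omega>))) \<partial>M) < \<infinity>"
      by blast
    interpret smoothing_solution M \<nu> V P Z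
      using solution finite_number_if_moments[OF assms(2) _ fin_\<kappa> a(2)] \<gamma>(1) a(1) by simp
    obtain c A where "0 < c" "\<And>t. 1 \<le> t \<Longrightarrow> c * t powr (- \<gamma>) \<le> Z.laplace_pos t"
        "\<And>t. 1 \<le> t \<Longrightarrow> Z.laplace_pos t \<le> A * t powr (- \<gamma>)"
      using laplace_pos_asymptotics[OF assms(2,4,5) \<gamma> a] by blast
    note bounds = this
    show "same_order (\<lambda>\<epsilon>. measure P {x \<in> space P. 0 < Z x \<and> Z x < \<epsilon>}) (\<lambda>\<epsilon>. \<epsilon> powr \<gamma>) (at_right 0)"
      by (rule Z.same_order_small_values[OF \<gamma>(1) bounds])
    show "same_order (\<lambda>t. \<integral>x. exp (- t * Z x) * indicator {x. 0 < Z x} x \<partial>P) (\<lambda>t. t powr (- \<gamma>)) at_top"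
      using Z.same_order_laplace_pos[OF bounds] unfolding Z.laplace_pos_def[abs_def] .
  next
    assume zero: "measure M {\<omega> \<in> space M. \<nu> \<omega> = 0} = 0" and one: "measure M {\<omega> \<in> space M. \<nu> \<omega> = 1} = 0"
      and "\<exists>K>0. AE \<omega> in M. \<forall>i. enat i < \<nu> \<omega> \<longrightarrow> V i \<omega> \<le> K"
      and not_const: "\<not> (AE \<omega> in M. child_sum \<nu> \<omega> (\<lambda>i. ennreal (exp (- \<kappa> * V i \<omega>))) = 1)"
    then obtain K where K: "0 < K" "AE \<omega> in M. \<forall>i. enat i < \<nu> \<omega> \<longrightarrow> V i \<omega> \<le> K" by blast
    have fin: "AE \<omega> in M. \<nu> \<omega> \<noteq> \<infinity>" by (rule finite_number_if_bounded_above[OF assms(2) fin_\<kappa> K(2)])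
    have [measurable]: "{\<omega> \<in> space M. \<nu> \<omega> = k} \<in> sets M" for k
      using measurable_sets[OF measurable_number, of "{k}"] by (simp add: vimage_def Int_def conj_commute)
    have "AE \<omega> in M. \<nu> \<omega> \<noteq> 0" "AE \<omega> in M. \<nu> \<omega> \<noteq> 1"
      using zero one by (simp_all add: prob_Collect_eq_0)
    with fin have two: "AE \<omega> in M. 2 \<le> offspring \<omega>"
    proof eventually_elim
      case (elim \<omega>)
      then obtain n where "\<nu> \<omega> = enat n" by auto
      with elim show ?case by (auto simp: offspring_def zero_enat_def one_enat_def)
    qed
    have le: "AE \<omega> in M. \<forall>i<offspring \<omega>. V i \<omega> \<le> K"
      using fin K(2)
    proof eventually_elim
      case (elim \<omega>)
      then obtain n where "\<nu> \<omega> = enat n" by auto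
      with elim show ?case by (simp add: offspring_def)
    qed
    interpret smoothing_solution M \<nu> V P Z by (rule solution[OF fin])
    interpret boettcher_solution M \<nu> V \<kappa> K P Z
      by unfold_locales (fact assms(2,4) K(1) not_const two le)+
    let ?\<beta> = "boettcher_exponent M \<nu> V"
    have \<beta>: "0 < ?\<beta>" "?\<beta> < 1" using boettcher_exponent_bounds assms(3) by auto
    obtain \<delta> where "(\<delta> \<longlongrightarrow> 0) at_top" "\<forall>\<^sub>F t in at_top. Z.laplace t = exp (- (t powr (?\<beta> + \<delta> t)))"
      using Z.laplace_exponent[OF \<beta> laplace_upper laplace_lower] by blast
    moreover obtain \<delta>' where "(\<delta>' \<longlongrightarrow> 0) (at_right 0)"
      "\<forall>\<^sub>F \<epsilon> in at_right 0. measure P {x \<in> space P. Z x < \<epsilon>} = exp (- (\<epsilon> powr (- (?\<beta> / (1 - ?\<beta>)) + \<delta>' \<epsilon>)))"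
      using Z.small_value_exponent[OF \<beta> laplace_upper laplace_lower] by blast
    ultimately show "let \<beta> = ?\<beta> in
        (\<exists>\<delta>. (\<delta> \<longlongrightarrow> 0) at_top \<and>
          (\<forall>\<^sub>F t in at_top. (\<integral>x. exp (- t * Z x) \<partial>P) = exp (- (t powr (\<beta> + \<delta> t))))) \<and>
        (\<exists>\<delta>. (\<delta> \<longlongrightarrow> 0) (at_right 0) \<and>
          (\<forall>\<^sub>F \<epsilon> in at_right 0.
            measure P {x \<in> space P. Z x < \<epsilon>} = exp (- (\<epsilon> powr (- (\<beta> / (1 - \<beta>)) + \<delta> \<epsilon>)))))"
      unfolding Let_def Z.laplace_def by blast
  qed
qed

end
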